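(* Let $\Phi$ be a Young function with $\Phi\in\Delta_2$. For any convex function $f:L_{\Phi^*}\to\mathbb R$, the following are equivalent: (1) $f$ is $\tau(L_{\Phi^*},L_\Phi)$-continuous on $L_{\Phi^*}$; (2) $f$ is sequentially $\tau(L_{\Phi^*},L_\Phi)$-continuous on $L_{\Phi^*}$; (3) $f$ is sequentially $\tau(L_{\Phi^*},L_\Phi)$-continuous on closed balls $\lambda\mathbb B_{\Phi^*}$ ($\lambda>0$); (4) $f$ is sequentially $\tau(L_{\Phi^*},L_\Phi)$-continuous on order intervals $[-\zeta,\zeta]$ ($\zeta\in L_{\Phi^*}$); (5) $f$ is $\tau_{L_0}$-continuous on order intervals, or equivalently order continuous, i.e. $f(\xi)=\lim_nf(\xi_n)$ whenever $\xi_n\to\xi$ a.s. and $(\xi_n)_n$ is order bounded in $L_{\Phi^*}$.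
   Context: $(\Omega,\mathcal F,\mathbb P)$ is a probability space, $L_0$ is the space of $\mathbb P$-a.s. equivalence classes of finite real measurable functions, with the topology $\tau_{L_0}$ of convergence in probability; $\mathbb E$ is expectation. A (finite coercive) Young function is an even convex function $\Phi:\mathbb R\to\mathbb R$ with $\Phi(0)=0$ and $\lim_{x\to+\infty}\Phi(x)/x=+\infty$; its conjugate $\Phi^*(y)=\sup_x(xy-\Phi(x))$ is again such a function. $\Phi\in\Delta_2$ means $\limsup_{x\to\infty}\Phi(2x)/\Phi(x)<\infty$. For a Young function $\Psi$, $\mathbb B_\Psi=\{\xi\in L_0:\mathbb E[\Psi(\xi)]\le 1\}$, and the Orlicz space is $L_\Psi=\bigcup_{\lambda>0}\lambda\mathbb B_\Psi$ with norm $\|\xi\|_\Psi=\inf\{\lambda>0:\xi\in\lambda\mathbb B_\Psi\}$ and the a.s. pointwise order. $\tau(L_{\Phi^*},L_\Phi)$ is the Mackey topology on $L_{\Phi^*}$ for the duality $\langle\eta,\xi\rangle=\mathbb E[\eta\xi]$, $\eta\in L_\Phi$, $\xi\in L_{\Phi^*}$. Order interval: $[-\zeta,\zeta]=\{\xi:-\zeta\le\xi\le\zeta \text{ a.s.}\}$. A sequence $(\xi_n)_n$ is order bounded in $L_{\Phi^*}$ if $\sup_n|\xi_n|\in L_{\Phi^*}$. "(Sequentially) continuous on $A$" means that the restriction $f|_A$ is (sequentially) continuous for the relative topology on $A$. *)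

theory Defs
  imports "HOL-Probability.Probability"
begin

text \<open>
  Convention: an element of \<open>L\<^sub>0\<close> is represented by a real-valued Borel measurable function, and
  functions that agree almost surely represent the same element. Orlicz spaces, their balls and
  order intervals therefore contain all representatives of their elements. All topologies below are
  the preimages of the topologies on the spaces of equivalence classes (so they are not Hausdorff in
  general), and a function on a space of equivalence classes is a function on representatives that
  respects almost sure equality (\<open>ae_invariant_on\<close>).
\<close>


subsection \<open>Young functions\<close>

definition young_function :: "(real \<Rightarrow> real) \<Rightarrow> bool" where
  "young_function \<Phi> \<longleftrightarrow>
     convex_on UNIV \<Phi> \<and> (\<forall>x. \<Phi> (- x) = \<Phi> x) \<and> \<Phi> 0 = 0 \<and>
     filterlim (\<lambda>x. \<Phi> x / x) at_top at_top"

text \<open>For a Young function the supremum is over a nonempty set that is bounded above, by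
  coercivity; see \<open>bdd_above_young_conjugate\<close>.\<close>

definition young_conjugate :: "(real \<Rightarrow> real) \<Rightarrow> real \<Rightarrow> real" where
  "young_conjugate \<Phi> y = (SUP x. x * y - \<Phi> x)"

definition Delta2 :: "(real \<Rightarrow> real) \<Rightarrow> bool" where
  "Delta2 \<Phi> \<longleftrightarrow> Limsup at_top (\<lambda>x. ereal (\<Phi> (2 * x) / \<Phi> x)) < \<infinity>"

lemma young_function_nonneg:
  assumes "young_function \<Phi>"
  shows "0 \<le> \<Phi> x"
proof -
  have "\<Phi> ((1 - 1/2) *\<^sub>R x + (1/2) *\<^sub>R (- x)) \<le> (1 - 1/2) * \<Phi> x + (1/2) * \<Phi> (- x)"
    using assms by (intro convex_onD) (auto simp: young_function_def)
  then show ?thesis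
    using assms by (auto simp: young_function_def)
qed

lemma bdd_above_young_conjugate:
  assumes "young_function \<Phi>"
  shows "bdd_above (range (\<lambda>x. x * y - \<Phi> x))"
proof -
  have "eventually (\<lambda>x. \<Phi> x / x \<ge> \<bar>y\<bar>) at_top"
    using assms by (simp add: young_function_def filterlim_at_top)
  then obtain N0 where N0: "\<And>x. x \<ge> N0 \<Longrightarrow> \<Phi> x / x \<ge> \<bar>y\<bar>"
    by (auto simp: eventually_at_top_linorder)
  define N where "N = max N0 1"
  have N: "\<Phi> x \<ge> x * \<bar>y\<bar>" if "x \<ge> N" for x
    using that N0[of x] by (auto simp: N_def field_simps)
  have "x * y - \<Phi> x \<le> N * \<bar>y\<bar>" for x
  proof (cases "\<bar>x\<bar> \<ge> N")
    case True
    have "\<Phi> \<bar>x\<bar> = \<Phi> x"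
      using assms by (auto simp: young_function_def abs_if)
    moreover have "x * y \<le> \<bar>x\<bar> * \<bar>y\<bar>"
      by (metis abs_ge_self abs_mult)
    moreover have "0 \<le> N * \<bar>y\<bar>"
      by (simp add: N_def)
    ultimately show ?thesis
      using N[OF True] by linarith
  next
    case False
    have "x * y \<le> \<bar>x\<bar> * \<bar>y\<bar>"
      by (metis abs_ge_self abs_mult)
    also have "\<dots> \<le> N * \<bar>y\<bar>"
      using False by (intro mult_right_mono) auto
    finally show ?thesis
      using young_function_nonneg[OF assms, of x] by linarith
  qed
  then show ?thesis
    by (auto intro!: bdd_aboveI)
qed


subsection \<open>Orlicz spaces\<close>

text \<open>The set \<open>\<lambda>\<B>\<^sub>\<Psi>\<close>. The expectation is a nonnegative Lebesgue integral with value in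
  \<open>[0,\<infinity>]\<close>, and no integrability is presupposed.\<close>

definition orlicz_ball :: "'a measure \<Rightarrow> (real \<Rightarrow> real) \<Rightarrow> real \<Rightarrow> ('a \<Rightarrow> real) set" where
  "orlicz_ball M \<Psi> c =
     (\<lambda>\<xi> \<omega>. c * \<xi> \<omega>) ` {\<xi> \<in> borel_measurable M. (\<integral>\<^sup>+ \<omega>. ennreal (\<Psi> (\<xi> \<omega>)) \<partial>M) \<le> 1}"

definition orlicz :: "'a measure \<Rightarrow> (real \<Rightarrow> real) \<Rightarrow> ('a \<Rightarrow> real) set" where
  "orlicz M \<Psi> = (\<Union>c\<in>{0<..}. orlicz_ball M \<Psi> c)"

definition order_interval :: "'a measure \<Rightarrow> (real \<Rightarrow> real) \<Rightarrow> ('a \<Rightarrow> real) \<Rightarrow> ('a \<Rightarrow> real) set" where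
  "order_interval M \<Psi> \<zeta> = {\<xi> \<in> orlicz M \<Psi>. AE \<omega> in M. - \<zeta> \<omega> \<le> \<xi> \<omega> \<and> \<xi> \<omega> \<le> \<zeta> \<omega>}"

text \<open>The supremum of \<open>\<bar>\<xi>\<^sub>n\<bar>\<close> is taken in the extended reals, as it may be infinite.\<close>

definition order_bounded_seq ::
    "'a measure \<Rightarrow> (real \<Rightarrow> real) \<Rightarrow> (nat \<Rightarrow> 'a \<Rightarrow> real) \<Rightarrow> bool" where
  "order_bounded_seq M \<Psi> X \<longleftrightarrow>
     (\<exists>\<zeta>\<in>orlicz M \<Psi>. AE \<omega> in M. (SUP n. ereal \<bar>X n \<omega>\<bar>) = ereal (\<zeta> \<omega>))"


subsection \<open>Convergence in probability\<close>

definition L0_topology :: "'a measure \<Rightarrow> ('a \<Rightarrow> real) topology" where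
  "L0_topology M = topology (\<lambda>U. U \<subseteq> borel_measurable M \<and>
     (\<forall>\<xi>\<in>U. \<exists>\<epsilon>>0. {\<eta> \<in> borel_measurable M. measure M {\<omega> \<in> space M. \<bar>\<eta> \<omega> - \<xi> \<omega>\<bar> \<ge> \<epsilon>} < \<epsilon>} \<subseteq> U))"

lemma L0_ball_mono:
  assumes "prob_space M" "\<xi> \<in> borel_measurable M" "\<eta> \<in> borel_measurable M" "\<delta> \<le> \<epsilon>"
    and "measure M {\<omega> \<in> space M. \<bar>\<eta> \<omega> - \<xi> \<omega>\<bar> \<ge> \<delta>} < \<delta>"
  shows "measure M {\<omega> \<in> space M. \<bar>\<eta> \<omega> - \<xi> \<omega>\<bar> \<ge> \<epsilon>} < \<epsilon>"
proof -
  interpret prob_space M by fact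
  note [measurable] = assms(2,3)
  have "measure M {\<omega> \<in> space M. \<bar>\<eta> \<omega> - \<xi> \<omega>\<bar> \<ge> \<epsilon>} \<le> measure M {\<omega> \<in> space M. \<bar>\<eta> \<omega> - \<xi> \<omega>\<bar> \<ge> \<delta>}"
    using assms(4) by (intro finite_measure_mono) auto
  then show ?thesis
    using assms by linarith
qed

lemma openin_L0_topology:
  assumes "prob_space M"
  shows "openin (L0_topology M) U \<longleftrightarrow> U \<subseteq> borel_measurable M \<and>
     (\<forall>\<xi>\<in>U. \<exists>\<epsilon>>0. {\<eta> \<in> borel_measurable M. measure M {\<omega> \<in> space M. \<bar>\<eta> \<omega> - \<xi> \<omega>\<bar> \<ge> \<epsilon>} < \<epsilon>} \<subseteq> U)"
proof -
  let ?B = "\<lambda>\<xi> \<epsilon>. {\<eta> \<in> borel_measurable M. measure M {\<omega> \<in> space M. \<bar>\<eta> \<omega> - \<xi> \<omega>\<bar> \<ge> \<epsilon>} < \<epsilon>}"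
  have "istopology (\<lambda>U. U \<subseteq> borel_measurable M \<and> (\<forall>\<xi>\<in>U. \<exists>\<epsilon>>0. ?B \<xi> \<epsilon> \<subseteq> U))"
    unfolding istopology_def
  proof (intro conjI allI impI ballI)
    fix S T \<xi>
    assume S: "S \<subseteq> borel_measurable M \<and> (\<forall>\<xi>\<in>S. \<exists>\<epsilon>>0. ?B \<xi> \<epsilon> \<subseteq> S)"
      and T: "T \<subseteq> borel_measurable M \<and> (\<forall>\<xi>\<in>T. \<exists>\<epsilon>>0. ?B \<xi> \<epsilon> \<subseteq> T)"
      and \<xi>: "\<xi> \<in> S \<inter> T"
    obtain a b where ab: "a > 0" "?B \<xi> a \<subseteq> S" "b > 0" "?B \<xi> b \<subseteq> T"
      using S T \<xi> by blast
    have "\<xi> \<in> borel_measurable M" using S \<xi> by blast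
    then have "?B \<xi> (min a b) \<subseteq> ?B \<xi> a" "?B \<xi> (min a b) \<subseteq> ?B \<xi> b"
      using L0_ball_mono[OF assms, of \<xi> _ "min a b" a] L0_ball_mono[OF assms, of \<xi> _ "min a b" b]
      by auto
    then show "\<exists>\<epsilon>>0. ?B \<xi> \<epsilon> \<subseteq> S \<inter> T"
      using ab by (intro exI[of _ "min a b"]) auto
  next
    fix \<K> \<xi>
    assume "\<forall>K\<in>\<K>. K \<subseteq> borel_measurable M \<and> (\<forall>\<xi>\<in>K. \<exists>\<epsilon>>0. ?B \<xi> \<epsilon> \<subseteq> K)" "\<xi> \<in> \<Union>\<K>"
    then show "\<exists>\<epsilon>>0. ?B \<xi> \<epsilon> \<subseteq> \<Union>\<K>"
      by (meson Sup_upper UnionE subset_trans)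
  qed blast+
  then show ?thesis
    by (simp add: L0_topology_def)
qed

lemma topspace_L0_topology:
  assumes "prob_space M"
  shows "topspace (L0_topology M) = borel_measurable M"
proof
  show "topspace (L0_topology M) \<subseteq> borel_measurable M"
    using openin_topspace[of "L0_topology M"] by (simp only: openin_L0_topology[OF assms])
  have "openin (L0_topology M) (borel_measurable M)"
    by (auto simp: openin_L0_topology[OF assms] intro: exI[of _ 1])
  then show "borel_measurable M \<subseteq> topspace (L0_topology M)"
    by (rule openin_subset)
qed

lemma limitin_L0_topology:
  assumes "prob_space M" "\<And>n. X n \<in> borel_measurable M" "\<xi> \<in> borel_measurable M"
  shows "limitin (L0_topology M) X \<xi> sequentially \<longleftrightarrow>
     (\<forall>\<epsilon>>0. (\<lambda>n. measure M {\<omega> \<in> space M. \<bar>X n \<omega> - \<xi> \<omega>\<bar> \<ge> \<epsilon>}) \<longlonglongrightarrow> 0)"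
proof -
  interpret prob_space M by fact
  note [measurable] = assms(2,3)
  let ?p = "\<lambda>\<eta> \<xi> \<epsilon>. measure M {\<omega> \<in> space M. \<bar>\<eta> \<omega> - \<xi> \<omega>\<bar> \<ge> \<epsilon>}"
  show ?thesis
  proof
    assume L: "limitin (L0_topology M) X \<xi> sequentially"
    have ev: "eventually (\<lambda>n. ?p (X n) \<xi> \<epsilon> < \<epsilon>) sequentially" if "\<epsilon> > 0" for \<epsilon>
    proof -
      define U where "U = {\<eta> \<in> borel_measurable M. \<exists>a>0. a < \<epsilon> \<and> ?p \<eta> \<xi> a < a}"
      have "openin (L0_topology M) U"
        unfolding openin_L0_topology[OF assms(1)]
      proof (intro conjI ballI)
        show "U \<subseteq> borel_measurable M" by (auto simp: U_def)
        fix \<eta> assume "\<eta> \<in> U"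
        then obtain a where a: "a > 0" "a < \<epsilon>" "?p \<eta> \<xi> a < a" and [measurable]: "\<eta> \<in> borel_measurable M"
          by (auto simp: U_def)
        define b where "b = (\<epsilon> - a) / 2"
        have "\<zeta> \<in> U" if \<zeta>: "\<zeta> \<in> borel_measurable M" "?p \<zeta> \<eta> b < b" for \<zeta>
        proof -
          note [measurable] = \<zeta>(1)
          have "?p \<zeta> \<xi> (a + b) \<le> measure M ({\<omega> \<in> space M. \<bar>\<zeta> \<omega> - \<eta> \<omega>\<bar> \<ge> b} \<union> {\<omega> \<in> space M. \<bar>\<eta> \<omega> - \<xi> \<omega>\<bar> \<ge> a})"
            by (intro finite_measure_mono) auto
          also have "\<dots> \<le> ?p \<zeta> \<eta> b + ?p \<eta> \<xi> a"
            by (intro measure_Un_le) auto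
          also have "\<dots> < a + b" using a \<zeta> by linarith
          finally show ?thesis
            using a \<zeta>(1) unfolding U_def b_def
            by (intro CollectI conjI exI[of _ "a + (\<epsilon> - a) / 2"]) (auto simp: field_simps)
        qed
        then show "\<exists>e>0. {\<zeta> \<in> borel_measurable M. ?p \<zeta> \<eta> e < e} \<subseteq> U"
          using a by (intro exI[of _ b]) (auto simp: b_def)
      qed
      moreover have "\<xi> \<in> U"
        using that assms(3) by (auto simp: U_def intro!: exI[of _ "\<epsilon>/2"])
      ultimately have "eventually (\<lambda>n. X n \<in> U) sequentially"
        using L by (auto simp: limitin_def)
      then show ?thesis
      proof eventually_elim
        case (elim n)
        then obtain a where "a < \<epsilon>" "?p (X n) \<xi> a < a"
          by (auto simp: U_def)
        then show ?case
          using L0_ball_mono[OF assms(1,3,2), of a \<epsilon> n] by simp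
      qed
    qed
    show "\<forall>\<epsilon>>0. (\<lambda>n. ?p (X n) \<xi> \<epsilon>) \<longlonglongrightarrow> 0"
    proof (intro allI impI tendstoI)
      fix \<epsilon> \<delta> :: real assume "\<epsilon> > 0" "\<delta> > 0"
      then have "eventually (\<lambda>n. ?p (X n) \<xi> (min \<epsilon> \<delta>) < min \<epsilon> \<delta>) sequentially"
        by (intro ev) auto
      then show "eventually (\<lambda>n. dist (?p (X n) \<xi> \<epsilon>) 0 < \<delta>) sequentially"
      proof eventually_elim
        case (elim n)
        have "?p (X n) \<xi> \<epsilon> \<le> ?p (X n) \<xi> (min \<epsilon> \<delta>)"
          by (intro finite_measure_mono) auto
        then show ?case using elim by (auto simp: dist_real_def)
      qed
    qed
  next
    assume P: "\<forall>\<epsilon>>0. (\<lambda>n. ?p (X n) \<xi> \<epsilon>) \<longlonglongrightarrow> 0"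
    show "limitin (L0_topology M) X \<xi> sequentially"
      unfolding limitin_def
    proof (intro conjI allI impI)
      show "\<xi> \<in> topspace (L0_topology M)"
        using assms(1,3) by (simp add: topspace_L0_topology)
      fix U assume U: "openin (L0_topology M) U \<and> \<xi> \<in> U"
      then obtain \<epsilon> where \<epsilon>: "\<epsilon> > 0" "{\<eta> \<in> borel_measurable M. ?p \<eta> \<xi> \<epsilon> < \<epsilon>} \<subseteq> U"
        by (auto simp: openin_L0_topology[OF assms(1)])
      have "eventually (\<lambda>n. ?p (X n) \<xi> \<epsilon> < \<epsilon>) sequentially"
        using P \<epsilon>(1) by (intro order_tendstoD(2)[where y = 0]) auto
      then show "eventually (\<lambda>n. X n \<in> U) sequentially"
        by eventually_elim (use \<epsilon>(2) assms(2) in auto)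
    qed
  qed
qed


subsection \<open>Weak and Mackey topologies for the duality of random variables\<close>

definition pairing :: "'a measure \<Rightarrow> ('a \<Rightarrow> real) \<Rightarrow> ('a \<Rightarrow> real) \<Rightarrow> real" where
  "pairing M \<eta> \<xi> = (LINT \<omega>|M. \<eta> \<omega> * \<xi> \<omega>)"

text \<open>\<open>\<sigma>(F,E)\<close>: the initial topology on \<open>F\<close> for the functionals \<open>\<eta> \<mapsto> \<langle>\<eta>,\<xi>\<rangle>\<close>, \<open>\<xi> \<in> E\<close>.\<close>

definition weak_topology ::
    "'a measure \<Rightarrow> ('a \<Rightarrow> real) set \<Rightarrow> ('a \<Rightarrow> real) set \<Rightarrow> ('a \<Rightarrow> real) topology" where
  "weak_topology M F E =
     pullback_topology F (\<lambda>\<eta>. \<lambda>\<xi>\<in>E. pairing M \<eta> \<xi>) (product_topology (\<lambda>_. euclideanreal) E)"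

definition absolutely_convex :: "('a \<Rightarrow> real) set \<Rightarrow> bool" where
  "absolutely_convex K \<longleftrightarrow>
     (\<forall>\<eta>\<in>K. \<forall>\<theta>\<in>K. \<forall>a b. \<bar>a\<bar> + \<bar>b\<bar> \<le> 1 \<longrightarrow> (\<lambda>\<omega>. a * \<eta> \<omega> + b * \<theta> \<omega>) \<in> K)"

text \<open>\<open>\<tau>(E,F)\<close>: the topology on \<open>E\<close> of uniform convergence on the absolutely convex
  \<open>\<sigma>(F,E)\<close>-compact subsets of \<open>F\<close>.\<close>

definition mackey_nbhd :: "'a measure \<Rightarrow> ('a \<Rightarrow> real) set \<Rightarrow>
    ('a \<Rightarrow> real) set set \<Rightarrow> real \<Rightarrow> ('a \<Rightarrow> real) \<Rightarrow> ('a \<Rightarrow> real) set" where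
  "mackey_nbhd M E \<K> \<epsilon> \<xi> =
     {\<xi>' \<in> E. \<forall>K\<in>\<K>. \<forall>\<eta>\<in>K. \<bar>pairing M \<eta> (\<lambda>\<omega>. \<xi>' \<omega> - \<xi> \<omega>)\<bar> < \<epsilon>}"

definition mackey_topology ::
    "'a measure \<Rightarrow> ('a \<Rightarrow> real) set \<Rightarrow> ('a \<Rightarrow> real) set \<Rightarrow> ('a \<Rightarrow> real) topology" where
  "mackey_topology M E F = topology (\<lambda>U. U \<subseteq> E \<and>
     (\<forall>\<xi>\<in>U. \<exists>\<K> \<epsilon>. finite \<K> \<and> (\<forall>K\<in>\<K>. compactin (weak_topology M F E) K \<and> absolutely_convex K) \<and>
        \<epsilon> > 0 \<and> mackey_nbhd M E \<K> \<epsilon> \<xi> \<subseteq> U))"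

lemma topspace_weak_topology: "topspace (weak_topology M F E) = F"
  by (auto simp: weak_topology_def topspace_pullback_topology)

lemma openin_mackey_topology:
  "openin (mackey_topology M E F) U \<longleftrightarrow> U \<subseteq> E \<and>
     (\<forall>\<xi>\<in>U. \<exists>\<K> \<epsilon>. finite \<K> \<and> (\<forall>K\<in>\<K>. compactin (weak_topology M F E) K \<and> absolutely_convex K) \<and>
        \<epsilon> > 0 \<and> mackey_nbhd M E \<K> \<epsilon> \<xi> \<subseteq> U)"
proof -
  let ?C = "\<lambda>\<K>. finite \<K> \<and> (\<forall>K\<in>\<K>. compactin (weak_topology M F E) K \<and> absolutely_convex K)"
  let ?Q = "\<lambda>U. U \<subseteq> E \<and> (\<forall>\<xi>\<in>U. \<exists>\<K> \<epsilon>. ?C \<K> \<and> \<epsilon> > 0 \<and> mackey_nbhd M E \<K> \<epsilon> \<xi> \<subseteq> U)"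
  have "istopology ?Q"
    unfolding istopology_def
  proof (intro conjI allI impI ballI)
    fix S T \<xi>
    assume S: "?Q S" and T: "?Q T" and \<xi>: "\<xi> \<in> S \<inter> T"
    have "\<exists>\<K> \<epsilon>. ?C \<K> \<and> \<epsilon> > 0 \<and> mackey_nbhd M E \<K> \<epsilon> \<xi> \<subseteq> S"
      using S \<xi> by blast
    then obtain A a where a: "?C A" "a > 0" "mackey_nbhd M E A a \<xi> \<subseteq> S"
      by blast
    have "\<exists>\<K> \<epsilon>. ?C \<K> \<and> \<epsilon> > 0 \<and> mackey_nbhd M E \<K> \<epsilon> \<xi> \<subseteq> T"
      using T \<xi> by blast
    then obtain B b where b: "?C B" "b > 0" "mackey_nbhd M E B b \<xi> \<subseteq> T"
      by blast
    have "mackey_nbhd M E (A \<union> B) (min a b) \<xi> \<subseteq> mackey_nbhd M E A a \<xi> \<inter> mackey_nbhd M E B b \<xi>"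
      by (auto simp: mackey_nbhd_def)
    then have "mackey_nbhd M E (A \<union> B) (min a b) \<xi> \<subseteq> S \<inter> T"
      using a(3) b(3) by blast
    moreover have "?C (A \<union> B)" "min a b > 0"
      using a b by auto
    ultimately show "\<exists>\<K> \<epsilon>. ?C \<K> \<and> \<epsilon> > 0 \<and> mackey_nbhd M E \<K> \<epsilon> \<xi> \<subseteq> S \<inter> T"
      by blast
  next
    fix \<U> \<xi>
    assume *: "\<forall>K\<in>\<U>. ?Q K" and "\<xi> \<in> \<Union>\<U>"
    then obtain V where V: "V \<in> \<U>" "\<xi> \<in> V" by blast
    then have "\<exists>\<K> \<epsilon>. ?C \<K> \<and> \<epsilon> > 0 \<and> mackey_nbhd M E \<K> \<epsilon> \<xi> \<subseteq> V"
      using * by blast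
    then show "\<exists>\<K> \<epsilon>. ?C \<K> \<and> \<epsilon> > 0 \<and> mackey_nbhd M E \<K> \<epsilon> \<xi> \<subseteq> \<Union>\<U>"
      using V(1) by (meson Sup_upper subset_trans)
  qed blast+
  then show ?thesis
    by (simp add: mackey_topology_def conj_assoc)
qed

lemma topspace_mackey_topology: "topspace (mackey_topology M E F) = E"
proof
  show "topspace (mackey_topology M E F) \<subseteq> E"
    using openin_topspace[of "mackey_topology M E F"] by (simp only: openin_mackey_topology)
  have "openin (mackey_topology M E F) E"
    unfolding openin_mackey_topology
    by (auto simp: mackey_nbhd_def intro!: exI[of _ "{}"] exI[of _ "1::real"])
  then show "E \<subseteq> topspace (mackey_topology M E F)"
    by (rule openin_subset)
qed


subsection \<open>Properties of functions on spaces of random variables\<close>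

definition ae_invariant_on :: "'a measure \<Rightarrow> ('a \<Rightarrow> real) set \<Rightarrow> (('a \<Rightarrow> real) \<Rightarrow> real) \<Rightarrow> bool" where
  "ae_invariant_on M E f \<longleftrightarrow>
     (\<forall>\<xi>\<in>E. \<forall>\<eta>\<in>E. (AE \<omega> in M. \<xi> \<omega> = \<eta> \<omega>) \<longrightarrow> f \<xi> = f \<eta>)"

definition convex_fun_on :: "('a \<Rightarrow> real) set \<Rightarrow> (('a \<Rightarrow> real) \<Rightarrow> real) \<Rightarrow> bool" where
  "convex_fun_on E f \<longleftrightarrow>
     (\<forall>\<xi>\<in>E. \<forall>\<eta>\<in>E. \<forall>t\<in>{0..1}.
        f (\<lambda>\<omega>. (1 - t) * \<xi> \<omega> + t * \<eta> \<omega>) \<le> (1 - t) * f \<xi> + t * f \<eta>)"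

definition seq_continuous :: "'b topology \<Rightarrow> ('b \<Rightarrow> real) \<Rightarrow> bool" where
  "seq_continuous T f \<longleftrightarrow>
     (\<forall>X x. range X \<subseteq> topspace T \<longrightarrow> limitin T X x sequentially \<longrightarrow> (\<lambda>n. f (X n)) \<longlonglongrightarrow> f x)"

definition order_continuous ::
    "'a measure \<Rightarrow> (real \<Rightarrow> real) \<Rightarrow> (('a \<Rightarrow> real) \<Rightarrow> real) \<Rightarrow> bool" where
  "order_continuous M \<Psi> f \<longleftrightarrow>
     (\<forall>X \<xi>. range X \<subseteq> orlicz M \<Psi> \<longrightarrow> \<xi> \<in> orlicz M \<Psi> \<longrightarrow> order_bounded_seq M \<Psi> X \<longrightarrow>
        (AE \<omega> in M. (\<lambda>n. X n \<omega>) \<longlonglongrightarrow> \<xi> \<omega>) \<longrightarrow> (\<lambda>n. f (X n)) \<longlonglongrightarrow> f \<xi>)"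

end

theory Submission
  imports Defs "HOL-Library.Function_Algebras"
begin

text \<open>
  The heart of the matter is that order continuity of the finite convex function \<open>f\<close> yields Mackey
  continuity. Fix \<open>\<xi>\<close> and \<open>e > 0\<close>, and let \<open>p\<close> be the gauge of
  \<open>C = {x. f (\<xi> + x) \<le> f \<xi> + e \<and> f (\<xi> - x) \<le> f \<xi> + e}\<close>. Because \<open>f\<close> is order continuous, \<open>p\<close>
  tends to \<open>0\<close> along order bounded a.s. null sequences, so that every linear functional dominated by
  \<open>p\<close> is order continuous, hence given by an element of \<open>L\<^sub>\<Phi>\<close> (Radon-Nikodym and the fact that the
  Koethe dual of \<open>L\<^sub>\<Psi>\<close> is \<open>L\<^sub>\<Phi>\<close>). Therefore the polar \<open>K\<close> of \<open>C\<close> in \<open>L\<^sub>\<Phi>\<close> is the whole algebraic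
  polar: it is weakly compact by Tychonoff, and by Hahn-Banach \<open>p x\<close> is attained as \<open>\<langle>\<eta>, x\<rangle>\<close> with
  \<open>\<eta> \<in> K\<close>. So \<open>{x. \<forall>\<eta>\<in>K. \<bar>\<langle>\<eta>, x\<rangle>\<bar> < 1}\<close> is a Mackey neighbourhood of \<open>0\<close> contained in \<open>C\<close>.

  Conversely, a gliding hump argument shows that a weakly compact \<open>K \<subseteq> L\<^sub>\<Phi>\<close> satisfies
  \<open>sup\<^sub>\<eta>\<^sub>\<in>\<^sub>K \<langle>\<bar>\<eta>\<bar>, Z\<^sub>n\<rangle> \<rightarrow> 0\<close> whenever \<open>Z\<^sub>n\<close> decreases to \<open>0\<close> a.s. in \<open>L\<^sub>\<Psi>\<close>. Hence order bounded a.s.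
  convergence implies Mackey convergence, and sequential Mackey continuity on order intervals
  implies order continuity.
\<close>

subsection \<open>Young functions and Orlicz spaces\<close>

text \<open>The obstacle is that the Mackey topology is in general not metrizable, so information
  about sequences has to yield one weakly compact set that controls \<open>f\<close> near
  \<open>\<xi>\<close>. Tychonoff always gives compactness in the algebraic dual; the danger is that
  limit functionals are no longer countably additive. This is why order continuity is transferred
  from \<open>f\<close> to the gauge \<open>p\<close>: domination by \<open>p\<close> survives
  pointwise limits, so no limit can leave \<open>L\<^sub>\<Phi>\<close>. The set \<open>C\<close>
  uses both signs of \<open>x\<close> for two reasons: \<open>p\<close> becomes even, which turns
  \<open>l \<le> p\<close> into \<open>\<bar>l\<bar> \<le> p\<close>, and the upper estimate of
  \<open>f\<close> at the reflected point gives the lower estimate at the original one by convexity.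

  In the converse direction an a.s. null sequence is first replaced by its decreasing tail suprema.
  Compactness of \<open>K\<close> is used only through cluster points, so the humps are selected by
  neighbourhoods and not by convergent subsequences of functionals.

  Everything is said about representatives. Almost sure invariance of the functionals need not be
  imposed: a constant sequence converges a.s. to every version of its value.\<close>

lemma young_function_abs: "young_function \<Psi> \<Longrightarrow> \<Psi> \<bar>x\<bar> = \<Psi> x"
  by (auto simp: young_function_def abs_if)

lemma young_function_convexD:
  assumes "young_function \<Psi>" "0 \<le> t" "t \<le> 1"
  shows "\<Psi> ((1 - t) * x + t * y) \<le> (1 - t) * \<Psi> x + t * \<Psi> y"
  using assms convex_onD[of UNIV \<Psi> t x y] by (auto simp: young_function_def)

lemma young_function_scale:
  assumes "young_function \<Psi>" "0 \<le> t" "t \<le> 1"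
  shows "\<Psi> (t * x) \<le> t * \<Psi> x"
  using young_function_convexD[OF assms, of 0 x] assms by (simp add: young_function_def)

lemma young_function_mono:
  assumes "young_function \<Psi>" "\<bar>x\<bar> \<le> \<bar>y\<bar>"
  shows "\<Psi> x \<le> \<Psi> y"
proof (cases "y = 0")
  case False
  define t where "t = \<bar>x\<bar> / \<bar>y\<bar>"
  have t: "0 \<le> t" "t \<le> 1" "\<bar>x\<bar> = t * \<bar>y\<bar>"
    using False assms(2) by (auto simp: t_def)
  have "\<Psi> x \<le> t * \<Psi> \<bar>y\<bar>"
    using young_function_scale[OF assms(1) t(1,2), of "\<bar>y\<bar>"] t(3) young_function_abs[OF assms(1), of x] by simp
  also have "\<dots> \<le> 1 * \<Psi> \<bar>y\<bar>"
    using t young_function_nonneg[OF assms(1)] by (intro mult_right_mono) auto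
  finally show ?thesis using young_function_abs[OF assms(1)] by simp
qed (use assms in auto)

lemma young_function_continuous: "young_function \<Psi> \<Longrightarrow> continuous_on UNIV \<Psi>"
  by (auto simp: young_function_def intro: convex_on_continuous)

lemma young_function_measurable:
  "young_function \<Psi> \<Longrightarrow> g \<in> borel_measurable M \<Longrightarrow> (\<lambda>x. \<Psi> (g x)) \<in> borel_measurable M"
  using borel_measurable_continuous_onI[OF young_function_continuous] measurable_compose by blast

lemma young_inequality:
  assumes "young_function \<Phi>"
  shows "x * y \<le> \<Phi> x + young_conjugate \<Phi> y"
  using cSUP_upper[OF _ bdd_above_young_conjugate[OF assms], of x y]
  by (simp add: young_conjugate_def)

lemma young_function_conjugate:
  assumes "young_function \<Phi>"
  shows "young_function (young_conjugate \<Phi>)"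
proof -
  let ?\<Psi> = "young_conjugate \<Phi>"
  have leI: "?\<Psi> y \<le> c" if "\<And>x. x * y - \<Phi> x \<le> c" for y c
    unfolding young_conjugate_def by (intro cSUP_least that) auto
  note Y = young_inequality[OF assms]
  have even: "?\<Psi> (- y) \<le> ?\<Psi> y" for y
  proof (rule leI)
    show "x * - y - \<Phi> x \<le> ?\<Psi> y" for x
      using Y[of "-x" y] assms by (simp add: young_function_def)
  qed
  have "filterlim (\<lambda>y. ?\<Psi> y / y) at_top at_top"
    unfolding filterlim_at_top
  proof
    fix Z :: real
    \<comment> \<open>Testing the supremum at \<open>Z + 1\<close> gives at least
      \<open>(Z + 1) * y - \<Phi> (Z + 1)\<close>, which exceeds \<open>Z * y\<close> once
      \<open>y \<ge> \<Phi> (Z + 1)\<close>; the bound \<open>1\<close> keeps the divisor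
      positive.\<close>
    have "eventually (\<lambda>y. y \<ge> max 1 (\<Phi> (Z + 1))) at_top"
      by (rule eventually_ge_at_top)
    then show "eventually (\<lambda>y. Z \<le> ?\<Psi> y / y) at_top"
    proof eventually_elim
      case (elim y)
      then show ?case using Y[of "Z + 1" y] by (simp add: field_simps)
    qed
  qed
  moreover have "convex_on UNIV ?\<Psi>"
  proof (intro convex_onI leI)
    fix t x y z :: real assume t: "0 < t" "t < 1"
    have "z * ((1 - t) *\<^sub>R x + t *\<^sub>R y) - \<Phi> z = (1 - t) * (z * x - \<Phi> z) + t * (z * y - \<Phi> z)"
      by (simp add: algebra_simps)
    also have "\<dots> \<le> (1 - t) * ?\<Psi> x + t * ?\<Psi> y"
      using t Y[of z x] Y[of z y] by (intro add_mono mult_left_mono) auto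
    finally show "z * ((1 - t) *\<^sub>R x + t *\<^sub>R y) - \<Phi> z \<le> (1 - t) * ?\<Psi> x + t * ?\<Psi> y" .
  qed auto
  moreover have "?\<Psi> 0 = 0"
    using leI[of 0 0] Y[of 0 0] young_function_nonneg[OF assms] assms
    by (force simp: young_function_def)
  ultimately show ?thesis
    using even[of "- y" for y] even by (auto simp: young_function_def intro: antisym)
qed

section \<open>Orlicz spaces as solid vector spaces containing the bounded functions\<close>

locale orlicz_space = prob_space M for M :: "'a measure" +
  fixes \<Psi> :: "real \<Rightarrow> real"
  assumes young: "young_function \<Psi>"
begin

lemma ball_iff:
  assumes "0 < c"
  shows "\<xi> \<in> orlicz_ball M \<Psi> c \<longleftrightarrow>
    \<xi> \<in> borel_measurable M \<and> (\<integral>\<^sup>+ \<omega>. ennreal (\<Psi> (\<xi> \<omega> / c)) \<partial>M) \<le> 1"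
proof
  assume "\<xi> \<in> borel_measurable M \<and> (\<integral>\<^sup>+ \<omega>. ennreal (\<Psi> (\<xi> \<omega> / c)) \<partial>M) \<le> 1"
  then show "\<xi> \<in> orlicz_ball M \<Psi> c"
    using assms unfolding orlicz_ball_def by (intro image_eqI[of _ _ "\<lambda>\<omega>. \<xi> \<omega> / c"]) auto
qed (use assms in \<open>auto simp: orlicz_ball_def\<close>)

lemma in_iff:
  "\<xi> \<in> orlicz M \<Psi> \<longleftrightarrow>
    \<xi> \<in> borel_measurable M \<and> (\<exists>c>0. (\<integral>\<^sup>+ \<omega>. ennreal (\<Psi> (c * \<xi> \<omega>)) \<partial>M) \<le> 1)"
proof -
  have "(\<exists>c>0. (\<integral>\<^sup>+ \<omega>. ennreal (\<Psi> (\<xi> \<omega> / c)) \<partial>M) \<le> 1) \<longleftrightarrow>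
      (\<exists>c>0. (\<integral>\<^sup>+ \<omega>. ennreal (\<Psi> (c * \<xi> \<omega>)) \<partial>M) \<le> 1)"
    by (rule iffI; elim exE, rule_tac x = "1 / c" in exI) (auto simp: mult.commute)
  then show ?thesis
    by (auto simp: orlicz_def ball_iff)
qed

lemma measurable [measurable_dest]: "\<xi> \<in> orlicz M \<Psi> \<Longrightarrow> \<xi> \<in> borel_measurable M"
  by (simp add: in_iff)

lemma ball_solid:
  assumes "0 < c" "\<zeta> \<in> orlicz_ball M \<Psi> c" "\<xi> \<in> borel_measurable M" "AE \<omega> in M. \<bar>\<xi> \<omega>\<bar> \<le> \<bar>\<zeta> \<omega>\<bar>"
  shows "\<xi> \<in> orlicz_ball M \<Psi> c"
proof -
  have "(\<integral>\<^sup>+ \<omega>. ennreal (\<Psi> (\<xi> \<omega> / c)) \<partial>M) \<le> (\<integral>\<^sup>+ \<omega>. ennreal (\<Psi> (\<zeta> \<omega> / c)) \<partial>M)"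
    using assms(4)
    by (intro nn_integral_mono_AE, eventually_elim)
       (use assms(1) in \<open>auto intro!: ennreal_leI young_function_mono[OF young] divide_right_mono\<close>)
  then show ?thesis
    using assms by (auto simp: ball_iff)
qed

lemma solid:
  assumes "\<zeta> \<in> orlicz M \<Psi>" "\<xi> \<in> borel_measurable M" "AE \<omega> in M. \<bar>\<xi> \<omega>\<bar> \<le> \<bar>\<zeta> \<omega>\<bar>"
  shows "\<xi> \<in> orlicz M \<Psi>"
  using assms ball_solid[of _ \<zeta> \<xi>] by (auto simp: orlicz_def)

lemma scale:
  assumes "\<xi> \<in> orlicz M \<Psi>"
  shows "(\<lambda>\<omega>. a * \<xi> \<omega>) \<in> orlicz M \<Psi>"
proof -
  have [measurable]: "\<xi> \<in> borel_measurable M" using assms by (rule measurable)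
  obtain c where c: "c > 0" "(\<integral>\<^sup>+ \<omega>. ennreal (\<Psi> (c * \<xi> \<omega>)) \<partial>M) \<le> 1"
    using assms by (auto simp: in_iff)
  have "(\<integral>\<^sup>+ \<omega>. ennreal (\<Psi> (c / (1 + \<bar>a\<bar>) * (a * \<xi> \<omega>))) \<partial>M) \<le> (\<integral>\<^sup>+ \<omega>. ennreal (\<Psi> (c * \<xi> \<omega>)) \<partial>M)"
  proof (intro nn_integral_mono ennreal_leI young_function_mono[OF young])
    fix \<omega>
    have "\<bar>a\<bar> * \<bar>c * \<xi> \<omega>\<bar> \<le> (1 + \<bar>a\<bar>) * \<bar>c * \<xi> \<omega>\<bar>"
      by (intro mult_right_mono) auto
    then show "\<bar>c / (1 + \<bar>a\<bar>) * (a * \<xi> \<omega>)\<bar> \<le> \<bar>c * \<xi> \<omega>\<bar>"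
      using c(1) by (simp add: abs_mult divide_le_eq mult_ac)
  qed
  then show ?thesis
    using c unfolding in_iff by (intro conjI exI[of _ "c / (1 + \<bar>a\<bar>)"]) (auto simp: add_pos_nonneg)
qed

lemma add:
  assumes "\<xi> \<in> orlicz M \<Psi>" "\<eta> \<in> orlicz M \<Psi>"
  shows "(\<lambda>\<omega>. \<xi> \<omega> + \<eta> \<omega>) \<in> orlicz M \<Psi>"
proof -
  note [measurable] = assms[THEN measurable] and [measurable (raw)] = young_function_measurable[OF young]
  obtain c d where c: "c > 0" "(\<integral>\<^sup>+ \<omega>. ennreal (\<Psi> (c * \<xi> \<omega>)) \<partial>M) \<le> 1"
    and d: "d > 0" "(\<integral>\<^sup>+ \<omega>. ennreal (\<Psi> (d * \<eta> \<omega>)) \<partial>M) \<le> 1"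
    using assms by (auto simp: in_iff)
  \<comment> \<open>The factor \<open>1/2\<close> pays for convexity:
    \<open>e * (\<xi> + \<eta>)\<close> is the midpoint of \<open>2 * e * \<xi>\<close> and
    \<open>2 * e * \<eta>\<close>.\<close>
  define e where "e = min c d / 2"
  have "ennreal (\<Psi> (e * (\<xi> \<omega> + \<eta> \<omega>))) \<le> ennreal (1/2) * ennreal (\<Psi> (c * \<xi> \<omega>)) + ennreal (1/2) * ennreal (\<Psi> (d * \<eta> \<omega>))" for \<omega>
  proof -
    have "\<Psi> (e * (\<xi> \<omega> + \<eta> \<omega>)) \<le> 1/2 * \<Psi> (2 * e * \<xi> \<omega>) + 1/2 * \<Psi> (2 * e * \<eta> \<omega>)"
      using young_function_convexD[OF young, of "1/2" "2 * e * \<xi> \<omega>" "2 * e * \<eta> \<omega>"] by (simp add: algebra_simps)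
    also have "\<dots> \<le> 1/2 * \<Psi> (c * \<xi> \<omega>) + 1/2 * \<Psi> (d * \<eta> \<omega>)"
      using c(1) d(1)
      by (intro add_mono mult_left_mono young_function_mono[OF young]) (auto simp: e_def abs_mult intro!: mult_right_mono)
    finally have "ennreal (\<Psi> (e * (\<xi> \<omega> + \<eta> \<omega>))) \<le> ennreal (1/2 * \<Psi> (c * \<xi> \<omega>) + 1/2 * \<Psi> (d * \<eta> \<omega>))"
      by (rule ennreal_leI)
    also have "\<dots> = ennreal (1/2) * ennreal (\<Psi> (c * \<xi> \<omega>)) + ennreal (1/2) * ennreal (\<Psi> (d * \<eta> \<omega>))"
      by (subst ennreal_plus)
         (simp_all add: ennreal_mult'' young_function_nonneg[OF young] del: times_divide_eq_left mult_1 divide_ennreal)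
    finally show ?thesis .
  qed
  then have "(\<integral>\<^sup>+ \<omega>. ennreal (\<Psi> (e * (\<xi> \<omega> + \<eta> \<omega>))) \<partial>M) \<le>
     (\<integral>\<^sup>+ \<omega>. ennreal (1/2) * ennreal (\<Psi> (c * \<xi> \<omega>)) + ennreal (1/2) * ennreal (\<Psi> (d * \<eta> \<omega>)) \<partial>M)"
    by (intro nn_integral_mono)
  also have "\<dots> = ennreal (1/2) * (\<integral>\<^sup>+ \<omega>. ennreal (\<Psi> (c * \<xi> \<omega>)) \<partial>M) + ennreal (1/2) * (\<integral>\<^sup>+ \<omega>. ennreal (\<Psi> (d * \<eta> \<omega>)) \<partial>M)"
    by (subst nn_integral_add) (auto simp: nn_integral_cmult)
  also have "\<dots> \<le> ennreal (1/2) * 1 + ennreal (1/2) * 1"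
    using c d by (intro add_mono mult_left_mono) auto
  also have "\<dots> = 1"
    using ennreal_plus[of "1/2" "1/2"] by simp
  finally show ?thesis
    using c d unfolding in_iff by (intro conjI exI[of _ e]) (auto simp: e_def)
qed

lemma lincomb: "\<xi> \<in> orlicz M \<Psi> \<Longrightarrow> \<eta> \<in> orlicz M \<Psi> \<Longrightarrow> (\<lambda>\<omega>. a * \<xi> \<omega> + b * \<eta> \<omega>) \<in> orlicz M \<Psi>"
  by (intro add scale)

lemma diff: "\<xi> \<in> orlicz M \<Psi> \<Longrightarrow> \<eta> \<in> orlicz M \<Psi> \<Longrightarrow> (\<lambda>\<omega>. \<xi> \<omega> - \<eta> \<omega>) \<in> orlicz M \<Psi>"
  using lincomb[of \<xi> \<eta> 1 "-1"] by simp

lemma uminus: "\<xi> \<in> orlicz M \<Psi> \<Longrightarrow> (\<lambda>\<omega>. - \<xi> \<omega>) \<in> orlicz M \<Psi>"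
  using scale[of \<xi> "-1"] by simp

lemma abs: "\<xi> \<in> orlicz M \<Psi> \<Longrightarrow> (\<lambda>\<omega>. \<bar>\<xi> \<omega>\<bar>) \<in> orlicz M \<Psi>"
  by (rule solid) (auto dest: measurable)

lemma const: "(\<lambda>\<omega>. a) \<in> orlicz M \<Psi>"
proof -
  have *: "\<Psi> (1 / (1 + \<Psi> 1)) \<le> 1"
    using young_function_nonneg[OF young, of 1]
    by (intro order_trans[OF young_function_scale[OF young, of "1 / (1 + \<Psi> 1)" 1, simplified mult_1_right]])
       (auto simp: field_simps)
  have "(\<lambda>\<omega>. 1) \<in> orlicz M \<Psi>"
    unfolding in_iff
    using young_function_nonneg[OF young, of 1] *
    by (auto intro!: exI[of _ "1 / (1 + \<Psi> 1)"] simp: emeasure_space_1)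
  from scale[OF this, of a] show ?thesis by simp
qed

lemma bounded:
  assumes "\<xi> \<in> borel_measurable M" "\<And>\<omega>. \<omega> \<in> space M \<Longrightarrow> \<bar>\<xi> \<omega>\<bar> \<le> B"
  shows "\<xi> \<in> orlicz M \<Psi>"
  by (rule solid[OF const[of B] assms(1)]) (use assms(2) in force)

lemma indicator: "A \<in> sets M \<Longrightarrow> indicator A \<in> orlicz M \<Psi>"
  by (rule bounded[of _ 1]) (auto simp: indicator_def)

end

text \<open>Jensen's inequality for weights of total mass at most one: the extra index
  \<open>N\<close> carries the missing mass and sits at the point \<open>0\<close>, where a Young
  function vanishes.\<close>

lemma young_function_sum_le:
  fixes N :: nat
  assumes "young_function \<Psi>" "\<And>i. i < N \<Longrightarrow> 0 \<le> a i" "(\<Sum>i<N. a i) \<le> 1"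
  shows "\<Psi> (\<Sum>i<N. a i * x i) \<le> (\<Sum>i<N. a i * \<Psi> (x i))"
proof -
  define b where "b i = (if i < N then a i else 1 - (\<Sum>i<N. a i))" for i
  define y where "y i = (if i < N then x i else 0)" for i
  have eq: "{..N} = insert N {..<N}" by auto
  have "\<Psi> (\<Sum>i\<in>{..N}. b i *\<^sub>R y i) \<le> (\<Sum>i\<in>{..N}. b i * \<Psi> (y i))"
  proof (rule convex_on_sum)
    show "(\<Sum>i\<in>{..N}. b i) = 1"
      by (simp add: eq b_def)
  qed (use assms in \<open>auto simp: b_def young_function_def\<close>)
  then show ?thesis
    using assms(1) by (simp add: eq b_def y_def young_function_def)
qed

text \<open>Here \<open>\<phi>\<close> is the right derivative. The subgradient inequality says that
  \<open>t \<mapsto> t * \<phi> x - \<Phi> t\<close> is maximal at \<open>t = x\<close>, which is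
  the equality case of Young's inequality. Monotonicity is recorded because it gives measurability
  of \<open>\<phi>\<close> and bounds on truncations. The absolute value avoids a discussion of the
  sign of \<open>\<phi> 0\<close>.\<close>

lemma young_function_subgradient:
  assumes "young_function \<Phi>"
  obtains \<phi> where "mono \<phi>" "\<And>x. 0 \<le> x \<Longrightarrow> x * \<bar>\<phi> x\<bar> = \<Phi> x + young_conjugate \<Phi> \<bar>\<phi> x\<bar>"
proof -
  define \<phi> where "\<phi> x = Inf ((\<lambda>t. (\<Phi> x - \<Phi> t) / (x - t)) ` ({x<..} \<inter> UNIV))" for x
  have sub: "\<Phi> x + \<phi> x * (y - x) \<le> \<Phi> y" for x y
    unfolding \<phi>_def using assms by (intro convex_le_Inf_differential) (auto simp: young_function_def)
  have "mono \<phi>"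
  proof (rule monoI)
    fix x y :: real assume "x \<le> y"
    show "\<phi> x \<le> \<phi> y"
    proof (cases "x = y")
      case False
      have "(\<phi> x - \<phi> y) * (y - x) \<le> 0"
        using sub[of x y] sub[of y x] by (simp add: algebra_simps)
      then show ?thesis
        using False \<open>x \<le> y\<close> by (auto simp: mult_le_0_iff)
    qed simp
  qed
  moreover have "x * \<bar>\<phi> x\<bar> = \<Phi> x + young_conjugate \<Phi> \<bar>\<phi> x\<bar>" if "0 \<le> x" for x
  proof -
    have "0 \<le> x * \<phi> x"
      using sub[of x 0] young_function_nonneg[OF assms, of x] assms
      by (simp add: young_function_def algebra_simps)
    then have "x * \<bar>\<phi> x\<bar> = x * \<phi> x"
      using that by (metis abs_mult abs_of_nonneg)
    moreover have "young_conjugate \<Phi> (\<phi> x) \<le> x * \<phi> x - \<Phi> x"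
      unfolding young_conjugate_def
      by (rule cSUP_least) (use sub[of x] in \<open>auto simp: algebra_simps\<close>)
    ultimately show ?thesis
      using young_inequality[OF assms, of x "\<phi> x"] young_function_abs[OF young_function_conjugate[OF assms], of "\<phi> x"]
      by linarith
  qed
  ultimately show ?thesis by (rule that)
qed

section \<open>The duality pairing and the Koethe dual\<close>

locale orlicz_duality = prob_space M for M :: "'a measure" +
  fixes \<Phi> :: "real \<Rightarrow> real"
  assumes young: "young_function \<Phi>"
begin

abbreviation \<Psi> where "\<Psi> \<equiv> young_conjugate \<Phi>"

lemma young': "young_function \<Psi>"
  by (rule young_function_conjugate[OF young])

sublocale F: orlicz_space M \<Phi> by unfold_locales (rule young)
sublocale E: orlicz_space M "young_conjugate \<Phi>" by unfold_locales (rule young')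

lemmas [measurable (raw)] = young_function_measurable[OF young] young_function_measurable[OF young']

lemma integrable_pairing:
  assumes "\<eta> \<in> orlicz M \<Phi>" "\<xi> \<in> orlicz M \<Psi>"
  shows "integrable M (\<lambda>\<omega>. \<eta> \<omega> * \<xi> \<omega>)"
proof -
  have [measurable]: "\<eta> \<in> borel_measurable M" "\<xi> \<in> borel_measurable M"
    using assms F.measurable E.measurable by auto
  obtain c d where c: "c > 0" "(\<integral>\<^sup>+ \<omega>. ennreal (\<Phi> (c * \<eta> \<omega>)) \<partial>M) \<le> 1"
    and d: "d > 0" "(\<integral>\<^sup>+ \<omega>. ennreal (\<Psi> (d * \<xi> \<omega>)) \<partial>M) \<le> 1"
    using assms by (auto simp: F.in_iff E.in_iff)
  have "integrable M (\<lambda>\<omega>. \<Phi> (c * \<eta> \<omega>))" "integrable M (\<lambda>\<omega>. \<Psi> (d * \<xi> \<omega>))"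
    using c(2) d(2) young_function_nonneg[OF young] young_function_nonneg[OF young']
    by (auto intro!: integrableI_nonneg simp: order.strict_trans1[OF _ ennreal_one_less_top])
  then have "integrable M (\<lambda>\<omega>. (\<Phi> (c * \<eta> \<omega>) + \<Psi> (d * \<xi> \<omega>)) / (c * d))"
    by auto
  then show ?thesis
  proof (rule Bochner_Integration.integrable_bound)
    show "AE \<omega> in M. norm (\<eta> \<omega> * \<xi> \<omega>) \<le> norm ((\<Phi> (c * \<eta> \<omega>) + \<Psi> (d * \<xi> \<omega>)) / (c * d))"
    proof (rule AE_I2)
      fix \<omega>
      have "\<bar>c * \<eta> \<omega>\<bar> * \<bar>d * \<xi> \<omega>\<bar> \<le> \<Phi> (c * \<eta> \<omega>) + \<Psi> (d * \<xi> \<omega>)"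
        using young_inequality[OF young, of "\<bar>c * \<eta> \<omega>\<bar>" "\<bar>d * \<xi> \<omega>\<bar>"]
        by (simp only: young_function_abs[OF young] young_function_abs[OF young'])
      then show "norm (\<eta> \<omega> * \<xi> \<omega>) \<le> norm ((\<Phi> (c * \<eta> \<omega>) + \<Psi> (d * \<xi> \<omega>)) / (c * d))"
        using c(1) d(1) young_function_nonneg[OF young, of "c * \<eta> \<omega>"] young_function_nonneg[OF young', of "d * \<xi> \<omega>"]
        by (simp add: abs_mult field_simps)
    qed
  qed auto
qed

lemma integrable_abs_pairing:
  assumes "\<eta> \<in> orlicz M \<Phi>" "\<xi> \<in> orlicz M \<Psi>"
  shows "integrable M (\<lambda>\<omega>. \<bar>\<eta> \<omega>\<bar> * \<xi> \<omega>)"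
  using integrable_pairing[OF F.abs[OF assms(1)] assms(2)] .

lemma pairing_lincomb_left:
  assumes "\<eta> \<in> orlicz M \<Phi>" "\<theta> \<in> orlicz M \<Phi>" "\<xi> \<in> orlicz M \<Psi>"
  shows "pairing M (\<lambda>\<omega>. a * \<eta> \<omega> + b * \<theta> \<omega>) \<xi> = a * pairing M \<eta> \<xi> + b * pairing M \<theta> \<xi>"
  using integrable_pairing[OF assms(1,3)] integrable_pairing[OF assms(2,3)]
  by (simp add: pairing_def distrib_right mult.assoc)

lemma pairing_lincomb_right:
  assumes "\<eta> \<in> orlicz M \<Phi>" "\<xi> \<in> orlicz M \<Psi>" "\<zeta> \<in> orlicz M \<Psi>"
  shows "pairing M \<eta> (\<lambda>\<omega>. a * \<xi> \<omega> + b * \<zeta> \<omega>) = a * pairing M \<eta> \<xi> + b * pairing M \<eta> \<zeta>"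
  using integrable_pairing[OF assms(1,2)] integrable_pairing[OF assms(1,3)]
  by (simp add: pairing_def distrib_left mult.left_commute[of _ a] mult.left_commute[of _ b])

text \<open>The witness is a truncated and normalized multiple of
  \<open>\<phi> (c * \<bar>\<eta>\<bar>)\<close>, for which Young's inequality is an equality, so
  that the pairing is the sum of the two modulars. The constant \<open>c\<close> is left free
  because it will be the weight of a series.\<close>

lemma not_orlicz_imp_large_pairing:
  assumes [measurable]: "\<eta> \<in> borel_measurable M" and "\<eta> \<notin> orlicz M \<Phi>" "0 < c"
  obtains \<zeta> where "\<zeta> \<in> borel_measurable M" "\<And>\<omega>. 0 \<le> \<zeta> \<omega>"
    "(\<integral>\<^sup>+ \<omega>. ennreal (\<Psi> (\<zeta> \<omega>)) \<partial>M) \<le> 1" "1 \<le> (\<integral>\<^sup>+ \<omega>. ennreal (c * \<bar>\<eta> \<omega>\<bar> * \<zeta> \<omega>) \<partial>M)"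
proof -
  obtain \<phi> where \<phi>: "mono \<phi>" "\<And>x. 0 \<le> x \<Longrightarrow> x * \<bar>\<phi> x\<bar> = \<Phi> x + \<Psi> \<bar>\<phi> x\<bar>"
    using young_function_subgradient[OF young] by blast
  have [measurable]: "\<phi> \<in> borel_measurable borel"
    using \<phi>(1) by (rule borel_measurable_mono)
  \<comment> \<open>A finite modular \<open>I\<close> could be scaled below \<open>1\<close> by the
    factor \<open>1 / (1 + I)\<close>, by convexity, and \<open>\<eta>\<close> would lie in the
    Orlicz space.\<close>
  have inf: "(\<integral>\<^sup>+ \<omega>. ennreal (\<Phi> (c * \<bar>\<eta> \<omega>\<bar>)) \<partial>M) = \<infinity>"
  proof (rule ccontr)
    assume *: "(\<integral>\<^sup>+ \<omega>. ennreal (\<Phi> (c * \<bar>\<eta> \<omega>\<bar>)) \<partial>M) \<noteq> \<infinity>"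
    define I where "I = enn2real (\<integral>\<^sup>+ \<omega>. ennreal (\<Phi> (c * \<bar>\<eta> \<omega>\<bar>)) \<partial>M)"
    have I: "ennreal I = (\<integral>\<^sup>+ \<omega>. ennreal (\<Phi> (c * \<bar>\<eta> \<omega>\<bar>)) \<partial>M)" "0 \<le> I"
      using * by (auto simp: I_def less_top)
    define t where "t = 1 / (1 + I)"
    have t: "0 < t" "t \<le> 1" "t * I \<le> 1"
      using I(2) by (auto simp: t_def)
    have "(\<integral>\<^sup>+ \<omega>. ennreal (\<Phi> (t * c * \<eta> \<omega>)) \<partial>M) \<le> (\<integral>\<^sup>+ \<omega>. ennreal t * ennreal (\<Phi> (c * \<bar>\<eta> \<omega>\<bar>)) \<partial>M)"
    proof (rule nn_integral_mono)
      fix \<omega>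
      have "\<Phi> (t * c * \<eta> \<omega>) = \<Phi> (t * (c * \<bar>\<eta> \<omega>\<bar>))"
        using t assms(3) by (subst young_function_abs[OF young, symmetric]) (simp add: abs_mult mult.assoc)
      also have "\<dots> \<le> t * \<Phi> (c * \<bar>\<eta> \<omega>\<bar>)"
        using t by (intro young_function_scale[OF young]) auto
      finally show "ennreal (\<Phi> (t * c * \<eta> \<omega>)) \<le> ennreal t * ennreal (\<Phi> (c * \<bar>\<eta> \<omega>\<bar>))"
        using t by (simp add: ennreal_mult'[symmetric] ennreal_leI)
    qed
    also have "\<dots> = ennreal (t * I)"
      using t I by (simp add: nn_integral_cmult ennreal_mult')
    also have "\<dots> \<le> 1" using t by simp
    finally have "\<eta> \<in> orlicz M \<Phi>"
      unfolding F.in_iff using t(1) assms(3) by (auto intro!: exI[of _ "t * c"])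
    then show False using assms(2) by simp
  qed
  \<comment> \<open>Truncation to \<open>\<bar>\<eta>\<bar> \<le> N\<close> makes
    \<open>\<xi>\<close> below bounded, hence its \<open>\<Psi>\<close>-modular finite; by monotone
    convergence some \<open>N\<close> still leaves a \<open>\<Phi>\<close>-modular above
    \<open>1\<close>.\<close>
  define A where "A N = {\<omega> \<in> space M. \<bar>\<eta> \<omega>\<bar> \<le> real N}" for N
  have [measurable]: "A N \<in> sets M" for N by (auto simp: A_def)
  have "(SUP N. \<integral>\<^sup>+ \<omega>. ennreal (\<Phi> (c * \<bar>\<eta> \<omega>\<bar>)) * indicator (A N) \<omega> \<partial>M) =
      (\<integral>\<^sup>+ \<omega>. (SUP N. ennreal (\<Phi> (c * \<bar>\<eta> \<omega>\<bar>)) * indicator (A N) \<omega>) \<partial>M)"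
    by (rule nn_integral_monotone_convergence_SUP[symmetric])
       (auto simp: incseq_def le_fun_def A_def indicator_def)
  also have "\<dots> = (\<integral>\<^sup>+ \<omega>. ennreal (\<Phi> (c * \<bar>\<eta> \<omega>\<bar>)) \<partial>M)"
  proof (rule nn_integral_cong)
    fix \<omega> assume "\<omega> \<in> space M"
    moreover obtain N where "\<bar>\<eta> \<omega>\<bar> \<le> real N" using real_arch_simple by blast
    ultimately have "ennreal (\<Phi> (c * \<bar>\<eta> \<omega>\<bar>)) \<le> (SUP N. ennreal (\<Phi> (c * \<bar>\<eta> \<omega>\<bar>)) * indicator (A N) \<omega>)"
      by (intro SUP_upper2[of N]) (auto simp: A_def)
    then show "(SUP N. ennreal (\<Phi> (c * \<bar>\<eta> \<omega>\<bar>)) * indicator (A N) \<omega>) = ennreal (\<Phi> (c * \<bar>\<eta> \<omega>\<bar>))"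
      by (intro antisym SUP_least) (auto simp: indicator_def)
  qed
  finally have "1 < (SUP N. \<integral>\<^sup>+ \<omega>. ennreal (\<Phi> (c * \<bar>\<eta> \<omega>\<bar>)) * indicator (A N) \<omega> \<partial>M)"
    unfolding inf by (simp only: infinity_ennreal_def ennreal_one_less_top)
  then obtain N where N: "1 < (\<integral>\<^sup>+ \<omega>. ennreal (\<Phi> (c * \<bar>\<eta> \<omega>\<bar>)) * indicator (A N) \<omega> \<partial>M)"
    by (auto simp: less_SUP_iff)
  define \<xi> where "\<xi> \<omega> = \<bar>\<phi> (c * \<bar>\<eta> \<omega>\<bar>)\<bar> * indicator (A N) \<omega>" for \<omega>
  have [measurable]: "\<xi> \<in> borel_measurable M" unfolding \<xi>_def by measurable
  define B where "B = \<bar>\<phi> 0\<bar> + \<bar>\<phi> (c * real N)\<bar>"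
  have \<xi>B: "0 \<le> \<xi> \<omega>" "\<xi> \<omega> \<le> B" for \<omega>
  proof -
    have "\<omega> \<in> A N \<Longrightarrow> \<phi> 0 \<le> \<phi> (c * \<bar>\<eta> \<omega>\<bar>) \<and> \<phi> (c * \<bar>\<eta> \<omega>\<bar>) \<le> \<phi> (c * real N)"
      using assms(3) by (intro conjI monoD[OF \<phi>(1)]) (auto simp: A_def)
    then show "0 \<le> \<xi> \<omega>" "\<xi> \<omega> \<le> B"
      by (auto simp: \<xi>_def B_def indicator_def)
  qed
  have fin: "(\<integral>\<^sup>+ \<omega>. ennreal (\<Psi> (\<xi> \<omega>)) \<partial>M) \<noteq> \<infinity>"
  proof -
    have "(\<integral>\<^sup>+ \<omega>. ennreal (\<Psi> (\<xi> \<omega>)) \<partial>M) \<le> (\<integral>\<^sup>+ \<omega>. ennreal (\<Psi> B) \<partial>M)"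
      using \<xi>B by (intro nn_integral_mono ennreal_leI young_function_mono[OF young']) (auto simp: abs_of_nonneg intro: order_trans[OF _ abs_ge_self])
    also have "\<dots> < \<infinity>" by (simp add: emeasure_space_1)
    finally show ?thesis by simp
  qed
  define b where "b = enn2real (\<integral>\<^sup>+ \<omega>. ennreal (\<Psi> (\<xi> \<omega>)) \<partial>M)"
  have b: "ennreal b = (\<integral>\<^sup>+ \<omega>. ennreal (\<Psi> (\<xi> \<omega>)) \<partial>M)" "0 \<le> b"
    using fin by (auto simp: b_def less_top)
  \<comment> \<open>One factor serves both bounds: the \<open>\<Psi>\<close>-modular of
    \<open>t * \<xi>\<close> is at most \<open>t * b \<le> 1\<close>, while its pairing with
    \<open>c * \<bar>\<eta>\<bar>\<close> is at least \<open>t * (1 + b) = 1\<close>.\<close>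
  define t where "t = 1 / (1 + b)"
  have t: "0 < t" "t \<le> 1" "t * b \<le> 1" "t * (1 + b) = 1"
    using b(2) by (auto simp: t_def)
  show ?thesis
  proof (rule that[of "\<lambda>\<omega>. t * \<xi> \<omega>"])
    have "(\<integral>\<^sup>+ \<omega>. ennreal (\<Psi> (t * \<xi> \<omega>)) \<partial>M) \<le> (\<integral>\<^sup>+ \<omega>. ennreal t * ennreal (\<Psi> (\<xi> \<omega>)) \<partial>M)"
      using t young_function_scale[OF young', of t]
      by (intro nn_integral_mono) (simp add: ennreal_mult'[symmetric] ennreal_leI)
    also have "\<dots> = ennreal (t * b)"
      using t b by (simp add: nn_integral_cmult ennreal_mult')
    also have "\<dots> \<le> 1" using t by simp
    finally show "(\<integral>\<^sup>+ \<omega>. ennreal (\<Psi> (t * \<xi> \<omega>)) \<partial>M) \<le> 1" .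
    have "1 = ennreal t * (1 + ennreal b)"
      using t b(2) by (simp add: ennreal_mult'[symmetric] flip: ennreal_1 ennreal_plus)
    also have "\<dots> \<le> ennreal t * ((\<integral>\<^sup>+ \<omega>. ennreal (\<Phi> (c * \<bar>\<eta> \<omega>\<bar>)) * indicator (A N) \<omega> \<partial>M) + (\<integral>\<^sup>+ \<omega>. ennreal (\<Psi> (\<xi> \<omega>)) \<partial>M))"
      using N b by (intro mult_left_mono add_mono) auto
    also have "\<dots> = (\<integral>\<^sup>+ \<omega>. ennreal t * (ennreal (\<Phi> (c * \<bar>\<eta> \<omega>\<bar>)) * indicator (A N) \<omega> + ennreal (\<Psi> (\<xi> \<omega>))) \<partial>M)"
      by (simp add: nn_integral_add nn_integral_cmult)
    also have "\<dots> = (\<integral>\<^sup>+ \<omega>. ennreal (c * \<bar>\<eta> \<omega>\<bar> * (t * \<xi> \<omega>)) \<partial>M)"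
    proof (rule nn_integral_cong)
      fix \<omega>
      have "ennreal (\<Phi> (c * \<bar>\<eta> \<omega>\<bar>)) * indicator (A N) \<omega> + ennreal (\<Psi> (\<xi> \<omega>)) = ennreal (c * \<bar>\<eta> \<omega>\<bar> * \<xi> \<omega>)"
      proof (cases "\<omega> \<in> A N")
        case True
        then show ?thesis
          using \<phi>(2)[of "c * \<bar>\<eta> \<omega>\<bar>"] assms(3) young_function_nonneg[OF young] young_function_nonneg[OF young']
          by (simp add: \<xi>_def)
      next
        case False
        then show ?thesis using young' by (simp add: \<xi>_def young_function_def)
      qed
      then show "ennreal t * (ennreal (\<Phi> (c * \<bar>\<eta> \<omega>\<bar>)) * indicator (A N) \<omega> + ennreal (\<Psi> (\<xi> \<omega>))) = ennreal (c * \<bar>\<eta> \<omega>\<bar> * (t * \<xi> \<omega>))"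
        using t(1) by (simp add: ennreal_mult'[symmetric] mult_ac)
    qed
    finally show "1 \<le> (\<integral>\<^sup>+ \<omega>. ennreal (c * \<bar>\<eta> \<omega>\<bar> * (t * \<xi> \<omega>)) \<partial>M)" .
  qed (use t \<xi>B in auto)
qed

text \<open>Countable convexity of the unit ball. Finite sums obey the modular bound by convexity,
  and Fatou carries it to the limit; a uniform \<open>L\<^sup>1\<close> bound provides the a.s.
  convergence.\<close>

lemma orlicz_ball_series:
  assumes [measurable]: "\<And>n. \<zeta> n \<in> borel_measurable M" and pos: "\<And>n \<omega>. 0 \<le> \<zeta> n \<omega>"
    and ball: "\<And>n. (\<integral>\<^sup>+ \<omega>. ennreal (\<Psi> (\<zeta> n \<omega>)) \<partial>M) \<le> 1"
    and w: "\<And>n. 0 \<le> w n" "w sums 1"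
  shows "AE \<omega> in M. summable (\<lambda>n. w n * \<zeta> n \<omega>)"
    and "(\<lambda>\<omega>. \<Sum>n. w n * \<zeta> n \<omega>) \<in> orlicz M \<Psi>"
proof -
  let ?S = "\<lambda>N \<omega>. \<Sum>n<N. w n * \<zeta> n \<omega>"
  \<comment> \<open>Young's inequality with first factor \<open>1\<close> reads
    \<open>\<zeta> \<le> \<Phi> 1 + \<Psi> \<zeta>\<close>, so the modular controls the
    mean.\<close>
  have L1: "(\<integral>\<^sup>+ \<omega>. ennreal (\<zeta> n \<omega>) \<partial>M) \<le> ennreal (\<Phi> 1) + 1" for n
  proof -
    have "(\<integral>\<^sup>+ \<omega>. ennreal (\<zeta> n \<omega>) \<partial>M) \<le> (\<integral>\<^sup>+ \<omega>. ennreal (\<Phi> 1) + ennreal (\<Psi> (\<zeta> n \<omega>)) \<partial>M)"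
      using young_inequality[OF young, of 1] young_function_nonneg[OF young] young_function_nonneg[OF young']
      by (intro nn_integral_mono) (simp add: ennreal_leI flip: ennreal_plus)
    also have "\<dots> = ennreal (\<Phi> 1) + (\<integral>\<^sup>+ \<omega>. ennreal (\<Psi> (\<zeta> n \<omega>)) \<partial>M)"
      by (simp add: nn_integral_add emeasure_space_1)
    also have "\<dots> \<le> ennreal (\<Phi> 1) + 1"
      using ball by (intro add_mono) auto
    finally show ?thesis .
  qed
  have geo: "(\<Sum>n. ennreal (w n)) = 1"
    using suminf_ennreal_eq[OF w] by simp
  have sum_w: "(\<Sum>n<N. w n) \<le> 1" for N
    using sum_le_suminf[of w "{..<N}"] w by (simp add: sums_iff)
  have "(\<integral>\<^sup>+ \<omega>. (\<Sum>n. ennreal (w n * \<zeta> n \<omega>)) \<partial>M) =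
      (\<Sum>n. ennreal (w n) * (\<integral>\<^sup>+ \<omega>. ennreal (\<zeta> n \<omega>) \<partial>M))"
    by (simp add: nn_integral_suminf nn_integral_cmult ennreal_mult' w(1))
  also have "\<dots> \<le> (\<Sum>n. ennreal (w n) * (ennreal (\<Phi> 1) + 1))"
    by (intro suminf_le mult_left_mono L1) auto
  also have "\<dots> = ennreal (\<Phi> 1) + 1"
    using geo by simp
  also have "\<dots> < \<infinity>" by simp
  finally have "(\<integral>\<^sup>+ \<omega>. (\<Sum>n. ennreal (w n * \<zeta> n \<omega>)) \<partial>M) \<noteq> \<infinity>"
    by simp
  then have "AE \<omega> in M. (\<Sum>n. ennreal (w n * \<zeta> n \<omega>)) \<noteq> \<infinity>"
    by (intro nn_integral_noteq_infinite) auto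
  then show summ: "AE \<omega> in M. summable (\<lambda>n. w n * \<zeta> n \<omega>)"
    by eventually_elim (rule summable_suminf_not_top, use pos w in auto)
  have S: "(\<integral>\<^sup>+ \<omega>. ennreal (\<Psi> (?S N \<omega>)) \<partial>M) \<le> 1" for N
  proof -
    have "(\<integral>\<^sup>+ \<omega>. ennreal (\<Psi> (?S N \<omega>)) \<partial>M) \<le> (\<integral>\<^sup>+ \<omega>. (\<Sum>n<N. ennreal (w n) * ennreal (\<Psi> (\<zeta> n \<omega>))) \<partial>M)"
    proof (rule nn_integral_mono)
      fix \<omega>
      have "\<Psi> (?S N \<omega>) \<le> (\<Sum>n<N. w n * \<Psi> (\<zeta> n \<omega>))"
        by (rule young_function_sum_le[OF young' w(1) sum_w])
      then show "ennreal (\<Psi> (?S N \<omega>)) \<le> (\<Sum>n<N. ennreal (w n) * ennreal (\<Psi> (\<zeta> n \<omega>)))"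
        using young_function_nonneg[OF young'] w(1)
        by (simp add: ennreal_mult'[symmetric] sum_ennreal ennreal_leI)
    qed
    also have "\<dots> = (\<Sum>n<N. ennreal (w n) * (\<integral>\<^sup>+ \<omega>. ennreal (\<Psi> (\<zeta> n \<omega>)) \<partial>M))"
      by (simp add: nn_integral_sum nn_integral_cmult)
    also have "\<dots> \<le> (\<Sum>n<N. ennreal (w n) * 1)"
      by (intro sum_mono mult_left_mono ball) auto
    also have "\<dots> \<le> 1"
      using sum_w[of N] w(1) by (simp add: sum_ennreal)
    finally show ?thesis .
  qed
  have "(\<integral>\<^sup>+ \<omega>. ennreal (\<Psi> (\<Sum>n. w n * \<zeta> n \<omega>)) \<partial>M) = (\<integral>\<^sup>+ \<omega>. liminf (\<lambda>N. ennreal (\<Psi> (?S N \<omega>))) \<partial>M)"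
    using summ
  proof (intro nn_integral_cong_AE, eventually_elim)
    case (elim \<omega>)
    have "isCont \<Psi> x" for x
      using young_function_continuous[OF young'] by (simp add: continuous_on_eq_continuous_at)
    then have "(\<lambda>N. ennreal (\<Psi> (?S N \<omega>))) \<longlonglongrightarrow> ennreal (\<Psi> (\<Sum>n. w n * \<zeta> n \<omega>))"
      by (intro tendsto_ennrealI isCont_tendsto_compose[of _ \<Psi>] summable_LIMSEQ elim)
    then show ?case by (metis lim_imp_Liminf trivial_limit_sequentially)
  qed
  also have "\<dots> \<le> liminf (\<lambda>N. \<integral>\<^sup>+ \<omega>. ennreal (\<Psi> (?S N \<omega>)) \<partial>M)"
    by (rule nn_integral_liminf) auto
  also have "\<dots> \<le> liminf (\<lambda>N. 1)"
    by (intro Liminf_mono always_eventually allI S)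
  finally have "(\<integral>\<^sup>+ \<omega>. ennreal (\<Psi> (\<Sum>n. w n * \<zeta> n \<omega>)) \<partial>M) \<le> 1"
    by (simp add: Liminf_const)
  then show "(\<lambda>\<omega>. \<Sum>n. w n * \<zeta> n \<omega>) \<in> orlicz M \<Psi>"
    unfolding E.in_iff by (auto intro!: exI[of _ 1])
qed

text \<open>If \<open>\<eta>\<close> were outside, the weights \<open>w n = 2^-(n+1)\<close> could
  be used twice: as the constants for which \<open>\<zeta> n\<close> pairs with
  \<open>w n * \<bar>\<eta>\<bar>\<close> to at least \<open>1\<close>, and as the coefficients of a
  series \<open>\<Sum> w n * \<zeta> n\<close> that stays in \<open>L\<^sub>\<Psi>\<close>. Its
  pairing with \<open>\<bar>\<eta>\<bar>\<close> then exceeds every natural number.\<close>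

lemma koethe_dual:
  assumes [measurable]: "\<eta> \<in> borel_measurable M"
    and int: "\<And>\<xi>. \<xi> \<in> orlicz M \<Psi> \<Longrightarrow> integrable M (\<lambda>\<omega>. \<eta> \<omega> * \<xi> \<omega>)"
  shows "\<eta> \<in> orlicz M \<Phi>"
proof (rule ccontr)
  assume "\<eta> \<notin> orlicz M \<Phi>"
  define w :: "nat \<Rightarrow> real" where "w n = (1/2) ^ Suc n" for n
  have w: "0 < w n" "w sums 1" for n
    using power_half_series by (auto simp: w_def[abs_def])
  have "\<exists>\<zeta>. \<zeta> \<in> borel_measurable M \<and> (\<forall>\<omega>. 0 \<le> \<zeta> \<omega>) \<and> (\<integral>\<^sup>+ \<omega>. ennreal (\<Psi> (\<zeta> \<omega>)) \<partial>M) \<le> 1 \<and>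
      1 \<le> (\<integral>\<^sup>+ \<omega>. ennreal (w n * \<bar>\<eta> \<omega>\<bar> * \<zeta> \<omega>) \<partial>M)" for n
    by (rule not_orlicz_imp_large_pairing[OF assms(1) \<open>\<eta> \<notin> orlicz M \<Phi>\<close> w(1)[of n]]) blast
  then obtain \<zeta> where [measurable]: "\<And>n. \<zeta> n \<in> borel_measurable M" and pos: "\<And>n \<omega>. 0 \<le> \<zeta> n \<omega>"
    and ball: "\<And>n. (\<integral>\<^sup>+ \<omega>. ennreal (\<Psi> (\<zeta> n \<omega>)) \<partial>M) \<le> 1"
    and large: "\<And>n. 1 \<le> (\<integral>\<^sup>+ \<omega>. ennreal (w n * \<bar>\<eta> \<omega>\<bar> * \<zeta> n \<omega>) \<partial>M)"
    by metis
  let ?\<xi> = "\<lambda>\<omega>. \<Sum>n. w n * \<zeta> n \<omega>"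
  note series = orlicz_ball_series[of \<zeta> w, OF _ pos ball less_imp_le[OF w(1)] w(2)]
  have "integrable M (\<lambda>\<omega>. \<eta> \<omega> * ?\<xi> \<omega>)"
    by (rule int[OF series(2)]) auto
  then have fin: "(\<integral>\<^sup>+ \<omega>. ennreal (norm (\<eta> \<omega> * ?\<xi> \<omega>)) \<partial>M) < \<infinity>"
    by (simp add: integrable_iff_bounded)
  have "of_nat N \<le> (\<integral>\<^sup>+ \<omega>. ennreal (norm (\<eta> \<omega> * ?\<xi> \<omega>)) \<partial>M)" for N :: nat
  proof -
    have "of_nat N = (\<Sum>n<N. 1 :: ennreal)" by simp
    also have "\<dots> \<le> (\<Sum>n<N. \<integral>\<^sup>+ \<omega>. ennreal (w n * \<bar>\<eta> \<omega>\<bar> * \<zeta> n \<omega>) \<partial>M)"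
      by (intro sum_mono large)
    also have "\<dots> = (\<integral>\<^sup>+ \<omega>. (\<Sum>n<N. ennreal (w n * \<bar>\<eta> \<omega>\<bar> * \<zeta> n \<omega>)) \<partial>M)"
      by (rule nn_integral_sum[symmetric]) auto
    also have "\<dots> \<le> (\<integral>\<^sup>+ \<omega>. ennreal (norm (\<eta> \<omega> * ?\<xi> \<omega>)) \<partial>M)"
    proof (rule nn_integral_mono_AE)
      show "AE \<omega> in M. (\<Sum>n<N. ennreal (w n * \<bar>\<eta> \<omega>\<bar> * \<zeta> n \<omega>)) \<le> ennreal (norm (\<eta> \<omega> * ?\<xi> \<omega>))"
        using series(1)[simplified]
      proof eventually_elim
        case (elim \<omega>)
        have "(\<Sum>n<N. ennreal (w n * \<bar>\<eta> \<omega>\<bar> * \<zeta> n \<omega>)) = ennreal (\<bar>\<eta> \<omega>\<bar> * (\<Sum>n<N. w n * \<zeta> n \<omega>))"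
          using pos w(1) by (subst sum_ennreal) (auto simp: less_imp_le sum_distrib_left mult_ac)
        also have "\<dots> \<le> ennreal (\<bar>\<eta> \<omega>\<bar> * ?\<xi> \<omega>)"
          using elim pos w(1) by (intro ennreal_leI mult_left_mono sum_le_suminf) (auto simp: less_imp_le)
        also have "\<dots> \<le> ennreal (norm (\<eta> \<omega> * ?\<xi> \<omega>))"
          by (intro ennreal_leI) (simp add: abs_mult mult_left_mono)
        finally show ?case .
      qed
    qed
    finally show ?thesis .
  qed
  moreover obtain N :: nat where "(\<integral>\<^sup>+ \<omega>. ennreal (norm (\<eta> \<omega> * ?\<xi> \<omega>)) \<partial>M) < of_nat N"
    using fin ennreal_Ex_less_of_nat by fastforce
  ultimately show False
    by (meson not_le)
qed

end

subsection \<open>The Hahn-Banach theorem\<close>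

text \<open>The carrier is a set \<open>V\<close>, since the space to which Hahn-Banach will be
  applied is a set of functions inside the full function type.\<close>

locale real_subspace = vector_space scale
  for scale :: "real \<Rightarrow> 'b::ab_group_add \<Rightarrow> 'b" (infixr \<open>\<odot>\<close> 75) +
  fixes V :: "'b set"
  assumes subspace: "subspace V"
begin

lemmas mem = subspace_add[OF subspace] subspace_scale[OF subspace] subspace_0[OF subspace] subspace_neg[OF subspace]

text \<open>Inequality for positive scalars is enough: applied to the inverse scalar it yields
  equality, and it forces the value \<open>0\<close> at \<open>0\<close>.\<close>

definition sublinear :: "('b \<Rightarrow> real) \<Rightarrow> bool" where
  "sublinear q \<longleftrightarrow> (\<forall>x\<in>V. \<forall>c>0. q (c \<odot> x) \<le> c * q x) \<and> (\<forall>x\<in>V. \<forall>y\<in>V. q (x + y) \<le> q x + q y)"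

lemma sublinearD:
  assumes "sublinear q"
  shows "x \<in> V \<Longrightarrow> 0 < c \<Longrightarrow> q (c \<odot> x) \<le> c * q x"
    and "x \<in> V \<Longrightarrow> y \<in> V \<Longrightarrow> q (x + y) \<le> q x + q y"
  using assms by (auto simp: sublinear_def)

lemma sublinear_zero: "sublinear q \<Longrightarrow> q 0 = 0"
  using sublinearD(1)[of q 0 2] sublinearD(1)[of q 0 "1/2"] mem(3) by simp

lemma sublinear_scale:
  assumes "sublinear q" "x \<in> V" "0 \<le> c"
  shows "q (c \<odot> x) = c * q x"
proof (cases "c = 0")
  case False
  then have "c * q x = c * q (inverse c \<odot> c \<odot> x)" by simp
  also have "\<dots> \<le> c * (inverse c * q (c \<odot> x))"
    using False assms by (intro mult_left_mono sublinearD(1)) (auto intro: mem)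
  also have "\<dots> = q (c \<odot> x)" using False by simp
  finally show ?thesis
    using sublinearD(1)[OF assms(1,2), of c] False assms(3) by simp
qed (use assms sublinear_zero in auto)

lemma sublinear_ge: "sublinear q \<Longrightarrow> x \<in> V \<Longrightarrow> - q (- x) \<le> q x"
  using sublinearD(2)[of q x "- x"] sublinear_zero[of q] mem(4)[of x] by simp

text \<open>The last property forces \<open>r (- z) = - q z = - r z\<close>. A minimal sublinear functional is left
  unchanged by this reduction for every \<open>z\<close>, and hence linear.\<close>

lemma sublinear_reduce:
  assumes q: "sublinear q" and z: "z \<in> V"
  obtains r where "sublinear r" "\<And>x. x \<notin> V \<Longrightarrow> r x = 0" "\<And>x. x \<in> V \<Longrightarrow> r x \<le> q x"
    "\<And>x. x \<in> V \<Longrightarrow> r x \<le> q (x + z) - q z"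
proof -
  \<comment> \<open>Infimum of \<open>q\<close> along the ray in direction \<open>z\<close>,
    corrected by its linear growth. The choice \<open>t = 0\<close> gives \<open>r \<le> q\<close>
    and \<open>t = 1\<close> gives the last property; subadditivity holds because the parameters of
    two points add up. The value \<open>0\<close> off \<open>V\<close> makes functions that agree on
    \<open>V\<close> equal.\<close>
  define r where "r x = (if x \<in> V then INF t\<in>{0..}. q (x + t \<odot> z) - t * q z else 0)" for x
  have bdd: "bdd_below ((\<lambda>t. q (x + t \<odot> z) - t * q z) ` {0..})" if "x \<in> V" for x
  proof (rule bdd_belowI2)
    fix t :: real assume t: "t \<in> {0..}"
    have "q (t \<odot> z) \<le> q (x + t \<odot> z) + q (- x)"
      using sublinearD(2)[OF q, of "x + t \<odot> z" "- x"] that z by (simp add: mem)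
    then show "- q (- x) \<le> q (x + t \<odot> z) - t * q z"
      using t sublinear_scale[OF q z, of t] by simp
  qed
  have le: "r x \<le> q (x + t \<odot> z) - t * q z" if "x \<in> V" "0 \<le> t" for x t
    unfolding r_def using that bdd by (auto intro: cINF_lower)
  have ge: "c \<le> r x" if "x \<in> V" "\<And>t. 0 \<le> t \<Longrightarrow> c \<le> q (x + t \<odot> z) - t * q z" for c x
    unfolding r_def using that by (auto intro!: cINF_greatest)
  show ?thesis
  proof (rule that)
    show "sublinear r"
      unfolding sublinear_def
    proof (intro conjI ballI allI impI)
      fix x c assume x: "x \<in> V" and c: "(0::real) < c"
      have "r (c \<odot> x) / c \<le> r x"
      proof (rule ge[OF x])
        fix t :: real assume t: "0 \<le> t"
        have "r (c \<odot> x) \<le> q (c \<odot> x + (c * t) \<odot> z) - c * t * q z"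
          using x t c by (intro le mem) auto
        also have "c \<odot> x + (c * t) \<odot> z = c \<odot> (x + t \<odot> z)"
          by (simp add: scale_right_distrib)
        also have "q (c \<odot> (x + t \<odot> z)) = c * q (x + t \<odot> z)"
          using x z c by (intro sublinear_scale[OF q] mem) auto
        finally show "r (c \<odot> x) / c \<le> q (x + t \<odot> z) - t * q z"
          using c by (simp add: field_simps)
      qed
      then show "r (c \<odot> x) \<le> c * r x" using c by (simp add: field_simps)
    next
      fix x y assume x: "x \<in> V" and y: "y \<in> V"
      have "r (x + y) - r x \<le> r y"
      proof (rule ge[OF y])
        fix s :: real assume s: "0 \<le> s"
        have "r (x + y) - (q (y + s \<odot> z) - s * q z) \<le> r x"
        proof (rule ge[OF x])
          fix t :: real assume t: "0 \<le> t"
          have "r (x + y) \<le> q (x + y + (t + s) \<odot> z) - (t + s) * q z"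
            using x y s t by (intro le mem) auto
          also have "x + y + (t + s) \<odot> z = (x + t \<odot> z) + (y + s \<odot> z)"
            by (simp add: scale_left_distrib)
          also have "q \<dots> \<le> q (x + t \<odot> z) + q (y + s \<odot> z)"
            using x y z by (intro sublinearD(2)[OF q] mem) auto
          finally show "r (x + y) - (q (y + s \<odot> z) - s * q z) \<le> q (x + t \<odot> z) - t * q z"
            by (simp add: distrib_right)
        qed
        then show "r (x + y) - r x \<le> q (y + s \<odot> z) - s * q z" by simp
      qed
      then show "r (x + y) \<le> r x + r y" by simp
    qed
  qed (use le[of _ 0] le[of _ 1] in \<open>auto simp: r_def\<close>)
qed

text \<open>Zorn's lemma for the reversed pointwise order \<open>P\<close>, in which a maximal
  element is a minimal functional. The estimate \<open>- p (- x) \<le> q x\<close> keeps infima of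
  chains finite. The third property comes from applying \<open>sublinear_reduce\<close> to the
  minimal \<open>q\<close>, which must return \<open>q\<close> itself.\<close>

lemma minimal_sublinear_exists:
  assumes p: "sublinear p"
  obtains q where "sublinear q" "\<And>x. x \<in> V \<Longrightarrow> q x \<le> p x"
    "\<And>x z. x \<in> V \<Longrightarrow> z \<in> V \<Longrightarrow> q x \<le> q (x + z) - q z"
proof -
  define A where "A = {q. sublinear q \<and> (\<forall>x. x \<notin> V \<longrightarrow> q x = 0) \<and> (\<forall>x\<in>V. q x \<le> p x)}"
  define P where "P q q' \<longleftrightarrow> (\<forall>x\<in>V. q' x \<le> q x)" for q q' :: "'b \<Rightarrow> real"
  have "\<exists>m\<in>A. \<forall>a\<in>A. P m a \<longrightarrow> a = m"
  proof (rule predicate_Zorn)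
    show "partial_order_on A (relation_of P A)"
    proof (rule partial_order_on_relation_ofI)
      show "q = q'" if q: "q \<in> A" "q' \<in> A" "P q q'" "P q' q" for q q'
      proof
        fix x show "q x = q' x"
          using q by (cases "x \<in> V") (force simp: A_def P_def)+
      qed
    qed (force simp: P_def)+
  next
    fix C assume C: "C \<in> Chains (relation_of P A)"
    then have CA: "C \<subseteq> A" by (force simp: Chains_def relation_of_def)
    have chain: "P q q' \<or> P q' q" if "q \<in> C" "q' \<in> C" for q q'
      using C that by (auto simp: Chains_def relation_of_def)
    show "\<exists>u\<in>A. \<forall>a\<in>C. P a u"
    proof (cases "C = {}")
      case True
      have "(\<lambda>x. if x \<in> V then p x else 0) \<in> A"
        using p by (auto simp: A_def sublinear_def mem)
      then show ?thesis using True by auto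
    next
      case False
      have lower: "- p (- x) \<le> q x" if "q \<in> C" "x \<in> V" for q x
        using sublinear_ge[of q x] that CA mem(4)[of x] unfolding A_def by force
      define u where "u x = (if x \<in> V then INF q\<in>C. q x else 0)" for x
      have le: "u x \<le> q x" if "q \<in> C" "x \<in> V" for q x
        unfolding u_def using that lower[OF _ that(2)] by (auto intro!: cINF_lower bdd_belowI2[of _ "- p (- x)"])
      have ge: "c \<le> u x" if "x \<in> V" "\<And>q. q \<in> C \<Longrightarrow> c \<le> q x" for c x
        unfolding u_def using that False by (auto intro!: cINF_greatest)
      have sub: "sublinear q" if "q \<in> C" for q using that CA by (auto simp: A_def)
      have "sublinear u"
        unfolding sublinear_def
      proof (intro conjI ballI allI impI)
        fix x c assume x: "x \<in> V" and c: "(0::real) < c"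
        have "u (c \<odot> x) / c \<le> u x"
        proof (rule ge[OF x])
          fix q assume q: "q \<in> C"
          have "u (c \<odot> x) \<le> q (c \<odot> x)" using q x by (intro le mem)
          also have "\<dots> \<le> c * q x" using sublinearD(1)[OF sub[OF q] x c] .
          finally show "u (c \<odot> x) / c \<le> q x" using c by (simp add: field_simps)
        qed
        then show "u (c \<odot> x) \<le> c * u x" using c by (simp add: field_simps)
      next
        fix x y assume x: "x \<in> V" and y: "y \<in> V"
        have "u (x + y) - u x \<le> u y"
        proof (rule ge[OF y])
          fix q assume q: "q \<in> C"
          have "u (x + y) - q y \<le> u x"
          proof (rule ge[OF x])
            fix q' assume q': "q' \<in> C"
            \<comment> \<open>Subadditivity of the infimum needs one member of the chain that is
              good at \<open>x\<close> and at \<open>y\<close> simultaneously: the smaller of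
              \<open>q\<close> and \<open>q'\<close>.\<close>
            obtain s where s: "s \<in> C" "s x \<le> q' x" "s y \<le> q y"
              using chain[OF q q'] q q' x y by (auto simp: P_def)
            have "u (x + y) \<le> s (x + y)" using s x y by (intro le mem)
            also have "\<dots> \<le> s x + s y" using sublinearD(2)[OF sub[OF s(1)] x y] .
            finally show "u (x + y) - q y \<le> q' x" using s by simp
          qed
          then show "u (x + y) - u x \<le> q y" by simp
        qed
        then show "u (x + y) \<le> u x + u y" by simp
      qed
      moreover have "u x \<le> p x" if "x \<in> V" for x
      proof -
        obtain q where "q \<in> C" using False by blast
        then show ?thesis using le[of q x] that CA by (force simp: A_def)
      qed
      ultimately have "u \<in> A" by (auto simp: A_def u_def)
      then show ?thesis using le by (auto simp: P_def)
    qed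
  qed
  then obtain q where q: "q \<in> A" and min: "\<And>a. a \<in> A \<Longrightarrow> P q a \<Longrightarrow> a = q" by blast
  show ?thesis
  proof (rule that[of q])
    fix x z assume x: "x \<in> V" and z: "z \<in> V"
    have "sublinear q" using q by (simp add: A_def)
    then obtain r where
      r: "sublinear r" "\<And>x. x \<notin> V \<Longrightarrow> r x = 0" "\<And>x. x \<in> V \<Longrightarrow> r x \<le> q x"
        "\<And>x. x \<in> V \<Longrightarrow> r x \<le> q (x + z) - q z"
      by (rule sublinear_reduce[OF _ z]) (rule that)
    have "r = q"
    proof (rule min)
      show "r \<in> A"
        using r(1-3) q order_trans unfolding A_def by blast
    qed (use r(3) in \<open>simp add: P_def\<close>)
    then show "q x \<le> q (x + z) - q z" using r(4)[OF x] by simp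
  qed (use q in \<open>auto simp: A_def\<close>)
qed

text \<open>Minimality gives superadditivity, hence linearity. To attain the value at
  \<open>x0\<close>, the reduction is applied at \<open>x0\<close> before the minimal functional is
  taken: it forces \<open>l (- x0) \<le> p 0 - p x0 = - p x0\<close>, so linearity gives
  \<open>l x0 \<ge> p x0\<close>.\<close>

theorem hahn_banach:
  assumes p: "sublinear p" and x0: "x0 \<in> V"
  obtains l where "\<And>x y a b. x \<in> V \<Longrightarrow> y \<in> V \<Longrightarrow> l (a \<odot> x + b \<odot> y) = a * l x + b * l y"
    "\<And>x. x \<in> V \<Longrightarrow> l x \<le> p x" "l x0 = p x0"
proof -
  obtain r where r: "sublinear r" "\<And>x. x \<notin> V \<Longrightarrow> r x = 0" "\<And>x. x \<in> V \<Longrightarrow> r x \<le> p x"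
    "\<And>x. x \<in> V \<Longrightarrow> r x \<le> p (x + x0) - p x0"
    by (rule sublinear_reduce[OF p x0]) (rule that)
  obtain l where l: "sublinear l" "\<And>x. x \<in> V \<Longrightarrow> l x \<le> r x"
    and super: "\<And>x z. x \<in> V \<Longrightarrow> z \<in> V \<Longrightarrow> l x \<le> l (x + z) - l z"
    by (rule minimal_sublinear_exists[OF r(1)]) (rule that)
  have add: "l (x + y) = l x + l y" if "x \<in> V" "y \<in> V" for x y
    using super[OF that] sublinearD(2)[OF l(1) that] by simp
  have neg: "l (- x) = - l x" if "x \<in> V" for x
    using add[OF that mem(4)[OF that]] sublinear_zero[OF l(1)] by simp
  have scale: "l (a \<odot> x) = a * l x" if "x \<in> V" for a x
  proof (cases "0 \<le> a")
    case True
    then show ?thesis using sublinear_scale[OF l(1) that] by simp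
  next
    case False
    then have "l (- a \<odot> x) = - a * l x"
      by (intro sublinear_scale[OF l(1) that]) auto
    then show ?thesis using neg[OF mem(2)[OF that], of a] by simp
  qed
  show ?thesis
  proof (rule that)
    show "l x \<le> p x" if "x \<in> V" for x
      using l(2)[OF that] r(3)[OF that] by simp
    have "l (- x0) \<le> - p x0"
      using l(2)[OF mem(4)[OF x0]] r(4)[OF mem(4)[OF x0]] sublinear_zero[OF p] by simp
    then show "l x0 = p x0"
      using neg[OF x0] l(2)[OF x0] r(3)[OF x0] by simp
  qed (simp add: add scale mem)
qed

end

subsection \<open>Order continuous functionals\<close>

text \<open>Finite additivity and continuity at the empty set amount to countable additivity, and
  vanishing on null sets is absolute continuity. The density is a.e. finite because
  \<open>\<mu>\<close> is, so it has a real version.\<close>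

lemma (in prob_space) Radon_Nikodym_charge:
  fixes \<mu> :: "'a set \<Rightarrow> real"
  assumes nonneg: "\<And>A. A \<in> sets M \<Longrightarrow> 0 \<le> \<mu> A"
    and add: "\<And>A B. A \<in> sets M \<Longrightarrow> B \<in> sets M \<Longrightarrow> A \<inter> B = {} \<Longrightarrow> \<mu> (A \<union> B) = \<mu> A + \<mu> B"
    and cont: "\<And>A. range A \<subseteq> sets M \<Longrightarrow> decseq A \<Longrightarrow> (\<Inter>i. A i) = {} \<Longrightarrow> (\<lambda>i. \<mu> (A i)) \<longlonglongrightarrow> 0"
    and null: "\<And>A. A \<in> null_sets M \<Longrightarrow> \<mu> A = 0"
  obtains g where "integrable M g" "\<And>A. A \<in> sets M \<Longrightarrow> \<mu> A = (LINT \<omega>|M. g \<omega> * indicator A \<omega>)"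
proof -
  define N where "N = measure_of (space M) (sets M) (\<lambda>A. ennreal (\<mu> A))"
  have sets_N [simp, measurable_cong]: "sets N = sets M" by (simp add: N_def)
  have "countably_additive (sets M) (\<lambda>A. ennreal (\<mu> A))"
  proof (rule sets.empty_continuous_imp_countably_additive)
    show "positive (sets M) (\<lambda>A. ennreal (\<mu> A))"
      using null[of "{}"] by (simp add: positive_def)
    show "additive (sets M) (\<lambda>A. ennreal (\<mu> A))"
      using add nonneg by (auto simp: additive_def)
    show "(\<lambda>i. ennreal (\<mu> (A i))) \<longlonglongrightarrow> 0"
      if "range A \<subseteq> sets M" "decseq A" "(\<Inter>i. A i) = {}" for A
      using tendsto_ennrealI[OF cont[OF that]] by simp
  qed auto
  moreover have "positive (sets M) (\<lambda>A. ennreal (\<mu> A))"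
    using null[of "{}"] by (simp add: positive_def)
  ultimately have emN: "emeasure N A = ennreal (\<mu> A)" if "A \<in> sets M" for A
    unfolding N_def using that sets.sigma_algebra_axioms by (intro emeasure_measure_of_sigma) auto
  have "absolutely_continuous M N"
    unfolding absolutely_continuous_def
  proof
    fix A assume "A \<in> null_sets M"
    then show "A \<in> null_sets N"
      using null[of A] emN[of A] by (intro null_setsI) auto
  qed
  then obtain f where [measurable]: "f \<in> borel_measurable M" and f: "density M f = N"
    using Radon_Nikodym[of N] by auto
  have int: "(\<integral>\<^sup>+ \<omega>. f \<omega> * indicator A \<omega> \<partial>M) = ennreal (\<mu> A)" if "A \<in> sets M" for A
    using that emN[OF that] f by (simp add: emeasure_density[symmetric])
  have total: "(\<integral>\<^sup>+ \<omega>. f \<omega> \<partial>M) = ennreal (\<mu> (space M))"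
    using int[of "space M"] by (simp cong: nn_integral_cong)
  have fin: "AE \<omega> in M. f \<omega> \<noteq> \<infinity>"
    by (rule nn_integral_noteq_infinite) (auto simp: total)
  define g where "g \<omega> = enn2real (f \<omega>)" for \<omega>
  have [measurable]: "g \<in> borel_measurable M" unfolding g_def by measurable
  have g0: "0 \<le> g \<omega>" for \<omega> by (simp add: g_def)
  have fg: "AE \<omega> in M. ennreal (g \<omega>) = f \<omega>"
    using fin by eventually_elim (simp add: g_def less_top)
  have gint: "(\<integral>\<^sup>+ \<omega>. ennreal (g \<omega> * indicator A \<omega>) \<partial>M) = ennreal (\<mu> A)" if "A \<in> sets M" for A
    unfolding int[OF that, symmetric] using fg
    by (intro nn_integral_cong_AE) (auto simp: indicator_def)
  show ?thesis
  proof (rule that)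
    have "(\<integral>\<^sup>+ \<omega>. ennreal (g \<omega>) \<partial>M) = (\<integral>\<^sup>+ \<omega>. f \<omega> \<partial>M)"
      using fg by (intro nn_integral_cong_AE) auto
    then show "integrable M g"
      using g0 total by (intro integrableI_nonneg) auto
    show "\<mu> A = (LINT \<omega>|M. g \<omega> * indicator A \<omega>)" if "A \<in> sets M" for A
      using gint[OF that] nonneg[OF that] g0 that
      by (subst integral_eq_nn_integral) (auto intro!: AE_I2)
  qed
qed

context orlicz_duality
begin

text \<open>Continuity is required only at \<open>0\<close>, which suffices by linearity. Domination
  by some \<open>\<zeta>\<close> replaces the exact supremum of \<open>order_bounded_seq\<close>.
  Almost sure invariance is a consequence, see \<open>oc_functional_cong\<close>.\<close>

definition oc_functional :: "(('a \<Rightarrow> real) \<Rightarrow> real) \<Rightarrow> bool" where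
  "oc_functional l \<longleftrightarrow>
    (\<forall>x\<in>orlicz M \<Psi>. \<forall>y\<in>orlicz M \<Psi>. \<forall>a b. l (\<lambda>\<omega>. a * x \<omega> + b * y \<omega>) = a * l x + b * l y) \<and>
    (\<forall>X. \<forall>\<zeta>\<in>orlicz M \<Psi>. range X \<subseteq> orlicz M \<Psi> \<longrightarrow> (\<forall>n. AE \<omega> in M. \<bar>X n \<omega>\<bar> \<le> \<zeta> \<omega>) \<longrightarrow>
        (AE \<omega> in M. (\<lambda>n. X n \<omega>) \<longlonglongrightarrow> 0) \<longrightarrow> (\<lambda>n. l (X n)) \<longlonglongrightarrow> 0)"

lemma oc_functional_lincomb:
  "oc_functional l \<Longrightarrow> x \<in> orlicz M \<Psi> \<Longrightarrow> y \<in> orlicz M \<Psi> \<Longrightarrow>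
    l (\<lambda>\<omega>. a * x \<omega> + b * y \<omega>) = a * l x + b * l y"
  by (simp add: oc_functional_def)

lemma oc_functional_tendsto_0:
  assumes "oc_functional l" "\<And>n. X n \<in> orlicz M \<Psi>" "\<zeta> \<in> orlicz M \<Psi>"
    "\<And>n. AE \<omega> in M. \<bar>X n \<omega>\<bar> \<le> \<zeta> \<omega>" "AE \<omega> in M. (\<lambda>n. X n \<omega>) \<longlonglongrightarrow> 0"
  shows "(\<lambda>n. l (X n)) \<longlonglongrightarrow> 0"
proof -
  have "range X \<subseteq> orlicz M \<Psi>" using assms(2) by auto
  then show ?thesis using assms unfolding oc_functional_def by blast
qed

lemma oc_functional_scale:
  "oc_functional l \<Longrightarrow> x \<in> orlicz M \<Psi> \<Longrightarrow> l (\<lambda>\<omega>. a * x \<omega>) = a * l x"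
  using oc_functional_lincomb[of l x x a 0] by simp

lemma oc_functional_diff:
  "oc_functional l \<Longrightarrow> x \<in> orlicz M \<Psi> \<Longrightarrow> y \<in> orlicz M \<Psi> \<Longrightarrow> l (\<lambda>\<omega>. x \<omega> - y \<omega>) = l x - l y"
  using oc_functional_lincomb[of l x y 1 "-1"] by simp

lemma oc_functional_tendsto:
  assumes "oc_functional l" "\<And>n. X n \<in> orlicz M \<Psi>" "\<zeta> \<in> orlicz M \<Psi>" "x \<in> orlicz M \<Psi>"
    "\<And>n. AE \<omega> in M. \<bar>X n \<omega>\<bar> \<le> \<zeta> \<omega>" "AE \<omega> in M. (\<lambda>n. X n \<omega>) \<longlonglongrightarrow> x \<omega>"
  shows "(\<lambda>n. l (X n)) \<longlonglongrightarrow> l x"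
proof -
  have "(\<lambda>n. l (\<lambda>\<omega>. X n \<omega> - x \<omega>)) \<longlonglongrightarrow> 0"
  proof (rule oc_functional_tendsto_0[OF assms(1)])
    show "(\<lambda>\<omega>. \<zeta> \<omega> + \<bar>x \<omega>\<bar>) \<in> orlicz M \<Psi>"
      by (intro E.add E.abs assms)
    show "AE \<omega> in M. \<bar>X n \<omega> - x \<omega>\<bar> \<le> \<zeta> \<omega> + \<bar>x \<omega>\<bar>" for n
      using assms(5)[of n] by eventually_elim auto
    show "AE \<omega> in M. (\<lambda>n. X n \<omega> - x \<omega>) \<longlonglongrightarrow> 0"
      using assms(6) by eventually_elim (auto simp: LIM_zero_iff)
  qed (intro E.diff assms)
  then show ?thesis
    using assms by (simp add: oc_functional_diff LIM_zero_iff)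
qed

lemma oc_functional_cong:
  assumes "oc_functional l" "x \<in> orlicz M \<Psi>" "y \<in> orlicz M \<Psi>" "AE \<omega> in M. x \<omega> = y \<omega>"
  shows "l x = l y"
proof -
  have "(\<lambda>n. l x) \<longlonglongrightarrow> l y"
    using assms(4) by (intro oc_functional_tendsto[OF assms(1) assms(2) E.abs[OF assms(2)] assms(3)]) auto
  then show ?thesis by (simp add: LIMSEQ_const_iff)
qed

lemma oc_functional_zero: "oc_functional l \<Longrightarrow> l (\<lambda>\<omega>. 0) = 0"
  using oc_functional_scale[of l "\<lambda>\<omega>. 0" 0] E.const[of 0] by simp

lemma oc_functional_sum:
  assumes l: "oc_functional l" and "finite I" "\<And>i. i \<in> I \<Longrightarrow> x i \<in> orlicz M \<Psi>"
  shows "(\<lambda>\<omega>. \<Sum>i\<in>I. c i * x i \<omega>) \<in> orlicz M \<Psi> \<and> l (\<lambda>\<omega>. \<Sum>i\<in>I. c i * x i \<omega>) = (\<Sum>i\<in>I. c i * l (x i))"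
  using assms(2,3)
proof (induction I rule: finite_induct)
  case empty
  then show ?case using E.const[of 0] oc_functional_zero[OF l] by simp
next
  case (insert i I)
  then show ?case
    using oc_functional_lincomb[OF l, of "x i" "\<lambda>\<omega>. \<Sum>i\<in>I. c i * x i \<omega>" "c i" 1]
      E.lincomb[of "x i" "\<lambda>\<omega>. \<Sum>i\<in>I. c i * x i \<omega>" "c i" 1] by simp
qed

text \<open>Jordan decomposition by hand: \<open>\<nu>p\<close> is the positive variation of the
  signed charge \<open>\<nu>\<close>, and \<open>\<nu>p - \<nu>\<close> is the negative one. Both
  are nonnegative charges continuous at the empty set, and the density of \<open>\<nu>\<close> is
  the difference of their densities.\<close>

lemma oc_functional_indicator_density:
  assumes l: "oc_functional l"
  obtains \<eta> where "integrable M \<eta>"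
    "\<And>A. A \<in> sets M \<Longrightarrow> l (indicator A) = (LINT \<omega>|M. \<eta> \<omega> * indicator A \<omega>)"
proof -
  define \<nu> where "\<nu> A = l (indicator A)" for A
  define \<nu>p where "\<nu>p A = (SUP B\<in>{B\<in>sets M. B \<subseteq> A}. \<nu> B)" for A
  have \<nu>_add: "\<nu> (A \<union> B) = \<nu> A + \<nu> B" if "A \<in> sets M" "B \<in> sets M" "A \<inter> B = {}" for A B
  proof -
    have "indicator (A \<union> B) = (\<lambda>\<omega>. 1 * indicator A \<omega> + 1 * indicator B \<omega> :: real)"
      using that by (auto simp: indicator_def fun_eq_iff)
    then show ?thesis
      unfolding \<nu>_def using oc_functional_lincomb[OF l E.indicator[OF that(1)] E.indicator[OF that(2)], of 1 1]
      by simp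
  qed
  have \<nu>_empty: "\<nu> {} = 0"
    using \<nu>_add[of "{}" "{}"] by simp
  have \<nu>_null: "\<nu> A = 0" if "A \<in> null_sets M" for A
  proof -
    have "\<nu> A = l (\<lambda>\<omega>. 0)"
      unfolding \<nu>_def
    proof (rule oc_functional_cong[OF l E.indicator E.const])
      show "AE \<omega> in M. indicator A \<omega> = (0::real)"
        using AE_not_in[OF that] by eventually_elim auto
    qed (use that in auto)
    then show ?thesis using oc_functional_zero[OF l] by simp
  qed
  \<comment> \<open>Stated for arbitrary subsets \<open>B n\<close> of the shrinking sets, because
    \<open>\<nu>p (A n)\<close> will be approximated by the values of \<open>\<nu>\<close> on such
    subsets.\<close>
  have \<nu>_cont: "(\<lambda>n. \<nu> (B n)) \<longlonglongrightarrow> 0"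
    if B: "\<And>n. B n \<in> sets M" "\<And>n. B n \<subseteq> A n" and A: "decseq A" "(\<Inter>n. A n) = {}" for A B
    unfolding \<nu>_def
  proof (rule oc_functional_tendsto_0[OF l])
    show "AE \<omega> in M. (\<lambda>n. indicator (B n) \<omega> :: real) \<longlonglongrightarrow> 0"
    proof (rule AE_I2)
      fix \<omega>
      obtain m where m: "\<omega> \<notin> A m" using A(2) by blast
      have "\<omega> \<notin> B n" if "n \<ge> m" for n
        using m B(2)[of n] decseqD[OF A(1) that] by blast
      then have "eventually (\<lambda>n. indicator (B n) \<omega> = (0::real)) sequentially"
        by (auto simp: eventually_sequentially intro!: exI[of _ m])
      then show "(\<lambda>n. indicator (B n) \<omega> :: real) \<longlonglongrightarrow> 0"
        by (rule tendsto_eventually)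
    qed
  qed (use B in \<open>auto intro!: E.indicator E.const[of 1]\<close>)
  \<comment> \<open>Otherwise there are sets with \<open>\<nu> (B n) > n + 1\<close>. The functions
    \<open>indicator (B n) / (n + 1)\<close> are dominated by \<open>1\<close> and tend to
    \<open>0\<close>, yet \<open>l\<close> exceeds \<open>1\<close> on all of them.\<close>
  have bdd: "bdd_above (\<nu> ` sets M)"
  proof (rule ccontr)
    assume "\<not> ?thesis"
    then have "\<forall>n::nat. \<exists>B\<in>sets M. real (Suc n) < \<nu> B"
      unfolding bdd_above_def by (metis imageE linorder_not_less)
    then obtain B where B: "\<And>n. B n \<in> sets M" "\<And>n. real (Suc n) < \<nu> (B n)" by metis
    have "(\<lambda>n. l (\<lambda>\<omega>. inverse (real (Suc n)) * indicator (B n) \<omega>)) \<longlonglongrightarrow> 0"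
    proof (rule oc_functional_tendsto_0[OF l])
      show "AE \<omega> in M. (\<lambda>n. inverse (real (Suc n)) * indicator (B n) \<omega>) \<longlonglongrightarrow> 0"
        by (intro AE_I2 tendsto_sandwich[OF _ _ tendsto_const LIMSEQ_inverse_real_of_nat])
           (auto simp: indicator_def)
      show "AE \<omega> in M. \<bar>inverse (real (Suc n)) * indicator (B n) \<omega>\<bar> \<le> 1" for n
        by (intro AE_I2) (auto simp: indicator_def field_simps)
    qed (use B in \<open>auto intro!: E.indicator E.const[of 1] E.scale\<close>)
    then have "eventually (\<lambda>n. l (\<lambda>\<omega>. inverse (real (Suc n)) * indicator (B n) \<omega>) < 1) sequentially"
      by (rule order_tendstoD) auto
    then obtain n where "l (\<lambda>\<omega>. inverse (real (Suc n)) * indicator (B n) \<omega>) < 1"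
      by (auto simp: eventually_sequentially)
    then have "inverse (real (Suc n)) * \<nu> (B n) < 1"
      using oc_functional_scale[OF l E.indicator[OF B(1)[of n]]] by (simp only: \<nu>_def)
    then show False using B(2)[of n] by (simp add: field_simps)
  qed
  have up: "\<nu> B \<le> \<nu>p A" if "B \<in> sets M" "B \<subseteq> A" for A B
    unfolding \<nu>p_def using that by (intro cSUP_upper bdd_above_mono[OF bdd]) auto
  have least: "\<nu>p A \<le> c" if "\<And>B. B \<in> sets M \<Longrightarrow> B \<subseteq> A \<Longrightarrow> \<nu> B \<le> c" for A c
    unfolding \<nu>p_def by (intro cSUP_least) (use that in auto)
  have \<nu>p_add: "\<nu>p (A \<union> B) = \<nu>p A + \<nu>p B" if AB: "A \<in> sets M" "B \<in> sets M" "A \<inter> B = {}" for A B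
  proof (rule antisym)
    show "\<nu>p (A \<union> B) \<le> \<nu>p A + \<nu>p B"
    proof (rule least)
      fix C assume C: "C \<in> sets M" "C \<subseteq> A \<union> B"
      have "(C \<inter> A) \<union> (C \<inter> B) = C" using C by blast
      moreover have "(C \<inter> A) \<inter> (C \<inter> B) = {}" using AB by blast
      ultimately have "\<nu> C = \<nu> (C \<inter> A) + \<nu> (C \<inter> B)"
        using \<nu>_add[of "C \<inter> A" "C \<inter> B"] C AB by auto
      also have "\<dots> \<le> \<nu>p A + \<nu>p B" using C AB by (intro add_mono up) auto
      finally show "\<nu> C \<le> \<nu>p A + \<nu>p B" .
    qed
    have "\<nu>p A \<le> \<nu>p (A \<union> B) - \<nu>p B"
    proof (rule least)
      fix C assume C: "C \<in> sets M" "C \<subseteq> A"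
      have "\<nu>p B \<le> \<nu>p (A \<union> B) - \<nu> C"
      proof (rule least)
        fix D assume D: "D \<in> sets M" "D \<subseteq> B"
        have "C \<inter> D = {}" using C D AB by blast
        then have "\<nu> C + \<nu> D = \<nu> (C \<union> D)" using \<nu>_add[of C D] C D by simp
        also have "\<dots> \<le> \<nu>p (A \<union> B)" using C D by (intro up) auto
        finally show "\<nu> D \<le> \<nu>p (A \<union> B) - \<nu> C" by simp
      qed
      then show "\<nu> C \<le> \<nu>p (A \<union> B) - \<nu>p B" by simp
    qed
    then show "\<nu>p A + \<nu>p B \<le> \<nu>p (A \<union> B)" by simp
  qed
  have \<nu>p_null: "\<nu>p A = 0" if "A \<in> null_sets M" for A
  proof (rule antisym)
    show "\<nu>p A \<le> 0"
      using that by (intro least) (metis \<nu>_null null_sets_subset order_refl)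
  qed (use up[of "{}" A] \<nu>_empty in auto)
  have \<nu>p_cont: "(\<lambda>n. \<nu>p (A n)) \<longlonglongrightarrow> 0"
    if A: "range A \<subseteq> sets M" "decseq A" "(\<Inter>n. A n) = {}" for A
  proof -
    have "\<exists>B\<in>sets M. B \<subseteq> A n \<and> \<nu>p (A n) - inverse (real (Suc n)) < \<nu> B" for n
    proof (rule ccontr)
      assume *: "\<not> ?thesis"
      have "\<nu>p (A n) \<le> \<nu>p (A n) - inverse (real (Suc n))"
        using * by (intro least) force
      then show False by (simp add: not_le[symmetric] del: of_nat_Suc)
    qed
    then obtain B where B: "\<And>n. B n \<in> sets M" "\<And>n. B n \<subseteq> A n"
        "\<And>n. \<nu>p (A n) - inverse (real (Suc n)) < \<nu> (B n)"
      by metis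
    have "(\<lambda>n. \<nu> (B n) + inverse (real (Suc n))) \<longlonglongrightarrow> 0 + 0"
      by (intro tendsto_add \<nu>_cont[OF B(1,2) A(2,3)] LIMSEQ_inverse_real_of_nat)
    then have lim: "(\<lambda>n. \<nu> (B n) + inverse (real (Suc n))) \<longlonglongrightarrow> 0" by simp
    show ?thesis
    proof (rule tendsto_sandwich[OF _ _ tendsto_const lim])
      show "eventually (\<lambda>n. 0 \<le> \<nu>p (A n)) sequentially"
        using up[of "{}"] \<nu>_empty by auto
      show "eventually (\<lambda>n. \<nu>p (A n) \<le> \<nu> (B n) + inverse (real (Suc n))) sequentially"
        using B(3) by (intro always_eventually allI) (simp add: diff_le_eq[symmetric] less_imp_le)
    qed
  qed
  obtain g where g: "integrable M g" "\<And>A. A \<in> sets M \<Longrightarrow> \<nu>p A = (LINT \<omega>|M. g \<omega> * indicator A \<omega>)"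
  proof (rule Radon_Nikodym_charge[of \<nu>p, OF _ \<nu>p_add \<nu>p_cont \<nu>p_null])
    show "0 \<le> \<nu>p A" if "A \<in> sets M" for A
      using up[of "{}" A] \<nu>_empty by simp
  qed (assumption | rule that)+
  have diff_cont: "(\<lambda>n. \<nu>p (A n) - \<nu> (A n)) \<longlonglongrightarrow> 0"
    if A: "range A \<subseteq> sets M" "decseq A" "(\<Inter>n. A n) = {}" for A
    using tendsto_diff[OF \<nu>p_cont[OF A] \<nu>_cont[OF _ _ A(2,3), of A]] A(1) by auto
  obtain h where h: "integrable M h" "\<And>A. A \<in> sets M \<Longrightarrow> \<nu>p A - \<nu> A = (LINT \<omega>|M. h \<omega> * indicator A \<omega>)"
  proof (rule Radon_Nikodym_charge[of "\<lambda>A. \<nu>p A - \<nu> A", OF _ _ diff_cont])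
    show "0 \<le> \<nu>p A - \<nu> A" if "A \<in> sets M" for A
      using up[OF that, of A] by simp
    show "\<nu>p (A \<union> B) - \<nu> (A \<union> B) = \<nu>p A - \<nu> A + (\<nu>p B - \<nu> B)"
      if "A \<in> sets M" "B \<in> sets M" "A \<inter> B = {}" for A B
      using \<nu>_add[OF that] \<nu>p_add[OF that] by simp
    show "\<nu>p A - \<nu> A = 0" if "A \<in> null_sets M" for A
      using \<nu>_null[OF that] \<nu>p_null[OF that] by simp
  qed (assumption | rule that)+
  show ?thesis
  proof (rule that[of "\<lambda>\<omega>. g \<omega> - h \<omega>"])
    fix A assume A: "A \<in> sets M"
    have "\<nu> A = (LINT \<omega>|M. g \<omega> * indicator A \<omega>) - (LINT \<omega>|M. h \<omega> * indicator A \<omega>)"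
      using g(2)[OF A] h(2)[OF A] by linarith
    also have "\<dots> = (LINT \<omega>|M. (g \<omega> - h \<omega>) * indicator A \<omega>)"
      using g(1) h(1) A
      by (simp add: left_diff_distrib integrable_real_mult_indicator)
    finally show "l (indicator A) = (LINT \<omega>|M. (g \<omega> - h \<omega>) * indicator A \<omega>)"
      by (simp add: \<nu>_def)
  qed (use g h in auto)
qed

lemma simple_function_orlicz:
  assumes "simple_function M s"
  shows "s \<in> orlicz M \<Psi>"
proof (rule E.bounded)
  show "\<bar>s \<omega>\<bar> \<le> Max ((\<lambda>\<omega>. \<bar>s \<omega>\<bar>) ` space M)" if "\<omega> \<in> space M" for \<omega>
  proof (rule Max_ge)
    have "finite (abs ` s ` space M)"
      using simple_functionD(1)[OF assms] by simp
    then show "finite ((\<lambda>\<omega>. \<bar>s \<omega>\<bar>) ` space M)" by (simp add: image_image)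
  qed (use that in auto)
qed (use assms in \<open>rule borel_measurable_simple_function\<close>)

lemma oc_functional_simple:
  assumes l: "oc_functional l" and \<eta>: "integrable M \<eta>"
    and ind: "\<And>A. A \<in> sets M \<Longrightarrow> l (indicator A) = (LINT \<omega>|M. \<eta> \<omega> * indicator A \<omega>)"
    and s: "simple_function M s"
  shows "l s = (LINT \<omega>|M. \<eta> \<omega> * s \<omega>)"
proof -
  let ?I = "s ` space M"
  let ?A = "\<lambda>y. s -` {y} \<inter> space M"
  have fin: "finite ?I" and A: "\<And>y. ?A y \<in> sets M"
    using simple_functionD[OF s] by auto
  have rep: "s \<omega> = (\<Sum>y\<in>?I. y * indicator (?A y) \<omega>)" if "\<omega> \<in> space M" for \<omega>
  proof -
    have "(\<Sum>y\<in>?I. y * indicator (?A y) \<omega>) = (\<Sum>y\<in>?I. if y = s \<omega> then y else 0)"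
      using that by (intro sum.cong) (auto simp: indicator_def)
    then show ?thesis using fin that by simp
  qed
  note sum = oc_functional_sum[OF l fin E.indicator[OF A], of "\<lambda>y. y"]
  have "l s = l (\<lambda>\<omega>. \<Sum>y\<in>?I. y * indicator (?A y) \<omega>)"
    using rep by (intro oc_functional_cong[OF l simple_function_orlicz[OF s]] conjunct1[OF sum] AE_I2)
  also have "\<dots> = (\<Sum>y\<in>?I. y * (LINT \<omega>|M. \<eta> \<omega> * indicator (?A y) \<omega>))"
    using sum ind[OF A] by simp
  also have "\<dots> = (LINT \<omega>|M. (\<Sum>y\<in>?I. y * (\<eta> \<omega> * indicator (?A y) \<omega>)))"
    using integrable_real_mult_indicator[OF A \<eta>] by (subst Bochner_Integration.integral_sum) auto
  also have "\<dots> = (LINT \<omega>|M. \<eta> \<omega> * s \<omega>)"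
  proof (rule Bochner_Integration.integral_cong[OF refl])
    fix \<omega> assume "\<omega> \<in> space M"
    then have "\<eta> \<omega> * s \<omega> = \<eta> \<omega> * (\<Sum>y\<in>?I. y * indicator (?A y) \<omega>)"
      by (simp only: rep[symmetric])
    also have "\<dots> = (\<Sum>y\<in>?I. y * (\<eta> \<omega> * indicator (?A y) \<omega>))"
      by (simp only: sum_distrib_left mult.left_commute)
    finally show "(\<Sum>y\<in>?I. y * (\<eta> \<omega> * indicator (?A y) \<omega>)) = \<eta> \<omega> * s \<omega>" by simp
  qed
  finally show ?thesis .
qed

text \<open>A priori the density \<open>\<eta>\<close> is only integrable. Order continuity first
  shows that \<open>\<eta> * \<xi>\<close> is integrable for every \<open>\<xi>\<close> in
  \<open>L\<^sub>\<Psi>\<close>, so that \<open>koethe_dual\<close> applies; afterwards simple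
  functions approximate \<open>\<xi>\<close> on both sides of the formula.\<close>

theorem oc_functional_representation:
  assumes l: "oc_functional l"
  obtains \<eta> where "\<eta> \<in> orlicz M \<Phi>" "\<And>\<xi>. \<xi> \<in> orlicz M \<Psi> \<Longrightarrow> l \<xi> = pairing M \<eta> \<xi>"
proof -
  obtain \<eta> where \<eta>: "integrable M \<eta>"
    and ind: "\<And>A. A \<in> sets M \<Longrightarrow> l (indicator A) = (LINT \<omega>|M. \<eta> \<omega> * indicator A \<omega>)"
    by (rule oc_functional_indicator_density[OF l]) (rule that)
  have [measurable]: "\<eta> \<in> borel_measurable M" using \<eta> by auto
  have simple: "l s = (LINT \<omega>|M. \<eta> \<omega> * s \<omega>)" if "simple_function M s" for s
    using oc_functional_simple[OF l \<eta> ind that] .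
  have approx: "\<exists>s. (\<forall>i. simple_function M (s i)) \<and> (\<forall>\<omega>\<in>space M. (\<lambda>i. s i \<omega>) \<longlonglongrightarrow> \<xi> \<omega>) \<and>
      (\<forall>i. \<forall>\<omega>\<in>space M. \<bar>s i \<omega>\<bar> \<le> 2 * \<bar>\<xi> \<omega>\<bar>)" if "\<xi> \<in> borel_measurable M" for \<xi> :: "'a \<Rightarrow> real"
    using borel_measurable_implies_sequence_metric[OF that, of 0] by (simp add: dist_real_def)
  have int: "integrable M (\<lambda>\<omega>. \<eta> \<omega> * \<xi> \<omega>)" if \<xi>: "\<xi> \<in> orlicz M \<Psi>" for \<xi>
  proof -
    have [measurable]: "\<xi> \<in> borel_measurable M" using \<xi> by (rule E.measurable)
    obtain s where s: "\<And>i. simple_function M (s i)" "\<And>\<omega>. \<omega> \<in> space M \<Longrightarrow> (\<lambda>i. s i \<omega>) \<longlonglongrightarrow> \<xi> \<omega>"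
      "\<And>i \<omega>. \<omega> \<in> space M \<Longrightarrow> \<bar>s i \<omega>\<bar> \<le> 2 * \<bar>\<xi> \<omega>\<bar>"
      using approx[of \<xi>] by simp metis
    note [measurable] = borel_measurable_simple_function[OF s(1)]
    \<comment> \<open>The sign turns the pairing into an integral of absolute values:
      \<open>l (v i)\<close> is the integral of \<open>\<bar>\<eta>\<bar> * \<bar>s i\<bar>\<close>,
      and these values converge because \<open>l\<close> is order continuous.\<close>
    define v where "v i \<omega> = sgn (\<eta> \<omega>) * \<bar>s i \<omega>\<bar>" for i \<omega>
    have "simple_function M (\<lambda>\<omega>. sgn (\<eta> \<omega>))"
    proof (rule simple_function_borel_measurable)
      show "finite ((\<lambda>\<omega>. sgn (\<eta> \<omega>)) ` space M)"
        by (rule finite_subset[of _ "{-1, 0, 1}"]) (auto simp: sgn_real_def)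
    qed auto
    then have v: "simple_function M (v i)" for i
      unfolding v_def using s(1)[of i] by (intro simple_function_mult simple_function_compose1[where g = abs])
    have sg: "\<eta> \<omega> * sgn (\<eta> \<omega>) = \<bar>\<eta> \<omega>\<bar>" for \<omega> by (simp add: abs_sgn)
    have "(\<lambda>i. l (v i)) \<longlonglongrightarrow> l (\<lambda>\<omega>. sgn (\<eta> \<omega>) * \<bar>\<xi> \<omega>\<bar>)"
    proof (rule oc_functional_tendsto[OF l simple_function_orlicz[OF v]])
      show "(\<lambda>\<omega>. 2 * \<bar>\<xi> \<omega>\<bar>) \<in> orlicz M \<Psi>" by (intro E.scale E.abs \<xi>)
      show "(\<lambda>\<omega>. sgn (\<eta> \<omega>) * \<bar>\<xi> \<omega>\<bar>) \<in> orlicz M \<Psi>"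
        by (rule E.solid[OF \<xi>]) (auto simp: abs_mult abs_sgn_eq)
      show "AE \<omega> in M. \<bar>v i \<omega>\<bar> \<le> 2 * \<bar>\<xi> \<omega>\<bar>" for i
        using s(3) by (intro AE_I2) (auto simp: v_def abs_mult abs_sgn_eq)
      show "AE \<omega> in M. (\<lambda>i. v i \<omega>) \<longlonglongrightarrow> sgn (\<eta> \<omega>) * \<bar>\<xi> \<omega>\<bar>"
        unfolding v_def using s(2) by (intro AE_I2 tendsto_intros)
    qed
    moreover have "(\<integral>\<^sup>+ \<omega>. ennreal (\<bar>\<eta> \<omega>\<bar> * \<bar>s i \<omega>\<bar>) \<partial>M) = ennreal (l (v i))" for i
    proof -
      have "(\<lambda>\<omega>. \<eta> \<omega> * v i \<omega>) = (\<lambda>\<omega>. \<bar>\<eta> \<omega>\<bar> * \<bar>s i \<omega>\<bar>)"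
        by (simp add: v_def sg mult.assoc[symmetric])
      moreover have "integrable M (\<lambda>\<omega>. \<bar>\<eta> \<omega>\<bar> * \<bar>s i \<omega>\<bar>)"
      proof -
        have "bounded (s i ` space M)"
          using simple_functionD(1)[OF s(1)[of i]] by (rule finite_imp_bounded)
        then obtain B where B: "\<And>\<omega>. \<omega> \<in> space M \<Longrightarrow> \<bar>s i \<omega>\<bar> \<le> B"
          by (auto simp: bounded_real)
        have "integrable M (\<lambda>\<omega>. \<eta> \<omega> * B)" using \<eta> by auto
        then show ?thesis
        proof (rule Bochner_Integration.integrable_bound)
          show "AE \<omega> in M. norm (\<bar>\<eta> \<omega>\<bar> * \<bar>s i \<omega>\<bar>) \<le> norm (\<eta> \<omega> * B)"
          proof (rule AE_I2)
            fix \<omega> assume "\<omega> \<in> space M"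
            then have "\<bar>\<eta> \<omega>\<bar> * \<bar>s i \<omega>\<bar> \<le> \<bar>\<eta> \<omega>\<bar> * \<bar>B\<bar>"
              using B[of \<omega>] by (intro mult_left_mono) auto
            then show "norm (\<bar>\<eta> \<omega>\<bar> * \<bar>s i \<omega>\<bar>) \<le> norm (\<eta> \<omega> * B)"
              by (simp add: abs_mult)
          qed
        qed auto
      qed
      ultimately show ?thesis
        using simple[OF v[of i]] by (simp add: nn_integral_eq_integral)
    qed
    ultimately have lim: "(\<lambda>i. \<integral>\<^sup>+ \<omega>. ennreal (\<bar>\<eta> \<omega>\<bar> * \<bar>s i \<omega>\<bar>) \<partial>M) \<longlonglongrightarrow> ennreal (l (\<lambda>\<omega>. sgn (\<eta> \<omega>) * \<bar>\<xi> \<omega>\<bar>))"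
      by (simp add: tendsto_ennrealI)
    \<comment> \<open>Fatou, since dominated convergence would presuppose the integrability being
      proved.\<close>
    have "(\<integral>\<^sup>+ \<omega>. ennreal (\<bar>\<eta> \<omega>\<bar> * \<bar>\<xi> \<omega>\<bar>) \<partial>M) = (\<integral>\<^sup>+ \<omega>. liminf (\<lambda>i. ennreal (\<bar>\<eta> \<omega>\<bar> * \<bar>s i \<omega>\<bar>)) \<partial>M)"
    proof (rule nn_integral_cong)
      fix \<omega> assume "\<omega> \<in> space M"
      then have "(\<lambda>i. ennreal (\<bar>\<eta> \<omega>\<bar> * \<bar>s i \<omega>\<bar>)) \<longlonglongrightarrow> ennreal (\<bar>\<eta> \<omega>\<bar> * \<bar>\<xi> \<omega>\<bar>)"
        by (intro tendsto_ennrealI tendsto_intros s)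
      then show "ennreal (\<bar>\<eta> \<omega>\<bar> * \<bar>\<xi> \<omega>\<bar>) = liminf (\<lambda>i. ennreal (\<bar>\<eta> \<omega>\<bar> * \<bar>s i \<omega>\<bar>))"
        by (rule lim_imp_Liminf[OF trivial_limit_sequentially, symmetric])
    qed
    also have "\<dots> \<le> liminf (\<lambda>i. \<integral>\<^sup>+ \<omega>. ennreal (\<bar>\<eta> \<omega>\<bar> * \<bar>s i \<omega>\<bar>) \<partial>M)"
      by (rule nn_integral_liminf) auto
    also have "\<dots> = ennreal (l (\<lambda>\<omega>. sgn (\<eta> \<omega>) * \<bar>\<xi> \<omega>\<bar>))"
      by (rule lim_imp_Liminf[OF trivial_limit_sequentially lim])
    also have "\<dots> < \<infinity>" by simp
    finally show ?thesis
      by (simp add: integrable_iff_bounded abs_mult)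
  qed
  show ?thesis
  proof (rule that)
    show "\<eta> \<in> orlicz M \<Phi>" using int by (intro koethe_dual) auto
    fix \<xi> assume \<xi>: "\<xi> \<in> orlicz M \<Psi>"
    then have [measurable]: "\<xi> \<in> borel_measurable M" by (rule E.measurable)
    obtain s where s: "\<And>i. simple_function M (s i)" "\<And>\<omega>. \<omega> \<in> space M \<Longrightarrow> (\<lambda>i. s i \<omega>) \<longlonglongrightarrow> \<xi> \<omega>"
      "\<And>i \<omega>. \<omega> \<in> space M \<Longrightarrow> \<bar>s i \<omega>\<bar> \<le> 2 * \<bar>\<xi> \<omega>\<bar>"
      using approx[of \<xi>] by simp metis
    note [measurable] = borel_measurable_simple_function[OF s(1)]
    have "(\<lambda>i. l (s i)) \<longlonglongrightarrow> l \<xi>"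
      using s by (intro oc_functional_tendsto[OF l simple_function_orlicz[OF s(1)] E.scale[OF E.abs[OF \<xi>], of 2] \<xi>] AE_I2)
    moreover have "(\<lambda>i. LINT \<omega>|M. \<eta> \<omega> * s i \<omega>) \<longlonglongrightarrow> (LINT \<omega>|M. \<eta> \<omega> * \<xi> \<omega>)"
    proof (rule integral_dominated_convergence[where w = "\<lambda>\<omega>. 2 * \<bar>\<eta> \<omega> * \<xi> \<omega>\<bar>"])
      show "integrable M (\<lambda>\<omega>. 2 * \<bar>\<eta> \<omega> * \<xi> \<omega>\<bar>)" using int[OF \<xi>] by auto
      show "AE \<omega> in M. (\<lambda>i. \<eta> \<omega> * s i \<omega>) \<longlonglongrightarrow> \<eta> \<omega> * \<xi> \<omega>"
        using s(2) by (intro AE_I2 tendsto_intros)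
      show "AE \<omega> in M. norm (\<eta> \<omega> * s i \<omega>) \<le> 2 * \<bar>\<eta> \<omega> * \<xi> \<omega>\<bar>" for i
        using s(3)[of _ i] by (intro AE_I2) (auto simp: abs_mult mult.left_commute[of 2] intro!: mult_left_mono)
    qed auto
    ultimately show "l \<xi> = pairing M \<eta> \<xi>"
      using simple[OF s(1)] by (simp add: pairing_def LIMSEQ_unique)
  qed
qed

end

subsection \<open>Weakly compact sets\<close>

text \<open>Open sets of a pullback are traces of preimages, so a cover of \<open>K\<close> comes
  from a cover of its image. The map may identify points, as the pairing does with a.s. equal
  functions.\<close>

lemma compactin_pullback_topology:
  assumes "K \<subseteq> A" "compactin T (g ` K)"
  shows "compactin (pullback_topology A g T) K"
  unfolding compactin_def
proof (intro conjI allI impI)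
  show "K \<subseteq> topspace (pullback_topology A g T)"
    using assms compactin_subset_topspace[OF assms(2)] by (auto simp: topspace_pullback_topology)
  fix \<U> assume \<U>: "Ball \<U> (openin (pullback_topology A g T)) \<and> K \<subseteq> \<Union>\<U>"
  define \<V> where "\<V> = {V. openin T V \<and> g -` V \<inter> A \<in> \<U>}"
  have "g ` K \<subseteq> \<Union>\<V>"
  proof
    fix y assume "y \<in> g ` K"
    then obtain x where x: "x \<in> K" "y = g x" by blast
    then obtain U where U: "U \<in> \<U>" "x \<in> U" using \<U> by blast
    then obtain V where "openin T V" "U = g -` V \<inter> A"
      using \<U> by (auto simp: openin_pullback_topology)
    then show "y \<in> \<Union>\<V>" using U x by (auto simp: \<V>_def)
  qed
  then obtain \<F> where \<F>: "finite \<F>" "\<F> \<subseteq> \<V>" "g ` K \<subseteq> \<Union>\<F>"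
    using assms(2) unfolding compactin_def \<V>_def by (metis (no_types, lifting) mem_Collect_eq)
  show "\<exists>\<F>. finite \<F> \<and> \<F> \<subseteq> \<U> \<and> K \<subseteq> \<Union>\<F>"
    using \<F> assms(1) by (intro exI[of _ "(\<lambda>V. g -` V \<inter> A) ` \<F>"]) (auto simp: \<V>_def, blast)
qed

text \<open>If every point of \<open>K\<close> had a neighbourhood that the sequence eventually
  avoids, finitely many of these would cover \<open>K\<close>. Cluster points are all that is
  available here, since no first countability is assumed.\<close>

lemma compactin_sequence_cluster_point:
  assumes K: "compactin T K" and x: "\<And>n::nat. x n \<in> K"
  shows "\<exists>y\<in>K. \<forall>U. openin T U \<longrightarrow> y \<in> U \<longrightarrow> frequently (\<lambda>n. x n \<in> U) sequentially"
proof (rule ccontr)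
  assume "\<not> ?thesis"
  then have "\<exists>U. openin T U \<and> y \<in> U \<and> eventually (\<lambda>n. x n \<notin> U) sequentially" if "y \<in> K" for y
    using that unfolding frequently_def by blast
  then obtain U where U: "\<And>y. y \<in> K \<Longrightarrow> openin T (U y) \<and> y \<in> U y \<and> eventually (\<lambda>n. x n \<notin> U y) sequentially"
    by metis
  have "\<exists>\<F>. finite \<F> \<and> \<F> \<subseteq> U ` K \<and> K \<subseteq> \<Union>\<F>"
    using K U unfolding compactin_def by (elim conjE allE[of _ "U ` K"] impE) auto
  then obtain \<F> where \<F>: "finite \<F>" "\<F> \<subseteq> U ` K" "K \<subseteq> \<Union>\<F>" by blast
  have "eventually (\<lambda>n. \<forall>V\<in>\<F>. x n \<notin> V) sequentially"
    using \<F>(1,2) U by (intro eventually_ball_finite) auto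
  then obtain n where "\<forall>V\<in>\<F>. x n \<notin> V"
    by (auto simp: eventually_sequentially)
  then show False using x[of n] \<F>(3) by blast
qed

lemma continuous_map_real_open_nbhd:
  assumes "continuous_map T euclideanreal u"
  shows "openin T {z \<in> topspace T. \<bar>u z - c\<bar> < e}"
proof -
  have "openin T {z \<in> topspace T. u z \<in> ball c e}"
    using assms by (intro openin_continuous_map_preimage[OF assms]) auto
  then show ?thesis by (simp add: dist_real_def abs_minus_commute)
qed

context orlicz_duality
begin

abbreviation weak where "weak \<equiv> weak_topology M (orlicz M \<Phi>) (orlicz M \<Psi>)"

lemma continuous_map_pairing:
  assumes "\<xi> \<in> orlicz M \<Psi>"
  shows "continuous_map weak euclideanreal (\<lambda>\<eta>. pairing M \<eta> \<xi>)"
proof -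
  have "continuous_map weak euclideanreal ((\<lambda>g. g \<xi>) \<circ> (\<lambda>\<eta>. \<lambda>\<xi>\<in>orlicz M \<Psi>. pairing M \<eta> \<xi>))"
    unfolding weak_topology_def
    by (intro continuous_map_pullback continuous_map_product_projection assms)
  then show ?thesis using assms by (simp add: o_def)
qed

lemma pairing_series:
  assumes [measurable]: "\<And>i::nat. x i \<in> borel_measurable M" and \<zeta>: "\<zeta> \<in> orlicz M \<Psi>"
    and bound: "AE \<omega> in M. \<forall>N. (\<Sum>i<N. \<bar>x i \<omega>\<bar>) \<le> \<zeta> \<omega>"
  shows "x i \<in> orlicz M \<Psi>"
    and "(\<lambda>\<omega>. \<Sum>i. x i \<omega>) \<in> orlicz M \<Psi>"
    and "\<eta> \<in> orlicz M \<Phi> \<Longrightarrow> summable (\<lambda>i. \<bar>pairing M \<eta> (x i)\<bar>)"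
    and "\<eta> \<in> orlicz M \<Phi> \<Longrightarrow> (\<lambda>i. pairing M \<eta> (x i)) sums pairing M \<eta> (\<lambda>\<omega>. \<Sum>i. x i \<omega>)"
proof -
  have [measurable]: "\<zeta> \<in> borel_measurable M" using \<zeta> by (rule E.measurable)
  have summ: "AE \<omega> in M. summable (\<lambda>i. \<bar>x i \<omega>\<bar>)"
    using bound by eventually_elim (auto intro!: summableI_nonneg_bounded)
  show xE: "x i \<in> orlicz M \<Psi>" for i
  proof (rule E.solid[OF \<zeta>])
    show "AE \<omega> in M. \<bar>x i \<omega>\<bar> \<le> \<bar>\<zeta> \<omega>\<bar>"
      using bound
    proof eventually_elim
      case (elim \<omega>)
      have "\<bar>x i \<omega>\<bar> \<le> (\<Sum>i<Suc i. \<bar>x i \<omega>\<bar>)" by (simp add: sum_nonneg)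
      then show ?case using elim by (meson abs_ge_self order_trans)
    qed
  qed auto
  show "(\<lambda>\<omega>. \<Sum>i. x i \<omega>) \<in> orlicz M \<Psi>"
  proof (rule E.solid[OF \<zeta>])
    show "AE \<omega> in M. \<bar>\<Sum>i. x i \<omega>\<bar> \<le> \<bar>\<zeta> \<omega>\<bar>"
      using bound summ
    proof eventually_elim
      case (elim \<omega>)
      have "\<bar>\<Sum>i. x i \<omega>\<bar> \<le> (\<Sum>i. \<bar>x i \<omega>\<bar>)" using elim(2) by (rule summable_rabs)
      also have "\<dots> \<le> \<zeta> \<omega>" using elim by (intro suminf_le_const) auto
      finally show ?case by simp
    qed
  qed auto
  assume \<eta>: "\<eta> \<in> orlicz M \<Phi>"
  then have [measurable]: "\<eta> \<in> borel_measurable M" by (rule F.measurable)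
  have int: "integrable M (\<lambda>\<omega>. \<eta> \<omega> * x i \<omega>)" for i by (rule integrable_pairing[OF \<eta> xE])
  have sum_int: "summable (\<lambda>i. LINT \<omega>|M. norm (\<eta> \<omega> * x i \<omega>))"
  proof (rule summableI_nonneg_bounded)
    fix N
    have "(\<Sum>i<N. LINT \<omega>|M. norm (\<eta> \<omega> * x i \<omega>)) = (LINT \<omega>|M. (\<Sum>i<N. norm (\<eta> \<omega> * x i \<omega>)))"
      using int by (subst Bochner_Integration.integral_sum) auto
    also have "\<dots> \<le> (LINT \<omega>|M. \<bar>\<eta> \<omega>\<bar> * \<zeta> \<omega>)"
    proof (rule integral_mono_AE)
      show "AE \<omega> in M. (\<Sum>i<N. norm (\<eta> \<omega> * x i \<omega>)) \<le> \<bar>\<eta> \<omega>\<bar> * \<zeta> \<omega>"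
        using bound by eventually_elim (auto simp: abs_mult sum_distrib_left[symmetric] intro!: mult_left_mono)
    qed (use int integrable_abs_pairing[OF \<eta> \<zeta>] in auto)
    finally show "(\<Sum>i<N. LINT \<omega>|M. norm (\<eta> \<omega> * x i \<omega>)) \<le> (LINT \<omega>|M. \<bar>\<eta> \<omega>\<bar> * \<zeta> \<omega>)" .
  qed auto
  have le: "\<bar>pairing M \<eta> (x i)\<bar> \<le> (LINT \<omega>|M. norm (\<eta> \<omega> * x i \<omega>))" for i
    unfolding pairing_def real_norm_def[symmetric] by (rule integral_norm_bound)
  show "summable (\<lambda>i. \<bar>pairing M \<eta> (x i)\<bar>)"
    by (rule summable_comparison_test'[OF sum_int, of 0]) (use le in auto)
  have summ': "AE \<omega> in M. summable (\<lambda>i. norm (\<eta> \<omega> * x i \<omega>))"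
    using summ by eventually_elim (auto simp: abs_mult intro: summable_mult)
  have "(\<lambda>i. LINT \<omega>|M. \<eta> \<omega> * x i \<omega>) sums (LINT \<omega>|M. (\<Sum>i. \<eta> \<omega> * x i \<omega>))"
    by (rule sums_integral[OF int summ' sum_int])
  also have "(LINT \<omega>|M. (\<Sum>i. \<eta> \<omega> * x i \<omega>)) = (LINT \<omega>|M. \<eta> \<omega> * (\<Sum>i. x i \<omega>))"
  proof (rule integral_cong_AE)
    show "AE \<omega> in M. (\<Sum>i. \<eta> \<omega> * x i \<omega>) = \<eta> \<omega> * (\<Sum>i. x i \<omega>)"
      using summ by eventually_elim (rule suminf_mult[OF summable_rabs_cancel])
  qed auto
  finally show "(\<lambda>i. pairing M \<eta> (x i)) sums pairing M \<eta> (\<lambda>\<omega>. \<Sum>i. x i \<omega>)"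
    by (simp add: pairing_def)
qed

text \<open>Gliding hump: with \<open>\<eta>\<^sub>*\<close> a cluster point of \<open>\<eta>\<^sub>n\<close>, thin out the indices so that \<open>\<langle>\<eta>\<^sub>k, x\<^sub>j\<rangle>\<close> is
  close to \<open>\<langle>\<eta>\<^sub>*, x\<^sub>j\<rangle>\<close> for the earlier \<open>j\<close> and negligible for the later ones. If all
  \<open>\<langle>\<eta>\<^sub>k, x\<^sub>k\<rangle>\<close> were large, pairing with the sum of the thinned \<open>x\<^sub>k\<close> would separate \<open>\<eta>\<^sub>*\<close> from
  the cluster points of the thinned \<open>\<eta>\<^sub>k\<close>, although these agree with \<open>\<eta>\<^sub>*\<close> on every \<open>x\<^sub>k\<close>.\<close>

lemma gliding_hump:
  assumes K: "compactin weak K" and \<eta>: "\<And>n::nat. \<eta> n \<in> K"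
    and [measurable]: "\<And>i::nat. x i \<in> borel_measurable M" and \<zeta>: "\<zeta> \<in> orlicz M \<Psi>"
    and bound: "AE \<omega> in M. \<forall>N. (\<Sum>i<N. \<bar>x i \<omega>\<bar>) \<le> \<zeta> \<omega>"
    and e: "0 < (e::real)"
  shows "\<exists>n. pairing M (\<eta> n) (x n) \<le> e"
proof (rule ccontr)
  assume "\<not> ?thesis"
  then have large: "e < pairing M (\<eta> n) (x n)" for n by (auto simp: not_le)
  have KF: "\<theta> \<in> orlicz M \<Phi>" if "\<theta> \<in> K" for \<theta>
    using compactin_subset_topspace[OF K] that by (auto simp: topspace_weak_topology)
  note series = pairing_series[of x, OF _ \<zeta> bound, simplified]
  define g where "g i \<theta> = pairing M \<theta> (x i)" for i \<theta>
  have g_cont: "continuous_map weak euclideanreal (g i)" for i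
    unfolding g_def by (intro continuous_map_pairing series(1))
  have g_summ: "summable (\<lambda>i. \<bar>g i \<theta>\<bar>)" if "\<theta> \<in> K" for \<theta>
    unfolding g_def by (intro series(3) KF that)
  \<comment> \<open>A continuous functional whose values along the sequence converge takes the limit
    as its value at each cluster point.\<close>
  have cluster_eq: "u y = c"
    if "continuous_map weak euclideanreal u" "(\<lambda>m. u (z m)) \<longlonglongrightarrow> c" "y \<in> K"
      "\<And>U. openin weak U \<Longrightarrow> y \<in> U \<Longrightarrow> frequently (\<lambda>m. z m \<in> U) sequentially" for u y z and c :: real
  proof (rule ccontr)
    assume ne: "u y \<noteq> c"
    define r where "r = \<bar>u y - c\<bar> / 2"
    have r: "0 < r" using ne by (simp add: r_def)
    have "frequently (\<lambda>m. z m \<in> {w \<in> topspace weak. \<bar>u w - u y\<bar> < r}) sequentially"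
      using r KF[OF that(3)]
      by (intro that(4) continuous_map_real_open_nbhd that(1)) (auto simp: topspace_weak_topology)
    moreover have "eventually (\<lambda>m. \<bar>u (z m) - c\<bar> < r) sequentially"
      using tendstoD[OF that(2) r] by (simp add: dist_real_def)
    ultimately have "frequently (\<lambda>m. z m \<in> {w \<in> topspace weak. \<bar>u w - u y\<bar> < r} \<and> \<bar>u (z m) - c\<bar> < r) sequentially"
      by (rule frequently_eventually_frequently)
    then obtain m where "\<bar>u (z m) - u y\<bar> < r" "\<bar>u (z m) - c\<bar> < r"
      using frequently_ex by fastforce
    then show False
      using dist_triangle3[of "u y" c "u (z m)"] by (simp add: r_def dist_real_def)
  qed
  obtain s where s: "s \<in> K" "\<And>U. openin weak U \<Longrightarrow> s \<in> U \<Longrightarrow> frequently (\<lambda>n. \<eta> n \<in> U) sequentially"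
    using compactin_sequence_cluster_point[OF K, of \<eta>] \<eta> by blast
  have tail: "eventually (\<lambda>n. (\<Sum>j. \<bar>g (j + n) \<theta>\<bar>) < e / 8) sequentially" if "\<theta> \<in> K" for \<theta>
    using order_tendstoD(2)[OF suminf_exist_split2[OF g_summ[OF that]], of "e / 8"] e by simp
  \<comment> \<open>The tolerance \<open>e / (8 * (k + 1))\<close> is divided by the number of
    indices \<open>j \<le> k\<close>, so that all earlier deviations together cost at most
    \<open>e / 8\<close>; the last clause makes the later terms of \<open>\<eta> k\<close> cost at
    most \<open>e / 8\<close>.\<close>
  define Q where "Q k k' \<longleftrightarrow> k < k' \<and> (\<forall>j\<le>k. \<bar>g j (\<eta> k') - g j s\<bar> < e / (8 * real (Suc k))) \<and>
      (\<Sum>j. \<bar>g (j + k') (\<eta> k)\<bar>) < e / 8" for k k'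
  \<comment> \<open>Starting beyond \<open>k0\<close> makes the contribution of all selected indices
    to \<open>s\<close> at most \<open>e / 8\<close>.\<close>
  obtain k0 where k0: "(\<Sum>j. \<bar>g (j + k0) s\<bar>) < e / 8"
    using tail[OF s(1)] by (auto simp: eventually_sequentially)
  have "\<exists>k. (k 0 = k0) \<and> (\<forall>n. Q (k n) (k (Suc n)))"
  proof -
    have ex: "\<exists>k'. Q k k'" for k
    proof -
      define U where "U = (\<Inter>j\<in>{..k}. {\<theta> \<in> topspace weak. \<bar>g j \<theta> - g j s\<bar> < e / (8 * real (Suc k))})"
      have "openin weak U"
        unfolding U_def by (intro openin_Inter) (auto intro: continuous_map_real_open_nbhd g_cont)
      moreover have "s \<in> U"
        using e KF[OF s(1)] by (auto simp: U_def topspace_weak_topology)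
      ultimately have "frequently (\<lambda>n. \<eta> n \<in> U) sequentially" by (rule s(2))
      moreover have "eventually (\<lambda>n. k < n \<and> (\<Sum>j. \<bar>g (j + n) (\<eta> k)\<bar>) < e / 8) sequentially"
        by (intro eventually_conj eventually_gt_at_top tail \<eta>)
      ultimately have "frequently (\<lambda>n. \<eta> n \<in> U \<and> k < n \<and> (\<Sum>j. \<bar>g (j + n) (\<eta> k)\<bar>) < e / 8) sequentially"
        by (rule frequently_eventually_frequently)
      then obtain n where "\<eta> n \<in> U" "k < n" "(\<Sum>j. \<bar>g (j + n) (\<eta> k)\<bar>) < e / 8"
        using frequently_ex by fastforce
      then show ?thesis unfolding Q_def U_def by blast
    qed
    define k where "k = rec_nat k0 (\<lambda>_ k. SOME k'. Q k k')"
    have "Q (k n) (k (Suc n))" for n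
      unfolding k_def using someI_ex[OF ex] by simp
    moreover have "k 0 = k0" by (simp add: k_def)
    ultimately show ?thesis by blast
  qed
  then obtain k where k: "k 0 = k0" "\<And>n. Q (k n) (k (Suc n))" by blast
  have mono: "strict_mono k"
    using k(2) by (intro strict_monoI_Suc) (auto simp: Q_def)
  have k_ge: "n \<le> k n" for n using mono by (rule strict_mono_imp_increasing)
  have near: "\<bar>g (k i) (\<eta> (k m)) - g (k i) s\<bar> \<le> e / (8 * real m)" if im: "i < m" for i m
  proof -
    obtain m' where m': "m = Suc m'" using im by (cases m) auto
    have "k i \<le> k m'" using im m' mono by (simp add: strict_mono_less_eq)
    then have "\<bar>g (k i) (\<eta> (k m)) - g (k i) s\<bar> \<le> e / (8 * real (Suc (k m')))"
      using k(2)[of m'] unfolding Q_def m' by (intro less_imp_le) blast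
    also have "\<dots> \<le> e / (8 * real m)"
      using e k_ge[of m'] m' by (intro divide_left_mono) auto
    finally show ?thesis .
  qed
  \<comment> \<open>The thinned series is a reindexed part of the full one. Subtraction of
    \<open>n0\<close> on naturals is exact here because every index involved is at least
    \<open>k n \<ge> n0\<close>.\<close>
  have sub_tail: "summable (\<lambda>i. \<bar>g (k (i + n)) \<theta>\<bar>)"
      "k n \<ge> n0 \<Longrightarrow> (\<Sum>i. \<bar>g (k (i + n)) \<theta>\<bar>) \<le> (\<Sum>j. \<bar>g (j + n0) \<theta>\<bar>)" if "\<theta> \<in> K" for \<theta> n n0
  proof -
    have summ: "summable (\<lambda>j. \<bar>g (j + n1) \<theta>\<bar>)" for n1
      using summable_ignore_initial_segment[OF g_summ[OF that]] .
    have le: "k n \<le> k (i + n)" for i using mono by (simp add: strict_mono_less_eq)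
    have inj: "inj (\<lambda>i. k (i + n) - n1)" if "n1 \<le> k n" for n1
    proof (rule injI)
      fix i j assume "k (i + n) - n1 = k (j + n) - n1"
      then have "k (i + n) = k (j + n)"
        using le[of i] le[of j] that by linarith
      then show "i = j" using strict_mono_eq[OF mono] by simp
    qed
    have eq: "(\<lambda>j. \<bar>g (j + n1) \<theta>\<bar>) \<circ> (\<lambda>i. k (i + n) - n1) = (\<lambda>i. \<bar>g (k (i + n)) \<theta>\<bar>)" if "n1 \<le> k n" for n1
      using order_trans[OF that le] by (simp add: o_def)
    show "summable (\<lambda>i. \<bar>g (k (i + n)) \<theta>\<bar>)"
      unfolding eq[OF zero_le, symmetric] by (rule summable_reindex[OF summ inj]) auto
    show "(\<Sum>i. \<bar>g (k (i + n)) \<theta>\<bar>) \<le> (\<Sum>j. \<bar>g (j + n0) \<theta>\<bar>)" if "k n \<ge> n0"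
      unfolding eq[OF that, symmetric] by (rule suminf_reindex_mono[OF summ inj[OF that]]) auto
  qed
  have bound': "AE \<omega> in M. \<forall>N. (\<Sum>i<N. \<bar>x (k i) \<omega>\<bar>) \<le> \<zeta> \<omega>"
    using bound
  proof eventually_elim
    case (elim \<omega>)
    show ?case
    proof
      fix N
      have "(\<Sum>i<N. \<bar>x (k i) \<omega>\<bar>) = (\<Sum>j\<in>k ` {..<N}. \<bar>x j \<omega>\<bar>)"
        using strict_mono_imp_inj_on[OF mono] by (subst sum.reindex) (auto intro: inj_on_subset)
      also have "\<dots> \<le> (\<Sum>j<k N. \<bar>x j \<omega>\<bar>)"
        using mono by (intro sum_mono2) (auto simp: strict_mono_less)
      also have "\<dots> \<le> \<zeta> \<omega>" using elim by blast
      finally show "(\<Sum>i<N. \<bar>x (k i) \<omega>\<bar>) \<le> \<zeta> \<omega>" .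
    qed
  qed
  define h where "h \<theta> = pairing M \<theta> (\<lambda>\<omega>. \<Sum>i. x (k i) \<omega>)" for \<theta>
  note series' = pairing_series[of "\<lambda>i. x (k i)", OF _ \<zeta> bound', simplified]
  have h_cont: "continuous_map weak euclideanreal h"
    unfolding h_def by (intro continuous_map_pairing series'(2))
  have h_sums: "(\<lambda>i. g (k i) \<theta>) sums h \<theta>" if "\<theta> \<in> K" for \<theta>
    unfolding h_def g_def by (intro series'(4) KF that)
  \<comment> \<open>Split at index \<open>m\<close>: the earlier terms cost at most
    \<open>e / 8\<close>; the later ones together with \<open>\<bar>g (k m) s\<bar>\<close> cost at
    most \<open>e / 4\<close>; and \<open>g (k m) (\<eta> (k m)) > e\<close>. What remains is more
    than \<open>5 * e / 8\<close>.\<close>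
  have far: "h s + e / 2 \<le> h (\<eta> (k m))" for m
  proof -
    let ?t = "\<eta> (k m)"
    define d where "d i = g (k i) ?t - g (k i) s" for i
    have d: "d sums (h ?t - h s)"
      unfolding d_def by (intro sums_diff h_sums \<eta> s)
    have "(\<lambda>i. d (i + Suc m)) sums (h ?t - h s - (\<Sum>i<Suc m. d i))"
      using d by (subst sums_iff_shift) simp
    then have split: "h ?t - h s = (\<Sum>i<m. d i) + d m + (\<Sum>i. d (i + Suc m))"
      by (simp add: sums_iff)
    have 1: "\<bar>\<Sum>i<m. d i\<bar> \<le> e / 8"
    proof (cases "m = 0")
      case False
      have "\<bar>\<Sum>i<m. d i\<bar> \<le> (\<Sum>i<m. e / (8 * real m))"
        using near by (intro order_trans[OF sum_abs] sum_mono) (auto simp: d_def)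
      then show ?thesis using False by simp
    qed (use e in auto)
    have tails: "(\<Sum>i. \<bar>g (k (i + Suc m)) ?t\<bar>) \<le> e / 8"
      using sub_tail(2)[OF \<eta>, of "k (Suc m)" "Suc m" "k m"] k(2)[of m] by (simp add: Q_def)
    have s_tail: "(\<Sum>i. \<bar>g (k (i + m)) s\<bar>) \<le> e / 8"
      using sub_tail(2)[OF s(1), of k0 m] k0 k(1) strict_mono_less_eq[OF mono, of 0 m] by simp
    have s_split: "(\<Sum>i. \<bar>g (k (i + m)) s\<bar>) = \<bar>g (k m) s\<bar> + (\<Sum>i. \<bar>g (k (i + Suc m)) s\<bar>)"
      using suminf_split_head[OF sub_tail(1)[OF s(1), of m]] by simp
    have "\<bar>\<Sum>i. d (i + Suc m)\<bar> \<le> (\<Sum>i. \<bar>g (k (i + Suc m)) ?t\<bar> + \<bar>g (k (i + Suc m)) s\<bar>)"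
    proof -
      have summ: "summable (\<lambda>i. \<bar>g (k (i + Suc m)) ?t\<bar> + \<bar>g (k (i + Suc m)) s\<bar>)"
        by (intro summable_add sub_tail(1) \<eta> s)
      have dle: "\<bar>d (i + Suc m)\<bar> \<le> \<bar>g (k (i + Suc m)) ?t\<bar> + \<bar>g (k (i + Suc m)) s\<bar>" for i
        by (simp add: d_def)
      have ds: "summable (\<lambda>i. \<bar>d (i + Suc m)\<bar>)"
        by (rule summable_comparison_test'[OF summ, of 0]) (use dle in auto)
      then show ?thesis
        by (intro order_trans[OF summable_rabs] suminf_le dle summ) auto
    qed
    also have "\<dots> = (\<Sum>i. \<bar>g (k (i + Suc m)) ?t\<bar>) + (\<Sum>i. \<bar>g (k (i + Suc m)) s\<bar>)"
      by (intro suminf_add[symmetric] sub_tail(1) \<eta> s)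
    finally have 2: "\<bar>\<Sum>i. d (i + Suc m)\<bar> + \<bar>g (k m) s\<bar> \<le> e / 4"
      using tails s_tail s_split by linarith
    have "e < g (k m) ?t" using large[of "k m"] by (simp add: g_def)
    then show ?thesis
      using split 1 2 by (simp add: d_def)
  qed
  obtain y where y: "y \<in> K" "\<And>U. openin weak U \<Longrightarrow> y \<in> U \<Longrightarrow> frequently (\<lambda>m. \<eta> (k m) \<in> U) sequentially"
    using compactin_sequence_cluster_point[OF K, of "\<lambda>m. \<eta> (k m)"] \<eta> by blast
  \<comment> \<open>For fixed \<open>i\<close>, the deviations \<open>near\<close> tend to
    \<open>0\<close> in \<open>m\<close>, so \<open>y\<close> and \<open>s\<close> agree on every
    selected hump and, by summation, under \<open>h\<close>; this contradicts
    \<open>far\<close>.\<close>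
  have "g (k i) y = g (k i) s" for i
  proof (rule cluster_eq[OF g_cont _ y])
    have "(\<lambda>m. e / 8 * inverse (real m)) \<longlonglongrightarrow> e / 8 * 0"
      by (intro tendsto_mult tendsto_const lim_inverse_n)
    then have "(\<lambda>m. e / (8 * real m)) \<longlonglongrightarrow> 0"
      by (simp add: field_simps)
    then have "(\<lambda>m. g (k i) (\<eta> (k m)) - g (k i) s) \<longlonglongrightarrow> 0"
      by (rule Lim_null_comparison[rotated])
         (auto simp: eventually_sequentially intro!: exI[of _ "Suc i"] near)
    then show "(\<lambda>m. g (k i) (\<eta> (k m))) \<longlonglongrightarrow> g (k i) s"
      by (simp add: LIM_zero_iff)
  qed
  then have "h y = h s"
    using h_sums[OF y(1)] h_sums[OF s(1)] by (simp add: sums_iff)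
  have "frequently (\<lambda>m. \<eta> (k m) \<in> {w \<in> topspace weak. \<bar>h w - h y\<bar> < e / 2}) sequentially"
    using e KF[OF y(1)] by (intro y(2) continuous_map_real_open_nbhd h_cont) (auto simp: topspace_weak_topology)
  then obtain m where "\<bar>h (\<eta> (k m)) - h y\<bar> < e / 2"
    using frequently_ex by fastforce
  then show False
    using far[of m] \<open>h y = h s\<close> by linarith
qed

text \<open>The differences \<open>Z\<^sub>k - Z\<^sub>k\<^sub>'\<close> along a subsequence have sums bounded by \<open>Z\<^sub>0\<close>, so they serve as
  the humps although the \<open>Z\<^sub>n\<close> themselves are not summable in \<open>L\<^sub>\<Psi>\<close>.\<close>

lemma weakly_compact_uniformly_null:
  assumes K: "compactin weak K" and Z: "\<And>n::nat. Z n \<in> orlicz M \<Psi>"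
    and decr: "AE \<omega> in M. \<forall>n. 0 \<le> Z n \<omega> \<and> Z (Suc n) \<omega> \<le> Z n \<omega>"
    and null: "AE \<omega> in M. (\<lambda>n. Z n \<omega>) \<longlonglongrightarrow> 0" and e: "0 < (e::real)"
  shows "\<exists>N. \<forall>n\<ge>N. \<forall>\<eta>\<in>K. (LINT \<omega>|M. \<bar>\<eta> \<omega>\<bar> * Z n \<omega>) \<le> e"
proof -
  have KF: "\<theta> \<in> orlicz M \<Phi>" if "\<theta> \<in> K" for \<theta>
    using compactin_subset_topspace[OF K] that by (auto simp: topspace_weak_topology)
  have [measurable]: "Z n \<in> borel_measurable M" for n using Z by (rule E.measurable)
  define A where "A \<eta> n = (LINT \<omega>|M. \<bar>\<eta> \<omega>\<bar> * Z n \<omega>)" for \<eta> n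
  have int: "integrable M (\<lambda>\<omega>. \<bar>\<eta> \<omega>\<bar> * Z n \<omega>)" if "\<eta> \<in> K" for \<eta> n
    by (rule integrable_abs_pairing[OF KF[OF that] Z])
  have mono: "AE \<omega> in M. \<forall>m n. m \<le> n \<longrightarrow> Z n \<omega> \<le> Z m \<omega>"
    using decr by eventually_elim (auto intro: lift_Suc_antimono_le)
  have A_mono: "A \<eta> n \<le> A \<eta> m" if "m \<le> n" "\<eta> \<in> K" for m n \<eta>
    unfolding A_def
  proof (rule integral_mono_AE[OF int[OF that(2)] int[OF that(2)]])
    show "AE \<omega> in M. \<bar>\<eta> \<omega>\<bar> * Z n \<omega> \<le> \<bar>\<eta> \<omega>\<bar> * Z m \<omega>"
      using mono by eventually_elim (use that in \<open>auto intro: mult_left_mono\<close>)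
  qed
  have A_null: "A \<eta> \<longlonglongrightarrow> 0" if \<eta>: "\<eta> \<in> K" for \<eta>
  proof -
    have [measurable]: "\<eta> \<in> borel_measurable M" using KF[OF \<eta>] by (rule F.measurable)
    have "(\<lambda>n. LINT \<omega>|M. \<bar>\<eta> \<omega>\<bar> * Z n \<omega>) \<longlonglongrightarrow> (LINT \<omega>|M. 0)"
    proof (rule integral_dominated_convergence[OF _ _ int[OF \<eta>, of 0]])
      show "AE \<omega> in M. (\<lambda>n. \<bar>\<eta> \<omega>\<bar> * Z n \<omega>) \<longlonglongrightarrow> 0"
        using null by eventually_elim (auto intro: tendsto_mult_right_zero)
      show "AE \<omega> in M. norm (\<bar>\<eta> \<omega>\<bar> * Z n \<omega>) \<le> \<bar>\<eta> \<omega>\<bar> * Z 0 \<omega>" for n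
        using decr mono by eventually_elim (auto simp: abs_mult intro!: mult_left_mono)
    qed auto
    then show ?thesis by (simp add: A_def[abs_def])
  qed
  \<comment> \<open>A single index suffices, since \<open>A \<eta>\<close> is decreasing for every
    \<open>\<eta>\<close> in \<open>K\<close>.\<close>
  have "\<exists>N. \<forall>\<eta>\<in>K. A \<eta> N \<le> e"
  proof (rule ccontr)
    assume "\<not> ?thesis"
    then have "\<forall>N. \<exists>\<eta>\<in>K. e < A \<eta> N" by (simp add: not_le)
    then obtain \<eta> where \<eta>: "\<And>n. \<eta> n \<in> K" "\<And>n. e < A (\<eta> n) n" by metis
    have "\<exists>k'. k < k' \<and> A (\<eta> k) k' < e / 2" for k
    proof -
      have "eventually (\<lambda>n. k < n \<and> A (\<eta> k) n < e / 2) sequentially"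
        using e by (intro eventually_conj eventually_gt_at_top order_tendstoD(2)[OF A_null[OF \<eta>(1)]]) auto
      then show ?thesis by (auto simp: eventually_sequentially)
    qed
    \<comment> \<open>Jumping until \<open>A (\<eta> k)\<close> has dropped below
      \<open>e / 2\<close> leaves more than \<open>e / 2\<close> for the difference from
      \<open>k\<close> to \<open>nxt k\<close>, which is the size of the hump.\<close>
    then obtain nxt where nxt: "\<And>k. k < nxt k" "\<And>k. A (\<eta> k) (nxt k) < e / 2" by metis
    define k where "k = rec_nat 0 (\<lambda>_. nxt)"
    have k: "k 0 = 0" "k (Suc n) = nxt (k n)" for n by (auto simp: k_def)
    \<comment> \<open>The sign of the functional makes \<open>\<langle>\<eta>, x\<rangle>\<close> a
      difference of two values of \<open>A\<close>, and it does not affect the telescoping bound on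
      the absolute values.\<close>
    define x where "x n \<omega> = sgn (\<eta> (k n) \<omega>) * (Z (k n) \<omega> - Z (k (Suc n)) \<omega>)" for n \<omega>
    have [measurable]: "\<eta> n \<in> borel_measurable M" for n using KF[OF \<eta>(1)] by (rule F.measurable)
    have [measurable]: "x n \<in> borel_measurable M" for n unfolding x_def by measurable
    have "AE \<omega> in M. \<forall>N. (\<Sum>i<N. \<bar>x i \<omega>\<bar>) \<le> Z 0 \<omega>"
      using decr mono
    proof eventually_elim
      case (elim \<omega>)
      show ?case
      proof
        fix N
        have "(\<Sum>i<N. \<bar>x i \<omega>\<bar>) \<le> (\<Sum>i<N. Z (k i) \<omega> - Z (k (Suc i)) \<omega>)"
        proof (rule sum_mono)
          fix i
          have "Z (k (Suc i)) \<omega> \<le> Z (k i) \<omega>"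
            using elim(2) nxt(1)[of "k i"] by (simp add: k)
          then show "\<bar>x i \<omega>\<bar> \<le> Z (k i) \<omega> - Z (k (Suc i)) \<omega>"
            by (auto simp: x_def abs_mult abs_sgn_eq)
        qed
        also have "\<dots> = Z 0 \<omega> - Z (k N) \<omega>"
          using sum_lessThan_telescope'[of "\<lambda>i. Z (k i) \<omega>" N] by (simp add: k)
        also have "\<dots> \<le> Z 0 \<omega>" using elim(1) by simp
        finally show "(\<Sum>i<N. \<bar>x i \<omega>\<bar>) \<le> Z 0 \<omega>" .
      qed
    qed
    then have "\<exists>n. pairing M (\<eta> (k n)) (x n) \<le> e / 2"
      using e by (intro gliding_hump[OF K _ _ Z[of 0]] \<eta>) auto
    then obtain n where n: "pairing M (\<eta> (k n)) (x n) \<le> e / 2" by blast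
    have "pairing M (\<eta> (k n)) (x n) = A (\<eta> (k n)) (k n) - A (\<eta> (k n)) (k (Suc n))"
    proof -
      have "\<eta> (k n) \<omega> * x n \<omega> = \<bar>\<eta> (k n) \<omega>\<bar> * Z (k n) \<omega> - \<bar>\<eta> (k n) \<omega>\<bar> * Z (k (Suc n)) \<omega>" for \<omega>
        by (simp add: x_def abs_sgn algebra_simps)
      then show ?thesis
        unfolding pairing_def A_def using int[OF \<eta>(1)] by simp
    qed
    then show False
      using n \<eta>(2)[of "k n"] nxt(2)[of "k n"] by (simp add: k)
  qed
  then obtain N where N: "\<And>\<eta>. \<eta> \<in> K \<Longrightarrow> A \<eta> N \<le> e" by blast
  show ?thesis
    using N A_mono order_trans unfolding A_def by blast
qed

text \<open>The pairing maps the polar into a product of compact intervals. Linearity cuts out a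
  closed subset, and \<open>repr\<close> guarantees that this subset is exactly the image: each of
  its points is an order continuous functional and therefore a pairing.\<close>

lemma compactin_weak_polar:
  fixes p :: "('a \<Rightarrow> real) \<Rightarrow> real"
  assumes repr: "\<And>l. (\<And>x y a b. x \<in> orlicz M \<Psi> \<Longrightarrow> y \<in> orlicz M \<Psi> \<Longrightarrow>
        l (\<lambda>\<omega>. a * x \<omega> + b * y \<omega>) = a * l x + b * l y) \<Longrightarrow>
      (\<And>x. x \<in> orlicz M \<Psi> \<Longrightarrow> \<bar>l x\<bar> \<le> p x) \<Longrightarrow> oc_functional l"
  shows "compactin weak {\<eta>\<in>orlicz M \<Phi>. \<forall>\<xi>\<in>orlicz M \<Psi>. \<bar>pairing M \<eta> \<xi>\<bar> \<le> p \<xi>}" (is "compactin _ ?K")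
  unfolding weak_topology_def
proof (rule compactin_pullback_topology)
  let ?L = "orlicz M \<Psi>"
  let ?\<Theta> = "\<lambda>\<eta>. \<lambda>\<xi>\<in>?L. pairing M \<eta> \<xi>"
  let ?P = "product_topology (\<lambda>_. euclideanreal) ?L"
  define I where "I = ?L \<times> ?L \<times> (UNIV :: (real \<times> real) set)"
  \<comment> \<open>The defect of linearity for one linear combination. It depends on three
    coordinates of \<open>g\<close>, hence is continuous in the product topology, and
    \<open>T\<close> is the set where all defects vanish.\<close>
  define D where "D = (\<lambda>(x :: 'a \<Rightarrow> real, y :: 'a \<Rightarrow> real, a, b) g. g (\<lambda>\<omega>. a * x \<omega> + b * y \<omega>) - (a * g x + b * g y) :: real)"
  define T where "T = (\<Inter>i\<in>I. {g \<in> topspace ?P. D i g \<in> {0}})"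
  have D_cont: "continuous_map ?P euclideanreal (D i)" if "i \<in> I" for i
    using that unfolding I_def D_def
    by (auto intro!: continuous_intros continuous_map_product_projection E.lincomb)
  have "I \<noteq> {}" unfolding I_def using E.const[of 0] by auto
  then have "closedin ?P T"
    unfolding T_def by (intro closedin_INT closedin_continuous_map_preimage[OF D_cont]) auto
  moreover have "compactin ?P (PiE ?L (\<lambda>\<xi>. {- p \<xi>..p \<xi>}))"
    by (auto simp: compactin_PiE)
  ultimately have "compactin ?P (PiE ?L (\<lambda>\<xi>. {- p \<xi>..p \<xi>}) \<inter> T)"
    by (intro compact_Int_closedin)
  also have "PiE ?L (\<lambda>\<xi>. {- p \<xi>..p \<xi>}) \<inter> T = ?\<Theta> ` ?K"
  proof (intro antisym subsetI)
    fix g assume g: "g \<in> PiE ?L (\<lambda>\<xi>. {- p \<xi>..p \<xi>}) \<inter> T"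
    have "oc_functional g"
    proof (rule repr)
      show "g (\<lambda>\<omega>. a * x \<omega> + b * y \<omega>) = a * g x + b * g y" if "x \<in> ?L" "y \<in> ?L" for x y a b
        using g that by (auto simp: T_def I_def D_def)
      show "\<bar>g x\<bar> \<le> p x" if "x \<in> ?L" for x
        using g that by (force simp: PiE_def Pi_def abs_le_iff)
    qed
    then obtain \<eta> where \<eta>: "\<eta> \<in> orlicz M \<Phi>" "\<And>\<xi>. \<xi> \<in> ?L \<Longrightarrow> g \<xi> = pairing M \<eta> \<xi>"
      by (rule oc_functional_representation) (rule that)
    have "g = ?\<Theta> \<eta>"
      using g \<eta>(2) by (intro extensionalityI[of _ ?L]) (auto simp: PiE_def)
    moreover have "\<eta> \<in> ?K"
      using g \<eta> by (force simp: PiE_def Pi_def abs_le_iff)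
    ultimately show "g \<in> ?\<Theta> ` ?K" by blast
  next
    fix g assume "g \<in> ?\<Theta> ` ?K"
    then obtain \<eta> where \<eta>: "\<eta> \<in> ?K" "g = ?\<Theta> \<eta>" by blast
    then show "g \<in> PiE ?L (\<lambda>\<xi>. {- p \<xi>..p \<xi>}) \<inter> T"
      using E.lincomb by (auto simp: T_def I_def D_def abs_le_iff pairing_lincomb_right minus_le_iff)
  qed
  finally show "compactin ?P (?\<Theta> ` ?K)" .
qed auto

lemma absolutely_convex_polar:
  assumes p: "\<And>\<xi>. \<xi> \<in> orlicz M \<Psi> \<Longrightarrow> 0 \<le> p \<xi>"
  shows "absolutely_convex {\<eta>\<in>orlicz M \<Phi>. \<forall>\<xi>\<in>orlicz M \<Psi>. \<bar>pairing M \<eta> \<xi>\<bar> \<le> p \<xi>}"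
  unfolding absolutely_convex_def
proof (intro ballI allI impI)
  fix \<eta> \<theta> and a b :: real
  assume \<eta>: "\<eta> \<in> {\<eta>\<in>orlicz M \<Phi>. \<forall>\<xi>\<in>orlicz M \<Psi>. \<bar>pairing M \<eta> \<xi>\<bar> \<le> p \<xi>}"
    and \<theta>: "\<theta> \<in> {\<eta>\<in>orlicz M \<Phi>. \<forall>\<xi>\<in>orlicz M \<Psi>. \<bar>pairing M \<eta> \<xi>\<bar> \<le> p \<xi>}"
    and ab: "\<bar>a\<bar> + \<bar>b\<bar> \<le> 1"
  have "\<bar>a * pairing M \<eta> \<xi> + b * pairing M \<theta> \<xi>\<bar> \<le> p \<xi>" if \<xi>: "\<xi> \<in> orlicz M \<Psi>" for \<xi>
  proof -
    have "\<bar>a * pairing M \<eta> \<xi> + b * pairing M \<theta> \<xi>\<bar> \<le> \<bar>a\<bar> * \<bar>pairing M \<eta> \<xi>\<bar> + \<bar>b\<bar> * \<bar>pairing M \<theta> \<xi>\<bar>"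
      by (metis abs_mult abs_triangle_ineq)
    also have "\<dots> \<le> \<bar>a\<bar> * p \<xi> + \<bar>b\<bar> * p \<xi>"
      using \<eta> \<theta> \<xi> by (intro add_mono mult_left_mono) auto
    also have "\<dots> = (\<bar>a\<bar> + \<bar>b\<bar>) * p \<xi>" by (simp add: distrib_right)
    also have "\<dots> \<le> 1 * p \<xi>" using ab p[OF \<xi>] by (intro mult_right_mono) auto
    finally show ?thesis by simp
  qed
  then show "(\<lambda>\<omega>. a * \<eta> \<omega> + b * \<theta> \<omega>) \<in> {\<eta>\<in>orlicz M \<Phi>. \<forall>\<xi>\<in>orlicz M \<Psi>. \<bar>pairing M \<eta> \<xi>\<bar> \<le> p \<xi>}"
    using \<eta> \<theta> by (auto simp: pairing_lincomb_left F.lincomb)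
qed

end

subsection \<open>Continuity of convex functions\<close>

lemma seq_continuous_subtopology:
  assumes "seq_continuous (subtopology T S') f" "S \<subseteq> S'"
  shows "seq_continuous (subtopology T S) f"
  using assms unfolding seq_continuous_def limitin_subtopology by (auto simp: subset_iff)

lemma continuous_map_imp_seq_continuous:
  assumes "continuous_map T euclideanreal f"
  shows "seq_continuous T f"
  using continuous_map_limit[OF assms] by (auto simp: seq_continuous_def o_def)

context orlicz_duality
begin

lemma order_continuousI:
  assumes "\<And>X \<xi> \<zeta>. (\<And>n. X n \<in> orlicz M \<Psi>) \<Longrightarrow> \<xi> \<in> orlicz M \<Psi> \<Longrightarrow> \<zeta> \<in> orlicz M \<Psi> \<Longrightarrow>
      (\<And>n. AE \<omega> in M. \<bar>X n \<omega>\<bar> \<le> \<zeta> \<omega>) \<Longrightarrow> AE \<omega> in M. (\<lambda>n. X n \<omega>) \<longlonglongrightarrow> \<xi> \<omega> \<Longrightarrow>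
      (\<lambda>n. f (X n)) \<longlonglongrightarrow> f \<xi>"
  shows "order_continuous M \<Psi> f"
  unfolding order_continuous_def
proof (intro allI impI)
  fix X \<xi> assume X: "range X \<subseteq> orlicz M \<Psi>" "\<xi> \<in> orlicz M \<Psi>" "order_bounded_seq M \<Psi> X"
    "AE \<omega> in M. (\<lambda>n. X n \<omega>) \<longlonglongrightarrow> \<xi> \<omega>"
  then obtain \<zeta> where \<zeta>: "\<zeta> \<in> orlicz M \<Psi>" "AE \<omega> in M. (SUP n. ereal \<bar>X n \<omega>\<bar>) = ereal (\<zeta> \<omega>)"
    by (auto simp: order_bounded_seq_def)
  have "AE \<omega> in M. \<bar>X n \<omega>\<bar> \<le> \<zeta> \<omega>" for n
    using \<zeta>(2)
  proof eventually_elim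
    case (elim \<omega>)
    have "ereal \<bar>X n \<omega>\<bar> \<le> (SUP n. ereal \<bar>X n \<omega>\<bar>)" by (rule SUP_upper) simp
    then show ?case using elim by simp
  qed
  then show "(\<lambda>n. f (X n)) \<longlonglongrightarrow> f \<xi>"
    using X \<zeta> by (intro assms[of X \<xi> \<zeta>]) auto
qed

text \<open>\<open>order_bounded_seq\<close> wants the exact supremum in the space, while
  applications only have a dominating \<open>\<zeta>\<close>. The supremum is measurable and a.e.
  below \<open>\<zeta>\<close>, so solidity supplies membership; \<open>real_of_ereal\<close>
  chooses the value \<open>0\<close> on the null set where it is infinite.\<close>

lemma order_continuousD:
  assumes f: "order_continuous M \<Psi> f" and X: "\<And>n. X n \<in> orlicz M \<Psi>" and "\<xi> \<in> orlicz M \<Psi>"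
    and \<zeta>: "\<zeta> \<in> orlicz M \<Psi>" "\<And>n. AE \<omega> in M. \<bar>X n \<omega>\<bar> \<le> \<zeta> \<omega>"
    and "AE \<omega> in M. (\<lambda>n. X n \<omega>) \<longlonglongrightarrow> \<xi> \<omega>"
  shows "(\<lambda>n. f (X n)) \<longlonglongrightarrow> f \<xi>"
proof -
  note [measurable] = E.measurable[OF X]
  define s where "s \<omega> = real_of_ereal (SUP n. ereal \<bar>X n \<omega>\<bar>)" for \<omega>
  have "AE \<omega> in M. \<forall>n. \<bar>X n \<omega>\<bar> \<le> \<zeta> \<omega>" using \<zeta>(2) by (simp add: AE_all_countable)
  then have s: "AE \<omega> in M. (SUP n. ereal \<bar>X n \<omega>\<bar>) = ereal (s \<omega>) \<and> \<bar>s \<omega>\<bar> \<le> \<bar>\<zeta> \<omega>\<bar>"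
  proof eventually_elim
    case (elim \<omega>)
    let ?S = "SUP n. ereal \<bar>X n \<omega>\<bar>"
    have "?S \<le> ereal (\<zeta> \<omega>)" using elim by (intro SUP_least) auto
    moreover have "0 \<le> ?S" by (rule SUP_upper2[of 0]) auto
    ultimately show ?case unfolding s_def by (cases ?S) auto
  qed
  have "s \<in> orlicz M \<Psi>"
    by (rule E.solid[OF \<zeta>(1)]) (use s in \<open>auto simp: s_def[abs_def]\<close>)
  moreover have "AE \<omega> in M. (SUP n. ereal \<bar>X n \<omega>\<bar>) = ereal (s \<omega>)"
    using s by eventually_elim simp
  ultimately have "order_bounded_seq M \<Psi> X"
    by (auto simp: order_bounded_seq_def)
  then show ?thesis
    using f assms(3,6) X unfolding order_continuous_def by blast
qed

lemma real_subspace_orlicz: "real_subspace (\<lambda>c x \<omega>. c * x \<omega>) (orlicz M \<Psi>)"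
proof -
  interpret vector_space "\<lambda>(c::real) (x :: 'a \<Rightarrow> real) \<omega>. c * x \<omega>"
    by unfold_locales (auto simp: fun_eq_iff algebra_simps)
  show ?thesis
    using E.const[of 0] E.add E.scale
    by unfold_locales (auto simp: subspace_def plus_fun_def zero_fun_def)
qed

text \<open>One set \<open>K\<close>, the polar with respect to the gauge \<open>p\<close>, serves
  all \<open>\<xi>'\<close>; only the supporting functional given by Hahn-Banach depends on
  \<open>\<xi>'\<close>. The tolerance \<open>e\<close> is absorbed into the gauge, which is why the
  neighbourhood has radius \<open>1\<close>.\<close>

lemma order_continuous_mackey_nbhd:
  assumes conv: "convex_fun_on (orlicz M \<Psi>) f" and oc: "order_continuous M \<Psi> f"
    and \<xi>: "\<xi> \<in> orlicz M \<Psi>" and e: "0 < (e::real)"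
  shows "\<exists>K. compactin weak K \<and> absolutely_convex K \<and>
    (\<forall>\<xi>'\<in>orlicz M \<Psi>. (\<forall>\<eta>\<in>K. \<bar>pairing M \<eta> (\<lambda>\<omega>. \<xi>' \<omega> - \<xi> \<omega>)\<bar> < 1) \<longrightarrow> \<bar>f \<xi>' - f \<xi>\<bar> \<le> e)"
proof -
  let ?L = "orlicz M \<Psi>"
  interpret V: real_subspace "\<lambda>(c::real) (x :: 'a \<Rightarrow> real) \<omega>. c * x \<omega>" ?L
    by (rule real_subspace_orlicz)
  have fconv: "f (\<lambda>\<omega>. (1 - t) * x \<omega> + t * y \<omega>) \<le> (1 - t) * f x + t * f y"
    if "x \<in> ?L" "y \<in> ?L" "0 \<le> t" "t \<le> 1" for x y t
    using conv that by (auto simp: convex_fun_on_def)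
  \<comment> \<open>The condition \<open>h x \<le> e\<close> is membership in \<open>C\<close>. The
    maximum over both signs makes \<open>h\<close> even and keeps it convex.\<close>
  define h where "h x = max (f (\<lambda>\<omega>. \<xi> \<omega> + x \<omega>)) (f (\<lambda>\<omega>. \<xi> \<omega> - x \<omega>)) - f \<xi>" for x
  have hconv: "h (\<lambda>\<omega>. (1 - t) * x \<omega> + t * y \<omega>) \<le> (1 - t) * h x + t * h y"
    if "x \<in> ?L" "y \<in> ?L" "0 \<le> t" "t \<le> 1" for x y t
  proof -
    have "f (\<lambda>\<omega>. \<xi> \<omega> + ((1 - t) * x \<omega> + t * y \<omega>)) \<le> (1 - t) * f (\<lambda>\<omega>. \<xi> \<omega> + x \<omega>) + t * f (\<lambda>\<omega>. \<xi> \<omega> + y \<omega>)"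
      using fconv[of "\<lambda>\<omega>. \<xi> \<omega> + x \<omega>" "\<lambda>\<omega>. \<xi> \<omega> + y \<omega>" t] that \<xi> by (simp add: E.add algebra_simps)
    also have "\<dots> \<le> (1 - t) * (h x + f \<xi>) + t * (h y + f \<xi>)"
      using that by (intro add_mono mult_left_mono) (auto simp: h_def)
    finally have 1: "f (\<lambda>\<omega>. \<xi> \<omega> + ((1 - t) * x \<omega> + t * y \<omega>)) \<le> (1 - t) * (h x + f \<xi>) + t * (h y + f \<xi>)" .
    have "f (\<lambda>\<omega>. \<xi> \<omega> - ((1 - t) * x \<omega> + t * y \<omega>)) \<le> (1 - t) * f (\<lambda>\<omega>. \<xi> \<omega> - x \<omega>) + t * f (\<lambda>\<omega>. \<xi> \<omega> - y \<omega>)"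
      using fconv[of "\<lambda>\<omega>. \<xi> \<omega> - x \<omega>" "\<lambda>\<omega>. \<xi> \<omega> - y \<omega>" t] that \<xi> by (simp add: E.diff algebra_simps)
    also have "\<dots> \<le> (1 - t) * (h x + f \<xi>) + t * (h y + f \<xi>)"
      using that by (intro add_mono mult_left_mono) (auto simp: h_def)
    finally have 2: "f (\<lambda>\<omega>. \<xi> \<omega> - ((1 - t) * x \<omega> + t * y \<omega>)) \<le> (1 - t) * (h x + f \<xi>) + t * (h y + f \<xi>)" .
    show ?thesis
      using 1 2 unfolding h_def[of "\<lambda>\<omega>. (1 - t) * x \<omega> + t * y \<omega>"] by (simp add: algebra_simps)
  qed
  have h0: "h (\<lambda>\<omega>. 0) = 0" by (simp add: h_def)
  have h_even: "h (\<lambda>\<omega>. - x \<omega>) = h x" for x by (simp add: h_def max.commute)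
  have h_null: "(\<lambda>n. h (X n)) \<longlonglongrightarrow> 0"
    if X: "\<And>n::nat. X n \<in> ?L" and \<zeta>: "\<zeta> \<in> ?L" "\<And>n. AE \<omega> in M. \<bar>X n \<omega>\<bar> \<le> \<zeta> \<omega>"
      and lim: "AE \<omega> in M. (\<lambda>n. X n \<omega>) \<longlonglongrightarrow> 0" for X \<zeta>
  proof -
    have dom: "(\<lambda>\<omega>. \<bar>\<xi> \<omega>\<bar> + \<zeta> \<omega>) \<in> ?L" by (intro E.add E.abs \<xi> \<zeta>)
    have "(\<lambda>n. f (\<lambda>\<omega>. \<xi> \<omega> + X n \<omega>)) \<longlonglongrightarrow> f \<xi>"
    proof (rule order_continuousD[OF oc _ \<xi> dom])
      show "AE \<omega> in M. \<bar>\<xi> \<omega> + X n \<omega>\<bar> \<le> \<bar>\<xi> \<omega>\<bar> + \<zeta> \<omega>" for n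
        using \<zeta>(2)[of n] by eventually_elim auto
      show "AE \<omega> in M. (\<lambda>n. \<xi> \<omega> + X n \<omega>) \<longlonglongrightarrow> \<xi> \<omega>"
        using lim by eventually_elim (auto intro: tendsto_eq_intros)
    qed (intro E.add \<xi> X)
    moreover have "(\<lambda>n. f (\<lambda>\<omega>. \<xi> \<omega> - X n \<omega>)) \<longlonglongrightarrow> f \<xi>"
    proof (rule order_continuousD[OF oc _ \<xi> dom])
      show "AE \<omega> in M. \<bar>\<xi> \<omega> - X n \<omega>\<bar> \<le> \<bar>\<xi> \<omega>\<bar> + \<zeta> \<omega>" for n
        using \<zeta>(2)[of n] by eventually_elim auto
      show "AE \<omega> in M. (\<lambda>n. \<xi> \<omega> - X n \<omega>) \<longlonglongrightarrow> \<xi> \<omega>"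
        using lim by eventually_elim (auto intro: tendsto_eq_intros)
    qed (intro E.diff \<xi> X)
    ultimately have "(\<lambda>n. h (X n)) \<longlonglongrightarrow> max (f \<xi>) (f \<xi>) - f \<xi>"
      unfolding h_def by (intro tendsto_intros)
    then show ?thesis by simp
  qed
  have divL: "(\<lambda>\<omega>. x \<omega> / t) \<in> ?L" if "x \<in> ?L" for x t
    using E.scale[OF that, of "1 / t"] by simp
  define G where "G x = {t. 0 < t \<and> h (\<lambda>\<omega>. x \<omega> / t) \<le> e}" for x
  define p where "p x = Inf (G x)" for x
  \<comment> \<open>The set \<open>C\<close> is absorbing: the sequence \<open>x / (n + 1)\<close>
    is dominated by \<open>\<bar>x\<bar>\<close> and tends to \<open>0\<close>, so \<open>h\<close>
    eventually falls below \<open>e\<close> along it.\<close>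
  have G_ne: "G x \<noteq> {}" if x: "x \<in> ?L" for x
  proof -
    have "(\<lambda>n. h (\<lambda>\<omega>. x \<omega> / real (Suc n))) \<longlonglongrightarrow> 0"
    proof (rule h_null[OF divL[OF x] E.abs[OF x]])
      show "AE \<omega> in M. \<bar>x \<omega> / real (Suc n)\<bar> \<le> \<bar>x \<omega>\<bar>" for n
        using mult_left_mono[of 1 "real (Suc n)"] by (intro AE_I2) (simp add: divide_le_eq del: of_nat_Suc)
      show "AE \<omega> in M. (\<lambda>n. x \<omega> / real (Suc n)) \<longlonglongrightarrow> 0"
        by (intro AE_I2 LIMSEQ_Suc[OF lim_const_over_n])
    qed
    then have "eventually (\<lambda>n. h (\<lambda>\<omega>. x \<omega> / real (Suc n)) < e) sequentially"
      using e by (rule order_tendstoD)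
    then obtain n where "h (\<lambda>\<omega>. x \<omega> / real (Suc n)) < e" by (auto simp: eventually_sequentially)
    then have "real (Suc n) \<in> G x" by (simp add: G_def)
    then show ?thesis by blast
  qed
  have p_le: "p x \<le> t" if "t \<in> G x" for x t
    unfolding p_def by (rule cInf_lower[OF that]) (auto simp: G_def intro!: bdd_belowI[of _ 0])
  have p_ge: "c \<le> p x" if "x \<in> ?L" "\<And>t. t \<in> G x \<Longrightarrow> c \<le> t" for c x
    unfolding p_def using G_ne that by (intro cInf_greatest) auto
  have p_nonneg: "0 \<le> p x" if "x \<in> ?L" for x
    by (rule p_ge[OF that]) (simp add: G_def)
  have p_even: "p (\<lambda>\<omega>. - x \<omega>) = p x" for x
  proof -
    have "h (\<lambda>\<omega>. - x \<omega> / t) = h (\<lambda>\<omega>. x \<omega> / t)" for t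
      using h_even[of "\<lambda>\<omega>. x \<omega> / t"] by simp
    then show ?thesis by (simp add: p_def G_def)
  qed
  have p_null: "(\<lambda>n. p (X n)) \<longlonglongrightarrow> 0"
    if X: "\<And>n::nat. X n \<in> ?L" and \<zeta>: "\<zeta> \<in> ?L" "\<And>n. AE \<omega> in M. \<bar>X n \<omega>\<bar> \<le> \<zeta> \<omega>"
      and lim: "AE \<omega> in M. (\<lambda>n. X n \<omega>) \<longlonglongrightarrow> 0" for X \<zeta>
  proof (rule tendstoI)
    fix \<delta> :: real assume \<delta>: "0 < \<delta>"
    \<comment> \<open>A fixed rescaling of a dominated null sequence is again one; small
      \<open>h\<close> of the rescaled terms means that \<open>\<delta>/2\<close> belongs to
      \<open>G (X n)\<close>.\<close>
    have "(\<lambda>n. h (\<lambda>\<omega>. X n \<omega> / (\<delta>/2))) \<longlonglongrightarrow> 0"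
    proof (rule h_null[OF divL[OF X] divL[OF \<zeta>(1)]])
      show "AE \<omega> in M. \<bar>X n \<omega> / (\<delta>/2)\<bar> \<le> \<zeta> \<omega> / (\<delta>/2)" for n
        using \<zeta>(2)[of n] by eventually_elim (use \<delta> in \<open>auto simp: abs_mult field_simps\<close>)
      show "AE \<omega> in M. (\<lambda>n. X n \<omega> / (\<delta>/2)) \<longlonglongrightarrow> 0"
        using lim by eventually_elim (intro tendsto_divide_zero)
    qed
    then have "eventually (\<lambda>n. h (\<lambda>\<omega>. X n \<omega> / (\<delta>/2)) < e) sequentially"
      using e by (rule order_tendstoD)
    then show "eventually (\<lambda>n. dist (p (X n)) 0 < \<delta>) sequentially"
    proof eventually_elim
      case (elim n)
      then have "\<delta>/2 \<in> G (X n)" using \<delta> by (simp add: G_def)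
      then show ?case using p_le[of "\<delta>/2" "X n"] p_nonneg[OF X, of n] \<delta> by (simp add: dist_real_def)
    qed
  qed
  have p_sub: "V.sublinear p"
    unfolding V.sublinear_def plus_fun_def
  proof (intro conjI ballI allI impI)
    fix x c assume x: "x \<in> ?L" and c: "(0::real) < c"
    have "p (\<lambda>\<omega>. c * x \<omega>) / c \<le> p x"
    proof (rule p_ge[OF x])
      fix t assume t: "t \<in> G x"
      then have "c * t \<in> G (\<lambda>\<omega>. c * x \<omega>)" using c by (simp add: G_def)
      then show "p (\<lambda>\<omega>. c * x \<omega>) / c \<le> t" using p_le c by (force simp: field_simps)
    qed
    then show "p (\<lambda>\<omega>. c * x \<omega>) \<le> c * p x" using c by (simp add: field_simps)
  next
    fix x y assume x: "x \<in> ?L" and y: "y \<in> ?L"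
    have "p (\<lambda>\<omega>. x \<omega> + y \<omega>) - p x \<le> p y"
    proof (rule p_ge[OF y])
      fix s assume s: "s \<in> G y"
      have "p (\<lambda>\<omega>. x \<omega> + y \<omega>) - s \<le> p x"
      proof (rule p_ge[OF x])
        fix t assume t: "t \<in> G x"
        have pos: "0 < t" "0 < s" using s t by (auto simp: G_def)
        \<comment> \<open>With these weights \<open>(x + y) / (t + s)\<close> is a convex
          combination of \<open>x / t\<close> and \<open>y / s\<close>, the usual subadditivity of a
          gauge.\<close>
        define r where "r = s / (t + s)"
        have r: "0 \<le> r" "r \<le> 1" "1 - r = t / (t + s)" using pos by (auto simp: r_def field_simps)
        have "(1 - r) * (x \<omega> / t) = x \<omega> / (t + s)" for \<omega>
          unfolding r(3) using pos by simp
        moreover have "r * (y \<omega> / s) = y \<omega> / (t + s)" for \<omega>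
          unfolding r_def using pos by simp
        ultimately have "h (\<lambda>\<omega>. (x \<omega> + y \<omega>) / (t + s)) \<le> (1 - r) * h (\<lambda>\<omega>. x \<omega> / t) + r * h (\<lambda>\<omega>. y \<omega> / s)"
          using hconv[OF divL[OF x, of t] divL[OF y, of s] r(1,2)] by (simp only: add_divide_distrib)
        also have "\<dots> \<le> (1 - r) * e + r * e"
          using s t r by (intro add_mono mult_left_mono) (auto simp: G_def)
        finally have "t + s \<in> G (\<lambda>\<omega>. x \<omega> + y \<omega>)" using pos by (simp add: G_def algebra_simps)
        then show "p (\<lambda>\<omega>. x \<omega> + y \<omega>) - s \<le> t" using p_le by (simp add: diff_le_eq)
      qed
      then show "p (\<lambda>\<omega>. x \<omega> + y \<omega>) - p x \<le> s" by simp
    qed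
    then show "p (\<lambda>\<omega>. x \<omega> + y \<omega>) \<le> p x + p y" by simp
  qed
  \<comment> \<open>Some \<open>t < 1\<close> lies in \<open>G x\<close>, so \<open>x\<close> is a
    convex combination of \<open>0\<close>, where \<open>h\<close> vanishes, and
    \<open>x / t\<close>, where \<open>h\<close> is at most \<open>e\<close>.\<close>
  have p_less: "h x \<le> e" if x: "x \<in> ?L" and px: "p x < 1" for x
  proof -
    obtain t where t: "t \<in> G x" "t < 1"
      using cInf_lessD[OF G_ne[OF x], of 1] px by (auto simp: p_def)
    have "h x = h (\<lambda>\<omega>. (1 - t) * 0 + t * (x \<omega> / t))" using t by (simp add: G_def)
    also have "\<dots> \<le> (1 - t) * h (\<lambda>\<omega>. 0) + t * h (\<lambda>\<omega>. x \<omega> / t)"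
      using t by (intro hconv E.const divL[OF x]) (auto simp: G_def)
    also have "\<dots> \<le> t * e" using t by (auto simp: h0 G_def)
    also have "\<dots> \<le> 1 * e" using t e by (intro mult_right_mono) auto
    finally show ?thesis by simp
  qed
  have repr: "oc_functional l"
    if lin: "\<And>x y a b. x \<in> ?L \<Longrightarrow> y \<in> ?L \<Longrightarrow> l (\<lambda>\<omega>. a * x \<omega> + b * y \<omega>) = a * l x + b * l y"
      and le: "\<And>x. x \<in> ?L \<Longrightarrow> \<bar>l x\<bar> \<le> p x" for l
    unfolding oc_functional_def
  proof (intro conjI ballI allI impI)
    fix X \<zeta> assume X: "range X \<subseteq> ?L" and \<zeta>: "\<zeta> \<in> ?L" "\<forall>n. AE \<omega> in M. \<bar>X n \<omega>\<bar> \<le> \<zeta> \<omega>"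
      "AE \<omega> in M. (\<lambda>n. X n \<omega>) \<longlonglongrightarrow> 0"
    have "(\<lambda>n. p (X n)) \<longlonglongrightarrow> 0" using X \<zeta> by (intro p_null[of X \<zeta>]) auto
    then show "(\<lambda>n. l (X n)) \<longlonglongrightarrow> 0"
      by (rule Lim_null_comparison[rotated]) (use X le in \<open>auto intro!: always_eventually\<close>)
  qed (use lin in auto)
  let ?K = "{\<eta>\<in>orlicz M \<Phi>. \<forall>\<xi>\<in>?L. \<bar>pairing M \<eta> \<xi>\<bar> \<le> p \<xi>}"
  have "\<bar>f \<xi>' - f \<xi>\<bar> \<le> e"
    if \<xi>': "\<xi>' \<in> ?L" and small: "\<forall>\<eta>\<in>?K. \<bar>pairing M \<eta> (\<lambda>\<omega>. \<xi>' \<omega> - \<xi> \<omega>)\<bar> < 1" for \<xi>'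
  proof -
    define x where "x \<omega> = \<xi>' \<omega> - \<xi> \<omega>" for \<omega>
    have x: "x \<in> ?L" unfolding x_def by (intro E.diff \<xi> \<xi>')
    obtain l where l: "\<And>x y a b. x \<in> ?L \<Longrightarrow> y \<in> ?L \<Longrightarrow> l ((\<lambda>\<omega>. a * x \<omega>) + (\<lambda>\<omega>. b * y \<omega>)) = a * l x + b * l y"
      "\<And>x. x \<in> ?L \<Longrightarrow> l x \<le> p x" "l x = p x"
      by (rule V.hahn_banach[OF p_sub x]) (rule that)
    have lin: "l (\<lambda>\<omega>. a * x \<omega> + b * y \<omega>) = a * l x + b * l y" if "x \<in> ?L" "y \<in> ?L" for x y a b
      using l(1)[OF that] by (simp add: plus_fun_def)
    have abs_le: "\<bar>l y\<bar> \<le> p y" if "y \<in> ?L" for y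
      using l(2)[OF that] l(2)[OF E.uminus[OF that]] lin[OF that that, of "-1" 0] p_even[of y] by simp
    have "oc_functional l" using lin abs_le by (rule repr)
    then obtain \<eta> where \<eta>: "\<eta> \<in> orlicz M \<Phi>" "\<And>y. y \<in> ?L \<Longrightarrow> l y = pairing M \<eta> y"
      by (rule oc_functional_representation) (rule that)
    then have "\<eta> \<in> ?K" using abs_le by simp
    then have "p x < 1"
      using small l(3) \<eta>(2)[OF x] by (force simp: x_def[abs_def])
    then have "h x \<le> e" by (rule p_less[OF x])
    moreover have "(\<lambda>\<omega>. \<xi> \<omega> + x \<omega>) = \<xi>'" by (simp add: x_def)
    ultimately have 1: "f \<xi>' - f \<xi> \<le> e" "f (\<lambda>\<omega>. \<xi> \<omega> - x \<omega>) - f \<xi> \<le> e"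
      by (auto simp: h_def)
    \<comment> \<open>Lower estimate: \<open>\<xi>\<close> is the midpoint of \<open>\<xi>'\<close>
      and its reflection \<open>\<xi> - x\<close>, and \<open>f\<close> is at most
      \<open>f \<xi> + e\<close> at the reflection.\<close>
    have "f \<xi> = f (\<lambda>\<omega>. (1 - 1/2) * \<xi>' \<omega> + 1/2 * (\<xi> \<omega> - x \<omega>))"
      by (rule arg_cong[of _ _ f]) (simp add: x_def fun_eq_iff field_simps)
    also have "\<dots> \<le> (1 - 1/2) * f \<xi>' + 1/2 * f (\<lambda>\<omega>. \<xi> \<omega> - x \<omega>)"
      by (intro fconv \<xi>' E.diff \<xi> x) auto
    finally show ?thesis using 1 by (simp add: abs_le_iff)
  qed
  then show ?thesis
    using compactin_weak_polar[of p, OF repr] absolutely_convex_polar[of p, OF p_nonneg]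
    by (intro exI[of _ ?K]) auto
qed

lemma order_continuous_imp_mackey_continuous:
  assumes "convex_fun_on (orlicz M \<Psi>) f" "order_continuous M \<Psi> f"
  shows "continuous_map (mackey_topology M (orlicz M \<Psi>) (orlicz M \<Phi>)) euclideanreal f"
  unfolding continuous_map_def topspace_mackey_topology
proof (intro conjI allI impI)
  fix U :: "real set" assume "openin euclideanreal U"
  then have U: "open U" by simp
  show "openin (mackey_topology M (orlicz M \<Psi>) (orlicz M \<Phi>)) {x \<in> orlicz M \<Psi>. f x \<in> U}"
    unfolding openin_mackey_topology
  proof (intro conjI ballI)
    fix \<xi> assume "\<xi> \<in> {x \<in> orlicz M \<Psi>. f x \<in> U}"
    then have \<xi>: "\<xi> \<in> orlicz M \<Psi>" "f \<xi> \<in> U" by auto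
    obtain e where e: "0 < e" "cball (f \<xi>) e \<subseteq> U" using U \<xi>(2) open_contains_cball by blast
    obtain K where K: "compactin weak K" "absolutely_convex K"
      "\<And>\<xi>'. \<xi>' \<in> orlicz M \<Psi> \<Longrightarrow> (\<forall>\<eta>\<in>K. \<bar>pairing M \<eta> (\<lambda>\<omega>. \<xi>' \<omega> - \<xi> \<omega>)\<bar> < 1) \<Longrightarrow> \<bar>f \<xi>' - f \<xi>\<bar> \<le> e"
      using order_continuous_mackey_nbhd[OF assms \<xi>(1) e(1)] by blast
    have "mackey_nbhd M (orlicz M \<Psi>) {K} 1 \<xi> \<subseteq> {x \<in> orlicz M \<Psi>. f x \<in> U}"
      using K(3) e(2) by (auto simp: mackey_nbhd_def subset_iff dist_real_def abs_minus_commute)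
    then show "\<exists>\<K> \<epsilon>. finite \<K> \<and> (\<forall>K\<in>\<K>. compactin weak K \<and> absolutely_convex K) \<and>
        \<epsilon> > 0 \<and> mackey_nbhd M (orlicz M \<Psi>) \<K> \<epsilon> \<xi> \<subseteq> {x \<in> orlicz M \<Psi>. f x \<in> U}"
      using K(1,2) by (intro exI[of _ "{K}"] exI[of _ 1]) auto
  qed auto
qed auto

text \<open>Weak compactness gives uniformity only for decreasing sequences, so the differences are
  dominated by their tail suprema \<open>Z n\<close>. These remain in \<open>L\<^sub>\<Psi>\<close>
  by solidity and decrease to \<open>0\<close> a.s.; the pairings are then at most the integrals of
  \<open>\<bar>\<eta>\<bar> * Z n\<close>.\<close>

lemma mackey_limitin_of_dominated:
  assumes X: "\<And>n. X n \<in> orlicz M \<Psi>" and \<xi>: "\<xi> \<in> orlicz M \<Psi>"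
    and \<zeta>: "\<zeta> \<in> orlicz M \<Psi>" "\<And>n. AE \<omega> in M. \<bar>X n \<omega>\<bar> \<le> \<zeta> \<omega>"
    and lim: "AE \<omega> in M. (\<lambda>n. X n \<omega>) \<longlonglongrightarrow> \<xi> \<omega>"
  shows "limitin (mackey_topology M (orlicz M \<Psi>) (orlicz M \<Phi>)) X \<xi> sequentially"
proof -
  note [measurable] = E.measurable[OF X] E.measurable[OF \<xi>]
  define Z where "Z n \<omega> = real_of_ereal (SUP m\<in>{n..}. ereal \<bar>X m \<omega> - \<xi> \<omega>\<bar>)" for n \<omega>
  have [measurable]: "Z n \<in> borel_measurable M" for n unfolding Z_def by measurable
  have "AE \<omega> in M. \<forall>n. \<bar>X n \<omega>\<bar> \<le> \<zeta> \<omega>" using \<zeta>(2) by (simp add: AE_all_countable)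
  \<comment> \<open>The first two clauses say that \<open>Z n\<close> is a real least upper bound on
    a set of full measure, so the extended reals can be left behind.\<close>
  then have Z: "AE \<omega> in M. (\<forall>n. \<forall>m\<ge>n. \<bar>X m \<omega> - \<xi> \<omega>\<bar> \<le> Z n \<omega>) \<and>
      (\<forall>n c. (\<forall>m\<ge>n. \<bar>X m \<omega> - \<xi> \<omega>\<bar> \<le> c) \<longrightarrow> Z n \<omega> \<le> c) \<and> (\<forall>n. \<bar>X n \<omega> - \<xi> \<omega>\<bar> \<le> \<zeta> \<omega> + \<bar>\<xi> \<omega>\<bar>)"
  proof eventually_elim
    case (elim \<omega>)
    have b: "\<bar>X m \<omega> - \<xi> \<omega>\<bar> \<le> \<zeta> \<omega> + \<bar>\<xi> \<omega>\<bar>" for m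
      using elim[rule_format, of m] by linarith
    have eq: "ereal (Z n \<omega>) = (SUP m\<in>{n..}. ereal \<bar>X m \<omega> - \<xi> \<omega>\<bar>)" for n
    proof -
      let ?S = "SUP m\<in>{n..}. ereal \<bar>X m \<omega> - \<xi> \<omega>\<bar>"
      have "?S \<le> ereal (\<zeta> \<omega> + \<bar>\<xi> \<omega>\<bar>)" using b by (intro SUP_least) auto
      moreover have "0 \<le> ?S" by (rule SUP_upper2[of n]) auto
      ultimately show ?thesis unfolding Z_def by (cases ?S) auto
    qed
    have "\<bar>X m \<omega> - \<xi> \<omega>\<bar> \<le> Z n \<omega>" if "m \<ge> n" for m n
    proof -
      have "ereal \<bar>X m \<omega> - \<xi> \<omega>\<bar> \<le> ereal (Z n \<omega>)"
        unfolding eq using that by (intro SUP_upper) auto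
      then show ?thesis by simp
    qed
    moreover have "Z n \<omega> \<le> c" if "\<forall>m\<ge>n. \<bar>X m \<omega> - \<xi> \<omega>\<bar> \<le> c" for n c
    proof -
      have "ereal (Z n \<omega>) \<le> ereal c"
        unfolding eq using that by (intro SUP_least) auto
      then show ?thesis by simp
    qed
    ultimately show ?case using b by blast
  qed
  have ZL: "Z n \<in> orlicz M \<Psi>" for n
  proof (rule E.solid[OF E.add[OF \<zeta>(1) E.abs[OF \<xi>]]])
    show "AE \<omega> in M. \<bar>Z n \<omega>\<bar> \<le> \<bar>\<zeta> \<omega> + \<bar>\<xi> \<omega>\<bar>\<bar>"
      using Z
    proof eventually_elim
      case (elim \<omega>)
      have "0 \<le> Z n \<omega>" using elim by (meson abs_ge_zero order_refl order_trans)
      moreover have "Z n \<omega> \<le> \<zeta> \<omega> + \<bar>\<xi> \<omega>\<bar>" using elim by blast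
      ultimately show ?case by linarith
    qed
  qed auto
  have decr: "AE \<omega> in M. \<forall>n. 0 \<le> Z n \<omega> \<and> Z (Suc n) \<omega> \<le> Z n \<omega>"
    using Z
  proof eventually_elim
    case (elim \<omega>)
    show ?case
    proof (intro allI conjI)
      fix n
      show "0 \<le> Z n \<omega>" using elim by (meson abs_ge_zero order_refl order_trans)
      have "\<forall>m\<ge>Suc n. \<bar>X m \<omega> - \<xi> \<omega>\<bar> \<le> Z n \<omega>" using elim by (meson Suc_leD)
      then show "Z (Suc n) \<omega> \<le> Z n \<omega>" using elim by blast
    qed
  qed
  have null: "AE \<omega> in M. (\<lambda>n. Z n \<omega>) \<longlonglongrightarrow> 0"
    using Z decr lim
  proof eventually_elim
    case (elim \<omega>)
    show ?case
    proof (rule LIMSEQ_I)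
      fix r :: real assume r: "0 < r"
      obtain N where N: "\<forall>n\<ge>N. norm (X n \<omega> - \<xi> \<omega>) < r / 2"
        using LIMSEQ_D[OF elim(3), of "r / 2"] r by auto
      have "Z n \<omega> \<le> r / 2" if "n \<ge> N" for n
      proof -
        have "\<forall>m\<ge>n. \<bar>X m \<omega> - \<xi> \<omega>\<bar> \<le> r / 2"
          using N that by (metis less_imp_le order_trans real_norm_def)
        then show ?thesis using elim(1) by blast
      qed
      then show "\<exists>N. \<forall>n\<ge>N. norm (Z n \<omega> - 0) < r"
        using elim(2) r by (intro exI[of _ N]) force
    qed
  qed
  show ?thesis
    unfolding limitin_def topspace_mackey_topology
  proof (intro conjI allI impI \<xi>)
    fix U assume U: "openin (mackey_topology M (orlicz M \<Psi>) (orlicz M \<Phi>)) U \<and> \<xi> \<in> U"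
    then have "\<exists>\<K> \<epsilon>. finite \<K> \<and> (\<forall>K\<in>\<K>. compactin weak K \<and> absolutely_convex K) \<and>
        \<epsilon> > 0 \<and> mackey_nbhd M (orlicz M \<Psi>) \<K> \<epsilon> \<xi> \<subseteq> U"
      unfolding openin_mackey_topology by blast
    then obtain \<K> \<epsilon> where \<K>: "finite \<K>" "\<And>K. K \<in> \<K> \<Longrightarrow> compactin weak K" and \<epsilon>: "\<epsilon> > 0"
      and sub: "mackey_nbhd M (orlicz M \<Psi>) \<K> \<epsilon> \<xi> \<subseteq> U" by blast
    have "eventually (\<lambda>n. \<forall>K\<in>\<K>. \<forall>\<eta>\<in>K. (LINT \<omega>|M. \<bar>\<eta> \<omega>\<bar> * Z n \<omega>) \<le> \<epsilon> / 2) sequentially"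
      using \<K>(1)
    proof (rule eventually_ball_finite, intro ballI)
      fix K assume "K \<in> \<K>"
      then show "eventually (\<lambda>n. \<forall>\<eta>\<in>K. (LINT \<omega>|M. \<bar>\<eta> \<omega>\<bar> * Z n \<omega>) \<le> \<epsilon> / 2) sequentially"
        using weakly_compact_uniformly_null[OF \<K>(2) ZL decr null, of K "\<epsilon> / 2"] \<epsilon>
        by (auto simp: eventually_sequentially)
    qed
    then show "eventually (\<lambda>n. X n \<in> U) sequentially"
    proof eventually_elim
      case (elim n)
      have "\<bar>pairing M \<eta> (\<lambda>\<omega>. X n \<omega> - \<xi> \<omega>)\<bar> < \<epsilon>" if K: "K \<in> \<K>" "\<eta> \<in> K" for K \<eta>
      proof -
        have \<eta>: "\<eta> \<in> orlicz M \<Phi>"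
          using compactin_subset_topspace[OF \<K>(2)[OF K(1)]] K(2) by (auto simp: topspace_weak_topology)
        have int: "integrable M (\<lambda>\<omega>. \<eta> \<omega> * (X n \<omega> - \<xi> \<omega>))"
          by (intro integrable_pairing \<eta> E.diff X \<xi>)
        have "\<bar>pairing M \<eta> (\<lambda>\<omega>. X n \<omega> - \<xi> \<omega>)\<bar> \<le> (LINT \<omega>|M. \<bar>\<eta> \<omega> * (X n \<omega> - \<xi> \<omega>)\<bar>)"
          unfolding pairing_def by (rule integral_abs_bound)
        also have "\<dots> \<le> (LINT \<omega>|M. \<bar>\<eta> \<omega>\<bar> * Z n \<omega>)"
        proof (rule integral_mono_AE)
          show "AE \<omega> in M. \<bar>\<eta> \<omega> * (X n \<omega> - \<xi> \<omega>)\<bar> \<le> \<bar>\<eta> \<omega>\<bar> * Z n \<omega>"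
            using Z by eventually_elim (auto simp: abs_mult intro: mult_left_mono)
        qed (use int integrable_abs_pairing[OF \<eta> ZL] in auto)
        also have "\<dots> < \<epsilon>" using elim K \<epsilon> by force
        finally show ?thesis .
      qed
      then have "X n \<in> mackey_nbhd M (orlicz M \<Psi>) \<K> \<epsilon> \<xi>"
        using X by (auto simp: mackey_nbhd_def)
      then show ?case using sub by blast
    qed
  qed
qed

section \<open>Order intervals, balls and convergence in probability\<close>

lemma in_order_interval:
  assumes "\<xi> \<in> orlicz M \<Psi>" "AE \<omega> in M. \<bar>\<xi> \<omega>\<bar> \<le> \<zeta> \<omega>"
  shows "\<xi> \<in> order_interval M \<Psi> \<zeta>"
  using assms(1) assms(2)[THEN AE_mp] by (auto simp: order_interval_def abs_le_iff minus_le_iff)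

lemma order_intervalD:
  assumes "\<xi> \<in> order_interval M \<Psi> \<zeta>"
  shows "\<xi> \<in> orlicz M \<Psi>" "AE \<omega> in M. \<bar>\<xi> \<omega>\<bar> \<le> \<zeta> \<omega>"
  using assms by (auto simp: order_interval_def abs_le_iff minus_le_iff)

lemma AE_limit_abs_le:
  assumes "\<And>n. AE \<omega> in M. \<bar>X n \<omega>\<bar> \<le> \<zeta> \<omega>" "AE \<omega> in M. (\<lambda>n. X n \<omega>) \<longlonglongrightarrow> (\<xi> \<omega> :: real)"
  shows "AE \<omega> in M. \<bar>\<xi> \<omega>\<bar> \<le> \<zeta> \<omega>"
proof -
  have "AE \<omega> in M. \<forall>n. \<bar>X n \<omega>\<bar> \<le> \<zeta> \<omega>" using assms(1) by (simp add: AE_all_countable)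
  then show ?thesis
    using assms(2)
  proof eventually_elim
    case (elim \<omega>)
    show ?case by (rule LIMSEQ_le_const2[OF tendsto_rabs[OF elim(2)]]) (use elim(1) in auto)
  qed
qed

lemma seq_continuous_intervals_imp_order_continuous:
  assumes "\<forall>\<zeta>\<in>orlicz M \<Psi>. seq_continuous
    (subtopology (mackey_topology M (orlicz M \<Psi>) (orlicz M \<Phi>)) (order_interval M \<Psi> \<zeta>)) f"
  shows "order_continuous M \<Psi> f"
proof (rule order_continuousI)
  fix X \<xi> \<zeta> assume X: "\<And>n. X n \<in> orlicz M \<Psi>" and \<xi>: "\<xi> \<in> orlicz M \<Psi>"
    and \<zeta>: "\<zeta> \<in> orlicz M \<Psi>" "\<And>n. AE \<omega> in M. \<bar>X n \<omega>\<bar> \<le> \<zeta> \<omega>"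
    and lim: "AE \<omega> in M. (\<lambda>n. X n \<omega>) \<longlonglongrightarrow> \<xi> \<omega>"
  have X_in: "X n \<in> order_interval M \<Psi> \<zeta>" for n
    by (intro in_order_interval X \<zeta>)
  moreover have "\<xi> \<in> order_interval M \<Psi> \<zeta>"
    by (intro in_order_interval \<xi> AE_limit_abs_le[OF \<zeta>(2) lim])
  ultimately have "limitin (subtopology (mackey_topology M (orlicz M \<Psi>) (orlicz M \<Phi>)) (order_interval M \<Psi> \<zeta>)) X \<xi> sequentially"
    using mackey_limitin_of_dominated[OF X \<xi> \<zeta> lim] by (simp add: limitin_subtopology)
  then show "(\<lambda>n. f (X n)) \<longlonglongrightarrow> f \<xi>"
    using assms \<zeta>(1) X X_in unfolding seq_continuous_def
    by (auto simp: topspace_subtopology topspace_mackey_topology image_subset_iff)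
qed

lemma order_interval_subset_ball:
  assumes "\<zeta> \<in> orlicz M \<Psi>"
  obtains c where "0 < c" "order_interval M \<Psi> \<zeta> \<subseteq> orlicz_ball M \<Psi> c"
proof -
  obtain c where c: "0 < c" "\<zeta> \<in> orlicz_ball M \<Psi> c" using assms by (auto simp: orlicz_def)
  have "order_interval M \<Psi> \<zeta> \<subseteq> orlicz_ball M \<Psi> c"
  proof
    fix \<xi> assume "\<xi> \<in> order_interval M \<Psi> \<zeta>"
    note \<xi> = order_intervalD[OF this]
    have "AE \<omega> in M. \<bar>\<xi> \<omega>\<bar> \<le> \<bar>\<zeta> \<omega>\<bar>" using \<xi>(2) by eventually_elim simp
    then show "\<xi> \<in> orlicz_ball M \<Psi> c" by (rule E.ball_solid[OF c E.measurable[OF \<xi>(1)]])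
  qed
  then show ?thesis using c(1) that by blast
qed

lemma L0_limitin_of_AE:
  assumes [measurable]: "\<And>n. X n \<in> borel_measurable M" "\<xi> \<in> borel_measurable M"
    and lim: "AE \<omega> in M. (\<lambda>n. X n \<omega>) \<longlonglongrightarrow> (\<xi> \<omega> :: real)"
  shows "limitin (L0_topology M) X \<xi> sequentially"
  unfolding limitin_L0_topology[OF prob_space_axioms assms(1,2)]
proof (intro allI impI)
  fix \<epsilon> :: real assume \<epsilon>: "\<epsilon> > 0"
  have "(\<lambda>n. LINT \<omega>|M. indicator {\<omega> \<in> space M. \<bar>X n \<omega> - \<xi> \<omega>\<bar> \<ge> \<epsilon>} \<omega>) \<longlonglongrightarrow> (LINT \<omega>|M. (0::real))"
  proof (rule integral_dominated_convergence[where w = "\<lambda>_. 1"])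
    show "AE \<omega> in M. (\<lambda>n. indicator {\<omega> \<in> space M. \<bar>X n \<omega> - \<xi> \<omega>\<bar> \<ge> \<epsilon>} \<omega> :: real) \<longlonglongrightarrow> 0"
      using lim
    proof eventually_elim
      case (elim \<omega>)
      have "eventually (\<lambda>n. dist (X n \<omega>) (\<xi> \<omega>) < \<epsilon>) sequentially" using elim \<epsilon> by (rule tendstoD)
      then have "eventually (\<lambda>n. indicator {\<omega> \<in> space M. \<bar>X n \<omega> - \<xi> \<omega>\<bar> \<ge> \<epsilon>} \<omega> = (0::real)) sequentially"
        by eventually_elim (auto simp: dist_real_def indicator_def)
      then show ?case by (rule tendsto_eventually)
    qed
  qed auto
  then show "(\<lambda>n. measure M {\<omega> \<in> space M. \<bar>X n \<omega> - \<xi> \<omega>\<bar> \<ge> \<epsilon>}) \<longlonglongrightarrow> 0"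
    by simp
qed

lemma L0_continuous_imp_order_continuous:
  assumes "\<forall>\<zeta>\<in>orlicz M \<Psi>. continuous_map (subtopology (L0_topology M) (order_interval M \<Psi> \<zeta>)) euclideanreal f"
  shows "order_continuous M \<Psi> f"
proof (rule order_continuousI)
  fix X \<xi> \<zeta> assume X: "\<And>n. X n \<in> orlicz M \<Psi>" and \<xi>: "\<xi> \<in> orlicz M \<Psi>"
    and \<zeta>: "\<zeta> \<in> orlicz M \<Psi>" "\<And>n. AE \<omega> in M. \<bar>X n \<omega>\<bar> \<le> \<zeta> \<omega>"
    and lim: "AE \<omega> in M. (\<lambda>n. X n \<omega>) \<longlonglongrightarrow> \<xi> \<omega>"
  have "X n \<in> order_interval M \<Psi> \<zeta>" for n
    by (intro in_order_interval X \<zeta>)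
  moreover have "\<xi> \<in> order_interval M \<Psi> \<zeta>"
    by (intro in_order_interval \<xi> AE_limit_abs_le[OF \<zeta>(2) lim])
  ultimately have "limitin (subtopology (L0_topology M) (order_interval M \<Psi> \<zeta>)) X \<xi> sequentially"
    using L0_limitin_of_AE[OF E.measurable[OF X] E.measurable[OF \<xi>] lim] by (simp add: limitin_subtopology)
  then have "limitin euclideanreal (f \<circ> X) (f \<xi>) sequentially"
    using assms \<zeta>(1) by (intro continuous_map_limit) auto
  then show "(\<lambda>n. f (X n)) \<longlonglongrightarrow> f \<xi>" by (simp add: o_def)
qed

text \<open>Continuity is checked by sequences, which suffices because convergence in probability
  has a countable base of balls at each point. A sequence converging fast in probability converges
  a.s. by Borel-Cantelli, and inside the interval it is dominated by \<open>\<zeta>\<close>.\<close>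

lemma order_continuous_imp_L0_continuous:
  assumes oc: "order_continuous M \<Psi> f" and \<zeta>: "\<zeta> \<in> orlicz M \<Psi>"
  shows "continuous_map (subtopology (L0_topology M) (order_interval M \<Psi> \<zeta>)) euclideanreal f"
  unfolding continuous_map_def
proof (intro conjI allI impI)
  let ?I = "order_interval M \<Psi> \<zeta>"
  let ?B = "\<lambda>\<xi> \<epsilon>. {\<eta> \<in> borel_measurable M. measure M {\<omega> \<in> space M. \<bar>\<eta> \<omega> - \<xi> \<omega>\<bar> \<ge> \<epsilon>} < \<epsilon>}"
  have I: "?I \<subseteq> borel_measurable M" using order_intervalD E.measurable by blast
  have top: "topspace (subtopology (L0_topology M) ?I) = ?I"
    using I by (auto simp: topspace_subtopology topspace_L0_topology[OF prob_space_axioms])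
  fix U :: "real set" assume "openin euclideanreal U"
  then have U: "open U" by simp
  define C where "C = {\<eta> \<in> ?I. f \<eta> \<notin> U}"
  \<comment> \<open>The interior of the complement of the bad set \<open>C\<close>; halving the
    radius shows that it is open. Its trace on the interval will be the preimage of
    \<open>U\<close>.\<close>
  define T where "T = {\<eta> \<in> borel_measurable M. \<exists>\<epsilon>>0. ?B \<eta> \<epsilon> \<inter> C = {}}"
  have "openin (L0_topology M) T"
    unfolding openin_L0_topology[OF prob_space_axioms]
  proof (intro conjI ballI)
    fix \<eta> assume "\<eta> \<in> T"
    then obtain \<epsilon> where \<epsilon>: "\<epsilon> > 0" "?B \<eta> \<epsilon> \<inter> C = {}" and [measurable]: "\<eta> \<in> borel_measurable M"
      by (auto simp: T_def)
    have "?B \<eta> (\<epsilon>/2) \<subseteq> T"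
    proof
      fix \<eta>' assume "\<eta>' \<in> ?B \<eta> (\<epsilon>/2)"
      then have [measurable]: "\<eta>' \<in> borel_measurable M" and \<eta>': "measure M {\<omega> \<in> space M. \<bar>\<eta>' \<omega> - \<eta> \<omega>\<bar> \<ge> \<epsilon>/2} < \<epsilon>/2"
        by auto
      have "?B \<eta>' (\<epsilon>/2) \<subseteq> ?B \<eta> \<epsilon>"
      proof
        fix \<theta> assume "\<theta> \<in> ?B \<eta>' (\<epsilon>/2)"
        then have [measurable]: "\<theta> \<in> borel_measurable M" and \<theta>: "measure M {\<omega> \<in> space M. \<bar>\<theta> \<omega> - \<eta>' \<omega>\<bar> \<ge> \<epsilon>/2} < \<epsilon>/2"
          by auto
        have "measure M {\<omega> \<in> space M. \<bar>\<theta> \<omega> - \<eta> \<omega>\<bar> \<ge> \<epsilon>} \<le>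
            measure M ({\<omega> \<in> space M. \<bar>\<theta> \<omega> - \<eta>' \<omega>\<bar> \<ge> \<epsilon>/2} \<union> {\<omega> \<in> space M. \<bar>\<eta>' \<omega> - \<eta> \<omega>\<bar> \<ge> \<epsilon>/2})"
        proof (intro finite_measure_mono subsetI)
          fix \<omega> assume "\<omega> \<in> {\<omega> \<in> space M. \<bar>\<theta> \<omega> - \<eta> \<omega>\<bar> \<ge> \<epsilon>}"
          moreover have "\<bar>\<theta> \<omega> - \<eta> \<omega>\<bar> \<le> \<bar>\<theta> \<omega> - \<eta>' \<omega>\<bar> + \<bar>\<eta>' \<omega> - \<eta> \<omega>\<bar>"
            by linarith
          ultimately show "\<omega> \<in> {\<omega> \<in> space M. \<bar>\<theta> \<omega> - \<eta>' \<omega>\<bar> \<ge> \<epsilon>/2} \<union> {\<omega> \<in> space M. \<bar>\<eta>' \<omega> - \<eta> \<omega>\<bar> \<ge> \<epsilon>/2}"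
            by auto
        qed auto
        also have "\<dots> \<le> measure M {\<omega> \<in> space M. \<bar>\<theta> \<omega> - \<eta>' \<omega>\<bar> \<ge> \<epsilon>/2} + measure M {\<omega> \<in> space M. \<bar>\<eta>' \<omega> - \<eta> \<omega>\<bar> \<ge> \<epsilon>/2}"
          by (intro measure_Un_le) auto
        also have "\<dots> < \<epsilon>" using \<theta> \<eta>' by linarith
        finally show "\<theta> \<in> ?B \<eta> \<epsilon>" by simp
      qed
      then show "\<eta>' \<in> T" using \<epsilon> by (auto simp: T_def intro!: exI[of _ "\<epsilon>/2"])
    qed
    then show "\<exists>\<epsilon>>0. ?B \<eta> \<epsilon> \<subseteq> T" using \<epsilon>(1) by (intro exI[of _ "\<epsilon>/2"]) auto
  qed (auto simp: T_def)
  moreover have "{\<eta> \<in> ?I. f \<eta> \<in> U} = T \<inter> ?I"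
  proof (intro antisym subsetI)
    fix \<eta> assume "\<eta> \<in> T \<inter> ?I"
    then obtain \<epsilon> where \<epsilon>: "\<epsilon> > 0" "?B \<eta> \<epsilon> \<inter> C = {}" and \<eta>: "\<eta> \<in> ?I" by (auto simp: T_def)
    have "\<eta> \<in> ?B \<eta> \<epsilon>" using \<epsilon>(1) I \<eta> by auto
    then show "\<eta> \<in> {\<eta> \<in> ?I. f \<eta> \<in> U}" using \<epsilon>(2) \<eta> by (auto simp: C_def)
  next
    fix \<eta> assume "\<eta> \<in> {\<eta> \<in> ?I. f \<eta> \<in> U}"
    then have \<eta>: "\<eta> \<in> ?I" "f \<eta> \<in> U" by auto
    have [measurable]: "\<eta> \<in> borel_measurable M" using \<eta>(1) I by blast
    have "\<eta> \<in> T"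
    proof (rule ccontr)
      assume "\<eta> \<notin> T"
      then have ne: "?B \<eta> \<epsilon> \<inter> C \<noteq> {}" if "0 < \<epsilon>" for \<epsilon>
        using that by (auto simp: T_def)
      \<comment> \<open>The radii \<open>(1/2) ^ n\<close> bound both the deviation and its
        probability: summability feeds Borel-Cantelli, and their convergence to \<open>0\<close>
        gives the a.s. limit.\<close>
      define X where "X n = (SOME \<theta>. \<theta> \<in> ?B \<eta> ((1/2) ^ n) \<inter> C)" for n :: nat
      have X: "X n \<in> ?B \<eta> ((1/2) ^ n) \<inter> C" for n
        unfolding X_def some_in_eq by (rule ne) simp
      have XI: "X n \<in> ?I" for n using X[of n] by (simp add: C_def)
      have [measurable]: "X n \<in> borel_measurable M" for n using X[of n] by simp
      have "AE \<omega> in M. eventually (\<lambda>n. \<omega> \<in> space M - {\<omega> \<in> space M. \<bar>X n \<omega> - \<eta> \<omega>\<bar> \<ge> (1/2) ^ n}) sequentially"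
      proof (rule borel_cantelli_AE1)
        show "summable (\<lambda>n. measure M {\<omega> \<in> space M. \<bar>X n \<omega> - \<eta> \<omega>\<bar> \<ge> (1/2) ^ n})"
          by (rule summable_comparison_test'[of "\<lambda>n. (1/2) ^ n" 0])
             (use X in \<open>auto simp: summable_geometric_iff intro: less_imp_le\<close>)
      qed (auto simp: less_top[symmetric])
      then have lim: "AE \<omega> in M. (\<lambda>n. X n \<omega>) \<longlonglongrightarrow> \<eta> \<omega>"
      proof eventually_elim
        case (elim \<omega>)
        then have "eventually (\<lambda>n. norm (X n \<omega> - \<eta> \<omega>) \<le> (1/2) ^ n) sequentially"
          by eventually_elim auto
        then have "(\<lambda>n. X n \<omega> - \<eta> \<omega>) \<longlonglongrightarrow> 0"
          by (rule Lim_null_comparison) (auto intro: LIMSEQ_power_zero)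
        then show ?case by (simp add: LIM_zero_iff)
      qed
      have "(\<lambda>n. f (X n)) \<longlonglongrightarrow> f \<eta>"
        using order_intervalD[OF XI] order_intervalD[OF \<eta>(1)] \<zeta> lim
        by (intro order_continuousD[OF oc, of X \<eta> \<zeta>])
      then have "eventually (\<lambda>n. f (X n) \<in> U) sequentially"
        using U \<eta>(2) by (rule topological_tendstoD)
      then show False
        using X by (auto simp: C_def eventually_sequentially)
    qed
    then show "\<eta> \<in> T \<inter> ?I" using \<eta> by simp
  qed
  ultimately show "openin (subtopology (L0_topology M) ?I) {x \<in> topspace (subtopology (L0_topology M) ?I). f x \<in> U}"
    unfolding top openin_subtopology by blast
qed auto

end

theorem theorem4p5:
  fixes M :: "'a measure" and \<Phi> :: "real \<Rightarrow> real" and f :: "('a \<Rightarrow> real) \<Rightarrow> real"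
  defines "\<Psi> \<equiv> young_conjugate \<Phi>"
  defines "L \<equiv> orlicz M \<Psi>"
  defines "\<tau> \<equiv> mackey_topology M L (orlicz M \<Phi>)"
  assumes "prob_space M"
    and "young_function \<Phi>"
    and "Delta2 \<Phi>"
    and "ae_invariant_on M L f"
    and "convex_fun_on L f"
  shows "(continuous_map \<tau> euclideanreal f
            \<longleftrightarrow> seq_continuous \<tau> f)
       \<and> (seq_continuous \<tau> f
            \<longleftrightarrow> (\<forall>c>0. seq_continuous (subtopology \<tau> (orlicz_ball M \<Psi> c)) f))
       \<and> ((\<forall>c>0. seq_continuous (subtopology \<tau> (orlicz_ball M \<Psi> c)) f)
            \<longleftrightarrow> (\<forall>\<zeta>\<in>L. seq_continuous (subtopology \<tau> (order_interval M \<Psi> \<zeta>)) f))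
       \<and> ((\<forall>\<zeta>\<in>L. seq_continuous (subtopology \<tau> (order_interval M \<Psi> \<zeta>)) f)
            \<longleftrightarrow> (\<forall>\<zeta>\<in>L. continuous_map (subtopology (L0_topology M) (order_interval M \<Psi> \<zeta>))
                   euclideanreal f))
       \<and> ((\<forall>\<zeta>\<in>L. continuous_map (subtopology (L0_topology M) (order_interval M \<Psi> \<zeta>))
                   euclideanreal f)
            \<longleftrightarrow> order_continuous M \<Psi> f)"
proof -
  interpret orlicz_duality M \<Phi>
    using assms(4,5) by (simp add: orlicz_duality_def orlicz_duality_axioms_def)
  \<comment> \<open>Conditions (1) to (4) and order continuity are linked in a cycle that returns to
    (1) through the Mackey neighbourhood lemma; continuity in probability on intervals is tied to
    order continuity separately.\<close>
  have 12: "seq_continuous \<tau> f" if "continuous_map \<tau> euclideanreal f"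
    using that by (rule continuous_map_imp_seq_continuous)
  have 23: "\<forall>c>0. seq_continuous (subtopology \<tau> (orlicz_ball M \<Psi> c)) f" if "seq_continuous \<tau> f"
    using seq_continuous_subtopology[of \<tau> UNIV f] that by simp
  have 34: "\<forall>\<zeta>\<in>L. seq_continuous (subtopology \<tau> (order_interval M \<Psi> \<zeta>)) f"
    if "\<forall>c>0. seq_continuous (subtopology \<tau> (orlicz_ball M \<Psi> c)) f"
    using that seq_continuous_subtopology order_interval_subset_ball unfolding L_def \<Psi>_def by metis
  have 46: "order_continuous M \<Psi> f" if "\<forall>\<zeta>\<in>L. seq_continuous (subtopology \<tau> (order_interval M \<Psi> \<zeta>)) f"
    using that seq_continuous_intervals_imp_order_continuous unfolding \<tau>_def L_def \<Psi>_def by blast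
  have 61: "continuous_map \<tau> euclideanreal f" if "order_continuous M \<Psi> f"
    using that assms(8) order_continuous_imp_mackey_continuous unfolding \<tau>_def L_def \<Psi>_def by blast
  have 56: "(\<forall>\<zeta>\<in>L. continuous_map (subtopology (L0_topology M) (order_interval M \<Psi> \<zeta>)) euclideanreal f)
      \<longleftrightarrow> order_continuous M \<Psi> f"
    using L0_continuous_imp_order_continuous order_continuous_imp_L0_continuous unfolding L_def \<Psi>_def by blast
  show ?thesis
    using 12 23 34 46 61 56 by blast
qed

end
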